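(* Let $p,n$ be positive integers such that $p=n^{c+o(1)}$ for some constant $c>0$, and let $s=p^{\alpha+o(1)}$ with $\alpha\in(1/2,1)$. Consider the Gaussian additive model $Y=\sqrt\lambda X+Z$ in $\mathbb R^{n\times p}$ (identified with $\mathbb R^{np}$) with $X=\mathrm{vec}(\xi\mu^\top)$, where $\xi=(\xi_1,\dots,\xi_n)$ has i.i.d. uniform $\pm1$ entries and, independently, $\mu_j=b_jg_j$ for $j=1,\dots,p$ with $b_j\sim\mathrm{Ber}(s/p)$ and $g_j\sim N(0,1)$ all independent (sparse clustering with separation parameter $\Delta$, where $\lambda=\Delta/s$). Let $\lambda_{\mathrm{ALG}}=\widetilde\Theta(\sqrt{p/(s^2n)})$ and $D_n=\lfloor(1-\alpha)\log n\rfloor$. Then, for $\lambda=\Delta/s$, $$\mathrm{MMSE}^{\le D_n}_X\!\left(\frac1{\log^4n}\Big(\lambda+\frac{d}{dq}\mathcal F_{\mathrm{ann},\lambda}(q)\Big|_{q=q(D_n)}\Big)\right)=ns-\widetilde O\big(s\sqrt{n/p}\big)=(1+o(1))\,\mathrm{MMSE}^{\mathrm{trivial}}_X.$$ In particular, for some $\lambda=\widetilde\Theta(\sqrt{p/(s^2n)})=\widetilde\Theta(\lambda_{\mathrm{ALG}})$ we have $\frac{d}{dq}\mathcal F_{\mathrm{ann},\lambda}(q)\big|_{q=q(D_n)}\ge0$, and therefore $$\mathrm{MMSE}^{\le D_n}_X\big(\widetilde\Theta(\lambda_{\mathrm{ALG}})\big)\ge(1+o(1))\,\mathrm{MMSE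}^{\mathrm{trivial}}_X.$$
   Context: In the Gaussian additive model, $Z$ is a standard Gaussian vector independent of $X$ and $\lambda$ is the signal-to-noise ratio. (This is the rescaled form of the two-component Gaussian mixture with rows $Y_i=\xi_i\bar\mu+z_i$, where $\bar\mu_j=b_j\bar g_j$, $\bar g_j\sim N(0,\Delta/s)$; the signal is divided by $\sqrt{\Delta/s}$.) Low-degree MMSE: with $\mathbb R[Y]_{\le D}$ the polynomials in $Y$ of total degree at most $D$, $\mathrm{MMSE}^{\le D}_X(\lambda):=\inf_{f_j\in\mathbb R[Y]_{\le D}}\mathbb E\big[\sum_j(f_j(Y)-X_j)^2\big]$, where $Y=\sqrt\lambda X+Z$ and $j$ ranges over the coordinates of $X$. $\mathrm{MMSE}^{\mathrm{trivial}}_X:=\mathbb E\|X\|^2-\|\mathbb E X\|^2$ is the mean squared error of the best constant estimator. Overlap quantile: for i.i.d. copies $X,X'$ and $D>0$, $q(D):=\inf\{y:\mathbb P(|\langle X,X'\rangle|\le y)\ge1-e^{-D}\}$. Annealed Franz–Parisi potential: for $q\ne0$, $\mathcal F_{\mathrm{ann},\lambda}(q)=-\lambda q-\log f(q)$, where $f$ is the density on $\mathbb R\setminus\{0\}$ of (the absolutely continuous part of) $\langle X,X'\rangle$ (formally $-\log\mathbb E[1_{\langle X,X'\rangle=q}e^{\lambda\langle X,X'\rangle}]$). Asymptotics are as $n\to\infty$; $\widetilde O,\widetilde\Theta$ hide factors polylogarithmic in $n$. *)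

theory Defs
  imports "HOL-Probability.Probability" "HOL-Library.Landau_Symbols"
begin

section \<open>Gaussian additive model and low-degree MMSE\<close>

text \<open>
  A prior is the law \<open>P\<close> on \<open>'i \<Rightarrow> real\<close> of a signal \<open>X\<close> whose coordinates are indexed by a
  finite set \<open>I\<close>; only the coordinates in \<open>I\<close> matter.
\<close>

definition gaussian_noise :: "'i set \<Rightarrow> ('i \<Rightarrow> real) measure" where
  "gaussian_noise I = PiM I (\<lambda>_. density lborel std_normal_density)"

definition observation :: "real \<Rightarrow> ('i \<Rightarrow> real) \<Rightarrow> ('i \<Rightarrow> real) \<Rightarrow> 'i \<Rightarrow> real" where
  "observation lam x z = (\<lambda>i. sqrt lam * x i + z i)"

text \<open>Exponent vectors supported on \<open>I\<close> of total degree at most \<open>D\<close>.\<close>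

definition exponents_le :: "'i set \<Rightarrow> nat \<Rightarrow> ('i \<Rightarrow> nat) set" where
  "exponents_le I D = {\<alpha>. (\<forall>i. i \<notin> I \<longrightarrow> \<alpha> i = 0) \<and> (\<Sum>i\<in>I. \<alpha> i) \<le> D}"

definition polys_le :: "'i set \<Rightarrow> nat \<Rightarrow> (('i \<Rightarrow> real) \<Rightarrow> real) set" where
  "polys_le I D = {f. \<exists>c :: ('i \<Rightarrow> nat) \<Rightarrow> real.
     f = (\<lambda>y. \<Sum>\<alpha>\<in>exponents_le I D. c \<alpha> * (\<Prod>i\<in>I. y i ^ \<alpha> i))}"

text \<open>
  The expectation is a Bochner integral, which is \<open>0\<close> on non-integrable functions; the
  definition is meant for priors all of whose moments are finite.
\<close>

definition mmse_le :: "'i set \<Rightarrow> ('i \<Rightarrow> real) measure \<Rightarrow> nat \<Rightarrow> real \<Rightarrow> real" where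
  "mmse_le I P D lam =
     Inf {(\<integral>(x, z). (\<Sum>j\<in>I. (f j (observation lam x z) - x j)\<^sup>2) \<partial>(P \<Otimes>\<^sub>M gaussian_noise I))
          | f. \<forall>j\<in>I. f j \<in> polys_le I D}"

definition mmse_trivial :: "'i set \<Rightarrow> ('i \<Rightarrow> real) measure \<Rightarrow> real" where
  "mmse_trivial I P =
     (\<integral>x. (\<Sum>j\<in>I. (x j)\<^sup>2) \<partial>P) - (\<Sum>j\<in>I. (\<integral>x. x j \<partial>P)\<^sup>2)"

section \<open>Overlap and annealed Franz-Parisi potential\<close>

definition overlap_law :: "'i set \<Rightarrow> ('i \<Rightarrow> real) measure \<Rightarrow> real measure" where
  "overlap_law I P = distr (P \<Otimes>\<^sub>M P) borel (\<lambda>(x, x'). \<Sum>j\<in>I. x j * x' j)"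

definition overlap_quantile :: "real measure \<Rightarrow> real \<Rightarrow> real" where
  "overlap_quantile L D = Inf {y. measure L {t. \<bar>t\<bar> \<le> y} \<ge> 1 - exp (- D)}"

text \<open>
  \<open>f\<close> is the density of \<open>L\<close> away from \<open>0\<close>, where \<open>L\<close> may have an atom. A density is only
  determined almost everywhere, whereas the potential needs its pointwise values and derivative;
  continuity selects the version, which is unique off \<open>0\<close>.
\<close>

definition is_density_off_0 :: "real measure \<Rightarrow> (real \<Rightarrow> real) \<Rightarrow> bool" where
  "is_density_off_0 L f \<longleftrightarrow>
     (\<forall>x. 0 \<le> f x) \<and> continuous_on (- {0}) f \<and>
     (\<forall>A\<in>sets borel. 0 \<notin> A \<longrightarrow> emeasure L A = (\<integral>\<^sup>+x\<in>A. ennreal (f x) \<partial>lborel))"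

definition density_off_0 :: "real measure \<Rightarrow> real \<Rightarrow> real" where
  "density_off_0 L = (SOME f. is_density_off_0 L f)"

definition franz_parisi_ann :: "real measure \<Rightarrow> real \<Rightarrow> real \<Rightarrow> real" where
  "franz_parisi_ann L lam q = - lam * q - ln (density_off_0 L q)"

section \<open>The sparse clustering prior\<close>

definition rademacher :: "real pmf" where
  "rademacher = pmf_of_set {-1, 1}"

text \<open>
  Law of the matrix with entries \<open>\<xi>\<^sub>i b\<^sub>j g\<^sub>j\<close> for \<open>i < n\<close>, \<open>j < p\<close>, the coordinates of
  \<open>vec(\<xi> \<mu>\<^sup>T)\<close> being indexed by the pairs \<open>(i, j)\<close>. The second component of a sample point is
  the family of pairs \<open>(b\<^sub>j, g\<^sub>j)\<close>. Meaningful for \<open>0 \<le> s \<le> p\<close>.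
\<close>

definition sparse_clustering_prior :: "nat \<Rightarrow> nat \<Rightarrow> real \<Rightarrow> (nat \<times> nat \<Rightarrow> real) measure" where
  "sparse_clustering_prior n p s =
     distr
       (PiM {..<n} (\<lambda>_. measure_pmf rademacher) \<Otimes>\<^sub>M
        PiM {..<p} (\<lambda>_. measure_pmf (bernoulli_pmf (s / real p)) \<Otimes>\<^sub>M
                        density lborel std_normal_density))
       (PiM ({..<n} \<times> {..<p}) (\<lambda>_. borel))
       (\<lambda>(\<xi>, bg). \<lambda>(i, j)\<in>{..<n} \<times> {..<p}. \<xi> i * (of_bool (fst (bg j)) * snd (bg j)))"

section \<open>Asymptotics up to polylogarithmic factors\<close>

definition soft_O :: "(nat \<Rightarrow> real) \<Rightarrow> (nat \<Rightarrow> real) set" where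
  "soft_O g = {f. \<exists>k::nat. f \<in> O(\<lambda>n. g n * ln (real n) ^ k)}"

text \<open>
  As for the library's \<open>\<Theta>\<close>, only absolute values are compared; signs are to be stated separately.
\<close>

definition soft_Theta :: "(nat \<Rightarrow> real) \<Rightarrow> (nat \<Rightarrow> real) set" where
  "soft_Theta g =
     {f. \<exists>k::nat. f \<in> O(\<lambda>n. g n * ln (real n) ^ k) \<and> f \<in> \<Omega>(\<lambda>n. g n / ln (real n) ^ k)}"

end

theory Submission
  imports Defs "HOL-Computational_Algebra.Polynomial" "HOL-Real_Asymp.Real_Asymp"
begin

text \<open>
  Given the labels, the supports and one of the two replicas, the overlap of the sparse clustering
  prior is a centred Gaussian with random variance \<open>W\<close>, so its density off \<open>0\<close> is
  \<open>f(t) = E[\<phi>\<^sub>W(t); W > 0]\<close> and \<open>- f'(q) / f(q) = q E[\<phi>\<^sub>W(q) / W] / E[\<phi>\<^sub>W(q)]\<close>. The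
  signal-to-noise ratio in the theorem is this quantity divided by \<open>log\<^sup>4 n\<close>; in particular \<open>\<Delta>\<close> cancels.
  With \<open>w = n s\<^sup>2 / p\<close> one has \<open>E W \<ge> w\<close> and \<open>E W\<^sup>k \<le> (C k w)\<^sup>k\<close> for \<open>k \<lesssim> s\<^sup>2 / p\<close>. The
  second moment method and Markov's inequality give \<open>\<surd>w \<lesssim> q(D) \<lesssim> D \<surd>w\<close>, and splitting
  the two expectations at \<open>W \<approx> w\<close> and at \<open>W \<approx> D\<^sup>3 w\<close> yields
  \<open>1 / (D\<^sup>3 \<surd>w) \<lesssim> - f'(q) / f(q) \<lesssim> D / \<surd>w\<close>.

  For the low-degree error, a function \<open>U\<close> of the noise with \<open>E[f(Y) U] = E[f(Y) X\<^sub>j]\<close> for all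
  polynomials \<open>f\<close> of degree at most \<open>D\<close> shows \<open>E (f(Y) - X\<^sub>j)\<^sup>2 \<ge> E X\<^sub>j\<^sup>2 - E U\<^sup>2\<close>. Its Hermite
  coefficients are joint cumulants of \<open>X\<close>. The moments \<open>M(\<beta>)\<close> of this prior are nonnegative and satisfy
  \<open>M(\<beta>) M(\<gamma>) \<le> M(\<beta> + \<gamma>)\<close>, which bounds the cumulants by \<open>(|\<beta>| + 1)\<^bsup>|\<beta>|\<^esup> M(\<beta> + e\<^sub>j)\<close>; the
  multinomial theorem then resums everything to
  \<open>\<Sum>\<^sub>j E U\<^sub>j\<^sup>2 \<le> \<Sum>\<^bsub>d \<le> D\<^esub> \<lambda>\<^sup>d (d + 1)\<^bsup>2d\<^esup> / d! E \<langle>X, X'\<rangle>\<^bsup>d + 1\<^esup>\<close>, which the moment bounds on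
  \<open>W\<close> control by \<open>\<surd>w\<close> up to logarithms.
\<close>

section \<open>Hermite polynomials\<close>

text \<open>Cumulants enter because pairing Hermite polynomials of the observation with Hermite
  polynomials of the noise gives a triangular system, and they are its solution. The cut at D^3 has
  this reason: at the quantile q one only knows q^2 / w <= C D^2, so the density there may be as
  small as exp (- C D^2). To discard large W, Markov's inequality must be applied at an order that
  exceeds every multiple of D^2, and D^3 is such an order. It is admissible because \<alpha> > 1/2
  makes s^2 / p a power of n while D is logarithmic. The fourth power of the logarithm comes from
  the other bound: the low-degree series is harmless once lam * sqrt w * D^2 is below a constant,
  and - f' / f is at most of order D / sqrt w. This costs three logarithms, and the fourth absorbs
  the constant. The mixture form also settles well-definedness: its density is differentiable off 0
  by construction, and continuity makes every other admissible version agree with it.\<close>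

lemma prob_space_std_normal: "prob_space std_normal_distribution"
  by (simp add: prob_space_normal_density)

text \<open>Integration by parts for monomials, read off here from the closed formula for the even
  moments. At \<open>k = 0\<close> the truncated \<open>k - 1\<close> is multiplied by 0.\<close>

lemma std_normal_moment_Suc:
  "(\<integral>z. z ^ Suc k \<partial>std_normal_distribution) = real k * (\<integral>z. z ^ (k - 1) \<partial>std_normal_distribution)"
proof (cases "even k")
  case True
  show ?thesis
  proof (cases "k = 0")
    case True
    then show ?thesis using integral_std_normal_distribution_moment_odd[of 1] by simp
  next
    case False
    then have "odd (k - 1)" "odd (Suc k)" using True by auto
    then show ?thesis
      by (simp add: integral_std_normal_distribution_moment_odd del: power_Suc)
  qed
next
  case False
  then obtain m where k: "k = 2 * m + 1" by (elim oddE)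
  have "fact (2 * Suc m) / (2 ^ Suc m * fact (Suc m)) = real k * (fact (2 * m) / (2 ^ m * fact m))"
  proof -
    have "fact (2 * Suc m) = 2 * (real m + 1) * (2 * real m + 1) * fact (2 * m)"
      by (simp add: algebra_simps)
    moreover have "fact (Suc m) = (real m + 1) * fact m"
      by (simp add: algebra_simps)
    moreover have "real m + 1 \<noteq> 0"
      by linarith
    ultimately show ?thesis
      unfolding k by (simp add: divide_simps del: fact_Suc)
  qed
  then have "(\<integral>z. z ^ (2 * Suc m) \<partial>std_normal_distribution)
    = real k * (\<integral>z. z ^ (2 * m) \<partial>std_normal_distribution)"
    by (simp only: std_normal_distribution_even_moments)
  then show ?thesis unfolding k by simp
qed

lemma integrable_std_normal_poly: "integrable std_normal_distribution (\<lambda>z. poly p z)"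
  unfolding poly_altdef
  by (intro Bochner_Integration.integrable_sum integrable_mult_right integrable_std_normal_distribution_moment)

lemma integrable_std_normal_poly_mult:
  "integrable std_normal_distribution (\<lambda>z. poly p z * poly q z)"
  using integrable_std_normal_poly[of "p * q"] by simp

text \<open>Stein's identity. For polynomials it follows from the moment recursion by linearity, so
  no boundary terms have to be discussed.\<close>

lemma std_normal_integration_by_parts:
  "(\<integral>z. z * poly p z \<partial>std_normal_distribution) = (\<integral>z. poly (pderiv p) z \<partial>std_normal_distribution)"
proof -
  \<comment> \<open>The factor \<open>z ^ k\<close> is carried along because reading
    \<open>pCons a p\<close> as a + z p raises the power by one.\<close>
  have "(\<integral>z. z ^ Suc k * poly p z \<partial>std_normal_distribution) =
      (\<integral>z. real k * z ^ (k - 1) * poly p z + z ^ k * poly (pderiv p) z \<partial>std_normal_distribution)" for k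
  proof (induction p arbitrary: k)
    case 0
    then show ?case by simp
  next
    case (pCons a p)
    have int: "integrable std_normal_distribution (\<lambda>z. z ^ i * poly q z)" for i q
      using integrable_std_normal_poly[of "monom 1 i * q"] by (simp add: poly_monom)
    have int': "integrable std_normal_distribution (\<lambda>z. c * z ^ i * poly q z)" for c i q
      using integrable_std_normal_poly[of "monom c i * q"] by (simp add: poly_monom)
    have int'': "integrable std_normal_distribution (\<lambda>z. c * z ^ i)" for c i
      using integrable_std_normal_poly[of "monom c i"] by (simp add: poly_monom)
    have "(\<integral>z. z ^ Suc k * poly (pCons a p) z \<partial>std_normal_distribution)
       = (\<integral>z. a * z ^ Suc k + z ^ Suc (Suc k) * poly p z \<partial>std_normal_distribution)"
      by (rule Bochner_Integration.integral_cong) (auto simp: algebra_simps)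
    also have "\<dots> = a * (\<integral>z. z ^ Suc k \<partial>std_normal_distribution) +
       (\<integral>z. z ^ Suc (Suc k) * poly p z \<partial>std_normal_distribution)"
      by (subst Bochner_Integration.integral_add)
        (auto intro!: int int'' integrable_std_normal_distribution_moment simp del: power_Suc)
    also have "\<dots> = (\<integral>z. a * (real k * z ^ (k - 1)) \<partial>std_normal_distribution) +
       (\<integral>z. real (Suc k) * z ^ k * poly p z + z ^ Suc k * poly (pderiv p) z \<partial>std_normal_distribution)"
      by (simp only: std_normal_moment_Suc pCons.IH) simp
    also have "\<dots> = (\<integral>z. a * (real k * z ^ (k - 1)) + (real (Suc k) * z ^ k * poly p z +
         z ^ Suc k * poly (pderiv p) z) \<partial>std_normal_distribution)"
    proof (rule Bochner_Integration.integral_add[symmetric])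
      show "integrable std_normal_distribution (\<lambda>z. a * (real k * z ^ (k - 1)))"
        using int''[of "a * real k" "k - 1"] by (simp add: mult.assoc)
    qed (auto intro!: int' int Bochner_Integration.integrable_add simp del: power_Suc of_nat_Suc)
    also have "\<dots> = (\<integral>z. real k * z ^ (k - 1) * poly (pCons a p) z +
         z ^ k * poly (pderiv (pCons a p)) z \<partial>std_normal_distribution)"
      by (rule Bochner_Integration.integral_cong, simp, cases k)
        (auto simp: pderiv_pCons algebra_simps)
    finally show ?case .
  qed
  from this[of 0] show ?thesis by simp
qed

text \<open>The probabilists' Hermite polynomials. The recursion applies z - d/dz, the adjoint of
  d/dz in L^2 of the standard normal law, so inner products are computed by differentiating the
  other factor.\<close>

fun hermite :: "nat \<Rightarrow> real poly" where
  "hermite 0 = 1"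
| "hermite (Suc k) = pCons 0 (hermite k) - pderiv (hermite k)"

text \<open>The operators d/dz and z - d/dz have commutator 1, so differentiating the recursion
  reproduces it one degree lower plus one extra copy of \<open>hermite (Suc k)\<close>.\<close>

lemma pderiv_hermite_Suc: "pderiv (hermite (Suc k)) = smult (real (Suc k)) (hermite k)"
proof (induction k)
  case 0
  then show ?case by (simp add: pderiv_pCons)
next
  case (Suc k)
  have "pderiv (hermite (Suc (Suc k))) =
      hermite (Suc k) + pCons 0 (pderiv (hermite (Suc k))) - pderiv (pderiv (hermite (Suc k)))"
    by (simp only: hermite.simps(2)[of "Suc k"] pderiv_diff pderiv_pCons)
  also have "\<dots> = hermite (Suc k) + smult (real (Suc k)) (pCons 0 (hermite k) - pderiv (hermite k))"
    by (simp only: Suc pderiv_smult smult_diff_right) (simp add: smult_diff_right)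
  also have "\<dots> = smult (real (Suc (Suc k))) (hermite (Suc k))"
    by (simp only: hermite.simps(2)[symmetric] of_nat_Suc smult_add_left) simp
  finally show ?case .
qed

lemma poly_hermite_Suc_shift:
  "poly (hermite (Suc k)) y = y * poly (hermite k) y - poly (pderiv (hermite k)) y"
  by simp

text \<open>Adjointness of z - d/dz and d/dz. It survives the shift by the signal because p (x + z)
  is again a polynomial in z with derivative p' (x + z).\<close>

lemma std_normal_integration_by_parts_shift:
  "(\<integral>z. poly p (x + z) * poly (hermite (Suc k)) z \<partial>std_normal_distribution) =
   (\<integral>z. poly (pderiv p) (x + z) * poly (hermite k) z \<partial>std_normal_distribution)"
proof -
  define r where "r = pcompose p [:x, 1:]"
  have r: "poly r z = poly p (x + z)" "poly (pderiv r) z = poly (pderiv p) (x + z)" for z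
    by (simp_all add: r_def poly_pcompose pderiv_pcompose pderiv_pCons)
  have "(\<integral>z. poly r z * poly (hermite (Suc k)) z \<partial>std_normal_distribution) =
    (\<integral>z. z * poly (r * hermite k) z - poly (r * pderiv (hermite k)) z \<partial>std_normal_distribution)"
    by (rule Bochner_Integration.integral_cong) (auto simp: algebra_simps)
  also have "\<dots> = (\<integral>z. z * poly (r * hermite k) z \<partial>std_normal_distribution) -
     (\<integral>z. poly (r * pderiv (hermite k)) z \<partial>std_normal_distribution)"
    using integrable_std_normal_poly[of "pCons 0 (r * hermite k)"]
    by (subst Bochner_Integration.integral_diff) (auto intro: integrable_std_normal_poly simp del: poly_mult)
  also have "\<dots> = (\<integral>z. poly (pderiv r) z * poly (hermite k) z \<partial>std_normal_distribution)"
    unfolding std_normal_integration_by_parts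
    by (subst Bochner_Integration.integral_diff[symmetric])
      (auto intro!: integrable_std_normal_poly Bochner_Integration.integral_cong
        simp: pderiv_mult algebra_simps simp del: poly_mult simp: poly_mult)
  finally show ?thesis by (simp only: r)
qed

text \<open>Hermite polynomials undo the noise: with h the previous one at x + z, the next one is x
  h + (z h - h'), and the bracket integrates to 0 by Stein's identity.\<close>

lemma hermite_shift_mean:
  "(\<integral>z. poly (hermite j) (x + z) \<partial>std_normal_distribution) = x ^ j"
proof (induction j)
  case 0
  interpret prob_space std_normal_distribution by (rule prob_space_std_normal)
  show ?case using prob_space by simp
next
  case (Suc j)
  define r where "r = pcompose (hermite j) [:x, 1:]"
  have r: "poly r z = poly (hermite j) (x + z)" "poly (pderiv r) z = poly (pderiv (hermite j)) (x + z)" for z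
    by (simp_all add: r_def poly_pcompose pderiv_pcompose pderiv_pCons)
  have "(\<integral>z. poly (hermite (Suc j)) (x + z) \<partial>std_normal_distribution) =
    (\<integral>z. x * poly r z + (z * poly r z - poly (pderiv r) z) \<partial>std_normal_distribution)"
    by (rule Bochner_Integration.integral_cong) (auto simp: r algebra_simps)
  also have "\<dots> = x * (\<integral>z. poly r z \<partial>std_normal_distribution) +
      ((\<integral>z. z * poly r z \<partial>std_normal_distribution) - (\<integral>z. poly (pderiv r) z \<partial>std_normal_distribution))"
    using integrable_std_normal_poly[of "pCons 0 r"] integrable_std_normal_poly[of r]
      integrable_std_normal_poly[of "pderiv r"] by simp
  also have "\<dots> = x ^ Suc j"
    by (simp only: std_normal_integration_by_parts) (simp add: r Suc)
  finally show ?case .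
qed

text \<open>Each step of \<open>k\<close> differentiates the other factor once. For j < k the
  binomial coefficient vanishes, so the truncated \<open>j - k\<close> is harmless; this
  triangularity is what makes the dual function computable.\<close>

lemma hermite_shift_inner:
  "(\<integral>z. poly (hermite j) (x + z) * poly (hermite k) z \<partial>std_normal_distribution) =
   fact k * real (j choose k) * x ^ (j - k)"
proof (induction k arbitrary: j)
  case 0
  then show ?case by (simp add: hermite_shift_mean)
next
  case (Suc k)
  show ?case
  proof (cases j)
    case 0
    then show ?thesis
      by (subst std_normal_integration_by_parts_shift) (simp add: pderiv_1)
  next
    case (Suc i)
    have "(\<integral>z. poly (hermite j) (x + z) * poly (hermite (Suc k)) z \<partial>std_normal_distribution) =
      real (Suc i) * (\<integral>z. poly (hermite i) (x + z) * poly (hermite k) z \<partial>std_normal_distribution)"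
      unfolding Suc std_normal_integration_by_parts_shift pderiv_hermite_Suc
      by (simp only: poly_smult mult.assoc) simp
    also have "\<dots> = fact k * (real (Suc i) * real (i choose k)) * x ^ (i - k)"
      by (simp add: Suc.IH)
    also have "real (Suc i) * real (i choose k) = real (Suc k) * real (Suc i choose Suc k)"
      by (simp only: of_nat_mult[symmetric] Suc_times_binomial)
    finally show ?thesis unfolding Suc by simp
  qed
qed

text \<open>Three-term recurrence z He_k = He_(k+1) + k He_(k-1). What matters is that no index
  exceeds \<open>a\<close>, so that total degrees do not grow.\<close>

lemma power_hermite_expansion: "\<exists>c. \<forall>y::real. y ^ a = (\<Sum>k\<le>a. c k * poly (hermite k) y)"
proof (induction a)
  case 0
  show ?case by (rule exI[of _ "\<lambda>_. 1"]) simp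
next
  case (Suc a)
  then obtain c where c: "\<And>y. y ^ a = (\<Sum>k\<le>a. c k * poly (hermite k) y)" by auto
  define c' where "c' k = (if k = 0 then 0 else c (k - 1)) + (if Suc k \<le> a then real (Suc k) * c (Suc k) else 0)" for k
  have rec: "y * poly (hermite k) y = poly (hermite (Suc k)) y + real k * poly (hermite (k - 1)) y" for k and y :: real
    by (cases k) (simp_all add: pderiv_hermite_Suc del: hermite.simps(2) add: poly_hermite_Suc_shift)
  have "y ^ Suc a = (\<Sum>k\<le>Suc a. c' k * poly (hermite k) y)" for y
  proof -
    have "y ^ Suc a = (\<Sum>k\<le>a. c k * poly (hermite (Suc k)) y) + (\<Sum>k\<le>a. real k * c k * poly (hermite (k - 1)) y)"
      by (simp add: c sum_distrib_left sum.distrib[symmetric] mult.left_commute[of y] rec algebra_simps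
          del: hermite.simps)
    also have "(\<Sum>k\<le>a. c k * poly (hermite (Suc k)) y) = 
       (\<Sum>k\<le>Suc a. (if k = 0 then 0 else c (k - 1)) * poly (hermite k) y)"
      by (subst sum.atMost_Suc_shift) (simp del: hermite.simps)
    also have "(\<Sum>k\<le>a. real k * c k * poly (hermite (k - 1)) y) = 
      (\<Sum>k\<le>Suc a. (if Suc k \<le> a then real (Suc k) * c (Suc k) else 0) * poly (hermite k) y)"
    proof (cases a)
      case 0
      then show ?thesis by simp
    next
      case (Suc b)
      show ?thesis unfolding Suc
        by (subst sum.atMost_Suc_shift) (auto intro!: sum.cong simp del: hermite.simps)
    qed
    finally show ?thesis by (simp only: c'_def distrib_right sum.distrib)
  qed
  then show ?case by auto
qed

section \<open>Random variables with all moments\<close>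

text \<open>Integrability is not stable under products, but having all absolute moments is, since 2
  a b \<le> a^2 + b^2. The class contains every polynomial expression in labels, entries and noise
  and so settles integrability side conditions uniformly.\<close>

definition all_moments :: "'a measure \<Rightarrow> ('a \<Rightarrow> real) \<Rightarrow> bool" where
  "all_moments M F \<longleftrightarrow> F \<in> borel_measurable M \<and> (\<forall>k::nat. integrable M (\<lambda>x. \<bar>F x\<bar> ^ k))"

lemma all_moments_measurable: "all_moments M F \<Longrightarrow> F \<in> borel_measurable M"
  by (simp add: all_moments_def)

lemma all_moments_integrable: "all_moments M F \<Longrightarrow> integrable M F"
proof -
  assume F: "all_moments M F"
  then have "integrable M (\<lambda>x. \<bar>F x\<bar> ^ 1)"
    unfolding all_moments_def by blast
  then show "integrable M F"
    using all_moments_measurable[OF F] by (auto intro: integrable_abs_cancel)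
qed

context finite_measure
begin

lemma all_moments_const: "all_moments M (\<lambda>_. c)"
  by (simp add: all_moments_def)

lemma all_moments_add:
  assumes "all_moments M F" "all_moments M G"
  shows "all_moments M (\<lambda>x. F x + G x)"
  unfolding all_moments_def
proof (intro conjI allI)
  show meas: "(\<lambda>x. F x + G x) \<in> borel_measurable M"
    using assms by (auto simp: all_moments_def)
  fix k :: nat
  have bound: "\<bar>a + b\<bar> ^ k \<le> 2 ^ k * (\<bar>a\<bar> ^ k + \<bar>b\<bar> ^ k)" for a b :: real
  proof -
    have "\<bar>a + b\<bar> ^ k \<le> (2 * max \<bar>a\<bar> \<bar>b\<bar>) ^ k"
      by (rule power_mono) auto
    also have "\<dots> = 2 ^ k * max \<bar>a\<bar> \<bar>b\<bar> ^ k" by (simp add: power_mult_distrib)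
    also have "\<dots> \<le> 2 ^ k * (\<bar>a\<bar> ^ k + \<bar>b\<bar> ^ k)"
      by (intro mult_left_mono) (auto simp: max_def)
    finally show ?thesis .
  qed
  show "integrable M (\<lambda>x. \<bar>F x + G x\<bar> ^ k)"
  proof (rule Bochner_Integration.integrable_bound)
    show "integrable M (\<lambda>x. 2 ^ k * (\<bar>F x\<bar> ^ k + \<bar>G x\<bar> ^ k))"
      using assms by (auto simp: all_moments_def)
  qed (use meas bound in \<open>auto intro!: AE_I2\<close>)
qed

lemma all_moments_mult:
  assumes "all_moments M F" "all_moments M G"
  shows "all_moments M (\<lambda>x. F x * G x)"
  unfolding all_moments_def
proof (intro conjI allI)
  show meas: "(\<lambda>x. F x * G x) \<in> borel_measurable M"
    using assms by (auto simp: all_moments_def)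
  fix k :: nat
  have bound: "\<bar>a * b\<bar> ^ k \<le> \<bar>a\<bar> ^ (2 * k) + \<bar>b\<bar> ^ (2 * k)" for a b :: real
  proof -
    have "2 * (\<bar>a\<bar> ^ k * \<bar>b\<bar> ^ k) \<le> (\<bar>a\<bar> ^ k)\<^sup>2 + (\<bar>b\<bar> ^ k)\<^sup>2"
      using sum_squares_bound[of "\<bar>a\<bar> ^ k" "\<bar>b\<bar> ^ k"] by (simp add: mult.assoc)
    moreover have "0 \<le> \<bar>a\<bar> ^ k * \<bar>b\<bar> ^ k" by simp
    ultimately have "\<bar>a\<bar> ^ k * \<bar>b\<bar> ^ k \<le> (\<bar>a\<bar> ^ k)\<^sup>2 + (\<bar>b\<bar> ^ k)\<^sup>2" by linarith
    then show ?thesis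
      by (simp add: abs_mult power_mult_distrib power_mult[symmetric] mult.commute[of k])
  qed
  show "integrable M (\<lambda>x. \<bar>F x * G x\<bar> ^ k)"
  proof (rule Bochner_Integration.integrable_bound)
    show "integrable M (\<lambda>x. \<bar>F x\<bar> ^ (2 * k) + \<bar>G x\<bar> ^ (2 * k))"
      using assms unfolding all_moments_def by (intro Bochner_Integration.integrable_add) blast+
    show "(\<lambda>x. \<bar>F x * G x\<bar> ^ k) \<in> borel_measurable M" using meas by measurable
    show "AE x in M. norm (\<bar>F x * G x\<bar> ^ k) \<le> norm (\<bar>F x\<bar> ^ (2 * k) + \<bar>G x\<bar> ^ (2 * k))"
    proof (rule AE_I2)
      fix x
      have "0 \<le> \<bar>F x\<bar> ^ (2 * k) + \<bar>G x\<bar> ^ (2 * k)" by simp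
      then show "norm (\<bar>F x * G x\<bar> ^ k) \<le> norm (\<bar>F x\<bar> ^ (2 * k) + \<bar>G x\<bar> ^ (2 * k))"
        using bound[of "F x" "G x"] by (simp only: real_norm_def abs_of_nonneg power_abs abs_abs)
    qed
  qed
qed

lemma all_moments_diff:
  "all_moments M F \<Longrightarrow> all_moments M G \<Longrightarrow> all_moments M (\<lambda>x. F x - G x)"
  using all_moments_add[OF _ all_moments_mult[OF all_moments_const[of "-1"]], of F G] by simp

lemma all_moments_power: "all_moments M F \<Longrightarrow> all_moments M (\<lambda>x. F x ^ k)"
proof (induction k)
  case (Suc k)
  then show ?case using all_moments_mult[of F "\<lambda>x. F x ^ k"] by simp
qed (simp add: all_moments_const)

lemma all_moments_sum:
  "(\<And>i. i \<in> A \<Longrightarrow> all_moments M (F i)) \<Longrightarrow> all_moments M (\<lambda>x. \<Sum>i\<in>A. F i x)"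
proof (induction A rule: infinite_finite_induct)
  case (insert a A)
  then show ?case using all_moments_add[of "F a" "\<lambda>x. \<Sum>i\<in>A. F i x"] by simp
qed (simp_all add: all_moments_const)

lemma all_moments_prod:
  "(\<And>i. i \<in> A \<Longrightarrow> all_moments M (F i)) \<Longrightarrow> all_moments M (\<lambda>x. \<Prod>i\<in>A. F i x)"
proof (induction A rule: infinite_finite_induct)
  case (insert a A)
  then show ?case using all_moments_mult[of "F a" "\<lambda>x. \<Prod>i\<in>A. F i x"] by simp
qed (simp_all add: all_moments_const)

lemma all_moments_poly: "all_moments M F \<Longrightarrow> all_moments M (\<lambda>x. poly p (F x))"
  unfolding poly_altdef
  by (rule all_moments_sum) (rule all_moments_mult[OF all_moments_const all_moments_power])

end

lemma all_moments_distr: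
  assumes "g \<in> measurable M N" "F \<in> borel_measurable N"
  shows "all_moments (distr M N g) F \<longleftrightarrow> all_moments M (\<lambda>x. F (g x))"
proof -
  have "integrable (distr M N g) (\<lambda>x. \<bar>F x\<bar> ^ k) \<longleftrightarrow> integrable M (\<lambda>x. \<bar>F (g x)\<bar> ^ k)" for k
    using assms by (subst integrable_distr_eq) auto
  then show ?thesis using assms by (auto simp: all_moments_def)
qed

lemma all_moments_fst:
  assumes "all_moments M F" "prob_space N"
  shows "all_moments (M \<Otimes>\<^sub>M N) (\<lambda>w. F (fst w))"
proof -
  interpret N: prob_space N by fact
  have "distr (M \<Otimes>\<^sub>M N) M fst = M"
    by (rule N.distr_pair_fst)
  with assms(1) show ?thesis
    by (metis all_moments_distr all_moments_measurable measurable_fst)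
qed

lemma all_moments_snd:
  assumes "all_moments N F" "prob_space M" "prob_space N"
  shows "all_moments (M \<Otimes>\<^sub>M N) (\<lambda>w. F (snd w))"
proof -
  interpret M: prob_space M by fact
  interpret N: prob_space N by fact
  have "distr (M \<Otimes>\<^sub>M N) N snd = N"
  proof (rule measure_eqI)
    fix A assume "A \<in> sets (distr (M \<Otimes>\<^sub>M N) N snd)"
    then have A: "A \<in> sets N" by simp
    then have "snd -` A \<inter> space (M \<Otimes>\<^sub>M N) = space M \<times> A"
      using sets.sets_into_space by (auto simp: space_pair_measure)
    then show "emeasure (distr (M \<Otimes>\<^sub>M N) N snd) A = emeasure N A"
      using A by (simp add: emeasure_distr N.emeasure_pair_measure_Times M.emeasure_space_1)
  qed simp
  with assms(1) show ?thesis
    by (metis all_moments_distr all_moments_measurable measurable_snd)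
qed

lemma all_moments_PiM_component:
  assumes "prob_space N" "i \<in> I" "all_moments N F"
  shows "all_moments (PiM I (\<lambda>_. N)) (\<lambda>x. F (x i))"
proof -
  interpret N: prob_space N by fact
  interpret product_prob_space "\<lambda>_. N" I ..
  have "distr (PiM I (\<lambda>_. N)) N (\<lambda>x. x i) = N"
    using PiM_component[OF assms(2)] by simp
  with all_moments_distr[OF measurable_component_singleton[OF assms(2)] all_moments_measurable[OF assms(3)]] assms(3)
  show ?thesis by simp
qed

section \<open>Exponent vectors\<close>

text \<open>Exponent vectors are total functions forced to be 0 off \<open>I\<close>, so that every
  monomial is represented exactly once.\<close>

definition exponents_below :: "'i set \<Rightarrow> ('i \<Rightarrow> nat) \<Rightarrow> ('i \<Rightarrow> nat) set" where
  "exponents_below I \<beta> = {\<gamma>. (\<forall>i\<in>I. \<gamma> i \<le> \<beta> i) \<and> (\<forall>i. i \<notin> I \<longrightarrow> \<gamma> i = 0)}"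

definition exponents_eq :: "'i set \<Rightarrow> nat \<Rightarrow> ('i \<Rightarrow> nat) set" where
  "exponents_eq I d = {\<beta>. (\<forall>i. i \<notin> I \<longrightarrow> \<beta> i = 0) \<and> sum \<beta> I = d}"

text \<open>Products of sums expand over \<open>PiE\<close>, whose members are
  \<open>undefined\<close> off \<open>I\<close>; this passes to the convention 0 off
  \<open>I\<close>.\<close>

lemma exponents_below_reindex:
  fixes g :: "('i \<Rightarrow> nat) \<Rightarrow> 'a :: comm_monoid_add"
  assumes "\<And>\<gamma> \<gamma>'. (\<And>i. i \<in> I \<Longrightarrow> \<gamma> i = \<gamma>' i) \<Longrightarrow> g \<gamma> = g \<gamma>'"
  shows "(\<Sum>\<gamma>\<in>PiE I (\<lambda>i. {..\<beta> i}). g \<gamma>) = (\<Sum>\<gamma>\<in>exponents_below I \<beta>. g \<gamma>)"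
proof (rule sum.reindex_bij_witness[where i = "\<lambda>\<gamma>. restrict \<gamma> I" and j = "\<lambda>\<gamma> i. if i \<in> I then \<gamma> i else 0"])
  fix \<gamma> assume "\<gamma> \<in> PiE I (\<lambda>i. {..\<beta> i})"
  then show "restrict (\<lambda>i. if i \<in> I then \<gamma> i else 0) I = \<gamma>"
    by (auto simp: fun_eq_iff PiE_def extensional_def)
  show "(\<lambda>i. if i \<in> I then \<gamma> i else 0) \<in> exponents_below I \<beta>"
    using \<open>\<gamma> \<in> _\<close> by (auto simp: exponents_below_def PiE_def Pi_def)
  show "g (\<lambda>i. if i \<in> I then \<gamma> i else 0) = g \<gamma>"
    by (rule assms) auto
next
  fix \<gamma> assume \<gamma>: "\<gamma> \<in> exponents_below I \<beta>"
  then show "(\<lambda>i. if i \<in> I then restrict \<gamma> I i else 0) = \<gamma>"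
    by (auto simp: fun_eq_iff exponents_below_def)
  show "restrict \<gamma> I \<in> PiE I (\<lambda>i. {..\<beta> i})"
    using \<gamma> by (auto simp: exponents_below_def)
qed

lemma prod_sum_exponents_below:
  fixes f :: "'i \<Rightarrow> nat \<Rightarrow> 'a :: comm_semiring_1"
  assumes "finite I"
  shows "(\<Prod>i\<in>I. \<Sum>k\<le>\<beta> i. f i k) = (\<Sum>\<gamma>\<in>exponents_below I \<beta>. \<Prod>i\<in>I. f i (\<gamma> i))"
proof -
  have "(\<Prod>i\<in>I. \<Sum>k\<le>\<beta> i. f i k) = (\<Sum>\<gamma>\<in>PiE I (\<lambda>i. {..\<beta> i}). \<Prod>i\<in>I. f i (\<gamma> i))"
    using assms by (rule prod_sum_PiE) auto
  also have "\<dots> = (\<Sum>\<gamma>\<in>exponents_below I \<beta>. \<Prod>i\<in>I. f i (\<gamma> i))"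
    by (rule exponents_below_reindex) (auto intro!: prod.cong)
  finally show ?thesis .
qed

lemma finite_exponents_le: "finite I \<Longrightarrow> finite (exponents_le I D)"
proof -
  assume I: "finite I"
  have "exponents_le I D \<subseteq> {\<gamma>. \<forall>i. (i \<in> I \<longrightarrow> \<gamma> i \<in> {..D}) \<and> (i \<notin> I \<longrightarrow> \<gamma> i = 0)}"
  proof
    fix \<gamma> assume \<gamma>: "\<gamma> \<in> exponents_le I D"
    have "\<gamma> i \<le> D" if "i \<in> I" for i
      using member_le_sum[of i I \<gamma>] that I \<gamma> by (simp add: exponents_le_def)
    with \<gamma> show "\<gamma> \<in> {\<gamma>. \<forall>i. (i \<in> I \<longrightarrow> \<gamma> i \<in> {..D}) \<and> (i \<notin> I \<longrightarrow> \<gamma> i = 0)}"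
      by (simp add: exponents_le_def)
  qed
  then show ?thesis
    by (rule finite_subset) (intro finite_set_of_finite_funs I finite_atMost)
qed

lemma exponents_below_subset_exponents_le:
  assumes "sum \<beta> I \<le> D"
  shows "exponents_below I \<beta> \<subseteq> exponents_le I D"
proof
  fix \<gamma> assume \<gamma>: "\<gamma> \<in> exponents_below I \<beta>"
  then have "sum \<gamma> I \<le> sum \<beta> I"
    by (intro sum_mono) (simp add: exponents_below_def)
  with \<gamma> assms show "\<gamma> \<in> exponents_le I D"
    by (simp add: exponents_le_def exponents_below_def)
qed

lemma finite_exponents_below:
  assumes "finite I"
  shows "finite (exponents_below I \<beta>)"
  by (rule finite_subset[OF exponents_below_subset_exponents_le[OF order_refl] finite_exponents_le[OF assms]])

lemma exponents_le_Union: "exponents_le I D = (\<Union>d\<le>D. exponents_eq I d)"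
  by (auto simp: exponents_le_def exponents_eq_def)

lemma finite_exponents_eq: "finite I \<Longrightarrow> finite (exponents_eq I d)"
  by (rule finite_subset[OF _ finite_exponents_le[of I d]]) (auto simp: exponents_le_Union)

lemma sum_exponents_le:
  fixes f :: "('i \<Rightarrow> nat) \<Rightarrow> 'a :: comm_monoid_add"
  assumes "finite I"
  shows "(\<Sum>\<beta>\<in>exponents_le I D. f \<beta>) = (\<Sum>d\<le>D. \<Sum>\<beta>\<in>exponents_eq I d. f \<beta>)"
  unfolding exponents_le_Union using assms
  by (intro sum.UNION_disjoint) (auto simp: finite_exponents_eq, auto simp: exponents_eq_def)

text \<open>Splitting off one coordinate a identifies \<beta> with the pair of \<beta> a and
  \<open>\<beta>(a := 0)\<close>; with the factorials as denominators the binomial theorem then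
  factors without further coefficients.\<close>

lemma multinomial_theorem:
  fixes y :: "'i \<Rightarrow> real"
  assumes "finite I"
  shows "(\<Sum>i\<in>I. y i) ^ d / fact d = (\<Sum>\<beta>\<in>exponents_eq I d. \<Prod>i\<in>I. y i ^ \<beta> i / fact (\<beta> i))"
  using assms
proof (induction I arbitrary: d)
  case empty
  have "exponents_eq {} d = (if d = 0 then {\<lambda>_. 0} else ({} :: ('i \<Rightarrow> nat) set))"
    by (auto simp: exponents_eq_def)
  then show ?case by (simp add: power_0_left)
next
  case (insert a I)
  have "(\<Sum>i\<in>insert a I. y i) ^ d / fact d
      = (\<Sum>k\<le>d. real (d choose k) * y a ^ k * (\<Sum>i\<in>I. y i) ^ (d - k)) / fact d"
    using insert.hyps by (simp add: binomial_ring)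
  also have "\<dots> = (\<Sum>k\<le>d. y a ^ k / fact k * ((\<Sum>i\<in>I. y i) ^ (d - k) / fact (d - k)))"
    by (simp add: sum_divide_distrib) (auto intro!: sum.cong simp: binomial_fact)
  also have "\<dots> = (\<Sum>k\<le>d. \<Sum>\<beta>\<in>exponents_eq I (d - k). y a ^ k / fact k * (\<Prod>i\<in>I. y i ^ \<beta> i / fact (\<beta> i)))"
    by (simp add: insert.IH sum_distrib_left)
  also have "\<dots> = (\<Sum>(k, \<beta>)\<in>Sigma {..d} (\<lambda>k. exponents_eq I (d - k)).
      y a ^ k / fact k * (\<Prod>i\<in>I. y i ^ \<beta> i / fact (\<beta> i)))"
    using insert.hyps by (subst sum.Sigma) (auto simp: finite_exponents_eq)
  also have "\<dots> = (\<Sum>\<beta>\<in>exponents_eq (insert a I) d. \<Prod>i\<in>insert a I. y i ^ \<beta> i / fact (\<beta> i))"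
  proof (rule sum.reindex_bij_witness[where i = "\<lambda>\<beta>. (\<beta> a, \<beta>(a := 0))" and j = "\<lambda>(k, \<beta>). \<beta>(a := k)"])
    fix x assume x: "x \<in> Sigma {..d} (\<lambda>k. exponents_eq I (d - k))"
    obtain k \<beta> where xk: "x = (k, \<beta>)" by (cases x)
    with x have k: "k \<le> d" and \<beta>: "\<And>i. i \<notin> I \<Longrightarrow> \<beta> i = 0" "sum \<beta> I = d - k"
      by (auto simp: exponents_eq_def)
    have *: "sum (\<beta>(a := k)) I = sum \<beta> I"
      using insert.hyps by (intro sum.cong) auto
    show "((case x of (k, \<beta>) \<Rightarrow> \<beta>(a := k)) a, (case x of (k, \<beta>) \<Rightarrow> \<beta>(a := k))(a := 0)) = x"
      using \<beta>(1)[OF insert.hyps(2)] by (auto simp: xk fun_eq_iff)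
    show "(case x of (k, \<beta>) \<Rightarrow> \<beta>(a := k)) \<in> exponents_eq (insert a I) d"
      using \<beta> k * insert.hyps by (auto simp: xk exponents_eq_def)
    have "(\<Prod>i\<in>I. y i ^ (\<beta>(a := k)) i / fact ((\<beta>(a := k)) i)) = (\<Prod>i\<in>I. y i ^ \<beta> i / fact (\<beta> i))"
      using insert.hyps by (intro prod.cong) auto
    then show "(\<Prod>i\<in>insert a I. y i ^ (case x of (k, \<beta>) \<Rightarrow> \<beta>(a := k)) i / fact ((case x of (k, \<beta>) \<Rightarrow> \<beta>(a := k)) i)) =
        (case x of (k, \<beta>) \<Rightarrow> y a ^ k / fact k * (\<Prod>i\<in>I. y i ^ \<beta> i / fact (\<beta> i)))"
      using insert.hyps by (simp add: xk)
  next
    fix \<beta> assume \<beta>: "\<beta> \<in> exponents_eq (insert a I) d"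
    have *: "sum (\<beta>(a := 0)) I = sum \<beta> I"
      using insert.hyps by (intro sum.cong) auto
    show "(case (\<beta> a, \<beta>(a := 0)) of (k, \<beta>) \<Rightarrow> \<beta>(a := k)) = \<beta>"
      by auto
    show "(\<beta> a, \<beta>(a := 0)) \<in> Sigma {..d} (\<lambda>k. exponents_eq I (d - k))"
      using \<beta> insert.hyps * by (auto simp: exponents_eq_def)
  qed
  finally show ?case .
qed

section \<open>Joint cumulants\<close>

abbreviation multifact :: "'i set \<Rightarrow> ('i \<Rightarrow> nat) \<Rightarrow> real" where
  "multifact I \<beta> \<equiv> \<Prod>i\<in>I. fact (\<beta> i)"

abbreviation multichoose :: "'i set \<Rightarrow> ('i \<Rightarrow> nat) \<Rightarrow> ('i \<Rightarrow> nat) \<Rightarrow> real" where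
  "multichoose I \<beta> \<gamma> \<equiv> \<Prod>i\<in>I. real (\<beta> i choose \<gamma> i)"

definition multihermite :: "'i set \<Rightarrow> ('i \<Rightarrow> nat) \<Rightarrow> ('i \<Rightarrow> real) \<Rightarrow> real" where
  "multihermite I \<beta> y = (\<Prod>i\<in>I. poly (hermite (\<beta> i)) (y i))"

definition moment :: "'i set \<Rightarrow> ('i \<Rightarrow> real) measure \<Rightarrow> ('i \<Rightarrow> nat) \<Rightarrow> real" where
  "moment I P \<beta> = (\<integral>x. (\<Prod>i\<in>I. x i ^ \<beta> i) \<partial>P)"

text \<open>Up to multiplicities, the joint cumulant of \<open>x\<^sub>j\<close> and the variables of the monomial \<open>x\<^sup>\<beta>\<close>.\<close>

function kappa :: "'i set \<Rightarrow> ('i \<Rightarrow> real) measure \<Rightarrow> 'i \<Rightarrow> ('i \<Rightarrow> nat) \<Rightarrow> real" where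
  "kappa I P j \<beta> = moment I P (\<beta>(j := Suc (\<beta> j))) -
     (\<Sum>\<gamma>\<in>{\<gamma>\<in>exponents_below I \<beta>. sum \<gamma> I < sum \<beta> I}.
        multichoose I \<beta> \<gamma> * kappa I P j \<gamma> * moment I P (\<lambda>i. \<beta> i - \<gamma> i))"
  by auto
termination
  by (relation "Wellfounded.measure (\<lambda>(I, P, j, \<beta>). sum \<beta> I)") auto

declare kappa.simps [simp del]

lemma exponents_below_sum_less_iff:
  assumes "finite I" "\<gamma> \<in> exponents_below I \<beta>" "\<And>i. i \<notin> I \<Longrightarrow> \<beta> i = 0"
  shows "sum \<gamma> I < sum \<beta> I \<longleftrightarrow> \<gamma> \<noteq> \<beta>"
proof
  assume "\<gamma> \<noteq> \<beta>"
  then obtain i where i: "\<gamma> i \<noteq> \<beta> i" by auto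
  then have "i \<in> I" using assms(2) assms(3)[of i] by (cases "i \<in> I") (auto simp: exponents_below_def)
  then show "sum \<gamma> I < sum \<beta> I"
    using assms i by (intro sum_strict_mono_ex1) (auto simp: exponents_below_def le_less)
qed auto

lemma exponents_below_self: "(\<And>i. i \<notin> I \<Longrightarrow> \<beta> i = 0) \<Longrightarrow> \<beta> \<in> exponents_below I \<beta>"
  by (simp add: exponents_below_def)

text \<open>The recursion defining \<open>kappa\<close> with the omitted term \<gamma> = \<beta> put
  back; its coefficient is 1 because the moment of the zero exponent is. This is the linear system
  that the dual function has to solve.\<close>

lemma kappa_sum:
  assumes "finite I" "\<And>i. i \<notin> I \<Longrightarrow> \<beta> i = 0"  "prob_space P"
  shows "(\<Sum>\<gamma>\<in>exponents_below I \<beta>. multichoose I \<beta> \<gamma> * kappa I P j \<gamma> * moment I P (\<lambda>i. \<beta> i - \<gamma> i)) =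
    moment I P (\<beta>(j := Suc (\<beta> j)))"
proof -
  interpret prob_space P by fact
  have "{\<gamma>\<in>exponents_below I \<beta>. sum \<gamma> I < sum \<beta> I} = exponents_below I \<beta> - {\<beta>}"
    using exponents_below_sum_less_iff[OF assms(1) _ assms(2)] by auto
  moreover have "moment I P (\<lambda>i. \<beta> i - \<beta> i) = 1"
    using prob_space by (simp add: moment_def)
  moreover have "multichoose I \<beta> \<beta> = 1"
    by simp
  ultimately have "kappa I P j \<beta> = moment I P (\<beta>(j := Suc (\<beta> j))) -
     (\<Sum>\<gamma>\<in>exponents_below I \<beta> - {\<beta>}.
        multichoose I \<beta> \<gamma> * kappa I P j \<gamma> * moment I P (\<lambda>i. \<beta> i - \<gamma> i))"
    "multichoose I \<beta> \<beta> * kappa I P j \<beta> * moment I P (\<lambda>i. \<beta> i - \<beta> i) = kappa I P j \<beta>"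
    by (simp_all only: kappa.simps[of I P j \<beta>] mult_1 mult_1_right)
  moreover have "\<beta> \<in> exponents_below I \<beta>"
    using assms(2) by (rule exponents_below_self)
  ultimately show ?thesis
    using sum.remove[OF finite_exponents_below[OF assms(1)], of \<beta> \<beta>,
      where g = "\<lambda>\<gamma>. multichoose I \<beta> \<gamma> * kappa I P j \<gamma> * moment I P (\<lambda>i. \<beta> i - \<gamma> i)"]
    by linarith
qed

text \<open>The binomial theorem in each coordinate. At t = |\<beta>| it sums the recursive bounds
  on the cumulants.\<close>

lemma sum_multichoose_power:
  assumes "finite I"
  shows "(\<Sum>\<gamma>\<in>exponents_below I \<beta>. multichoose I \<beta> \<gamma> * t ^ sum \<gamma> I) = (t + 1) ^ sum \<beta> I"
proof -
  have "(t + 1) ^ sum \<beta> I = (\<Prod>i\<in>I. \<Sum>k\<le>\<beta> i. real (\<beta> i choose k) * t ^ k)"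
    by (simp add: power_sum binomial_ring)
  also have "\<dots> = (\<Sum>\<gamma>\<in>exponents_below I \<beta>. \<Prod>i\<in>I. real (\<beta> i choose \<gamma> i) * t ^ \<gamma> i)"
    by (rule prod_sum_exponents_below[OF assms])
  finally show ?thesis by (simp add: prod.distrib power_sum)
qed

text \<open>The properties through which the prior enters the cumulant bound: nonnegativity disposes
  of absolute values, and supermultiplicativity merges the two moments in each term of the recursion
  into the single top moment.\<close>

definition supermultiplicative_moments :: "'i set \<Rightarrow> ('i \<Rightarrow> real) measure \<Rightarrow> bool" where
  "supermultiplicative_moments I P \<longleftrightarrow> (\<forall>\<beta>. 0 \<le> moment I P \<beta>) \<and>
     (\<forall>\<beta> \<gamma>. moment I P \<beta> * moment I P \<gamma> \<le> moment I P (\<lambda>i. \<beta> i + \<gamma> i))"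

text \<open>
  The factor \<open>T(d) = (d + 1)\<^sup>d\<close> reproduces itself in the recursion because
  \<open>\<Sum>\<^bsub>\<gamma> < \<beta>\<^esub> (\<beta> choose \<gamma>) d\<^bsup>|\<gamma>|\<^esup> = (d + 1)\<^sup>d - d\<^sup>d\<close> for \<open>d = |\<beta>|\<close>.
\<close>

lemma abs_kappa_le:
  assumes I: "finite I" and P: "prob_space P" "supermultiplicative_moments I P"
    and "\<And>i. i \<notin> I \<Longrightarrow> \<beta> i = 0" and j: "j \<in> I"
  shows "\<bar>kappa I P j \<beta>\<bar> \<le> real (sum \<beta> I + 1) ^ sum \<beta> I * moment I P (\<beta>(j := Suc (\<beta> j)))"
  using assms(4)
proof (induction "sum \<beta> I" arbitrary: \<beta> rule: less_induct)
  case less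
  define d where "d = sum \<beta> I"
  define m where "m = moment I P (\<beta>(j := Suc (\<beta> j)))"
  have nonneg: "0 \<le> moment I P \<gamma>" for \<gamma>
    using P(2) by (simp add: supermultiplicative_moments_def)
  define S where "S = {\<gamma>\<in>exponents_below I \<beta>. sum \<gamma> I < sum \<beta> I}"
  have S: "S = exponents_below I \<beta> - {\<beta>}"
    unfolding S_def using exponents_below_sum_less_iff[OF I _ less.prems] by auto
  have "\<beta> \<in> exponents_below I \<beta>"
    using less.prems by (rule exponents_below_self)
  have fin: "finite S" unfolding S using finite_exponents_below[OF I] by auto
  have term_le: "\<bar>multichoose I \<beta> \<gamma> * kappa I P j \<gamma> * moment I P (\<lambda>i. \<beta> i - \<gamma> i)\<bar>
      \<le> multichoose I \<beta> \<gamma> * real d ^ sum \<gamma> I * m" if \<gamma>: "\<gamma> \<in> S" for \<gamma>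
  proof -
    have \<gamma>': "\<And>i. i \<notin> I \<Longrightarrow> \<gamma> i = 0" "\<And>i. i \<in> I \<Longrightarrow> \<gamma> i \<le> \<beta> i" "sum \<gamma> I < d"
      using \<gamma> by (auto simp: S_def exponents_below_def d_def)
    \<comment> \<open>The unit added at j stays with the cumulant, so the two exponents of a term
      add up to \<beta> + e_j whatever \<gamma> is.\<close>
    have eq: "(\<lambda>i. (\<gamma>(j := Suc (\<gamma> j))) i + (\<beta> i - \<gamma> i)) = \<beta>(j := Suc (\<beta> j))"
    proof
      fix i show "(\<gamma>(j := Suc (\<gamma> j))) i + (\<beta> i - \<gamma> i) = (\<beta>(j := Suc (\<beta> j))) i"
        using \<gamma>'(1)[of i] \<gamma>'(2)[of i] less.prems[of i] j by (cases "i \<in> I") auto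
    qed
    have "\<bar>kappa I P j \<gamma>\<bar> \<le> real (sum \<gamma> I + 1) ^ sum \<gamma> I * moment I P (\<gamma>(j := Suc (\<gamma> j)))"
      using less.hyps[of \<gamma>] \<gamma>' by (simp add: d_def)
    \<comment> \<open>Strictness of |\<gamma>| < |\<beta>| gives |\<gamma>| + 1 \<le> d: all terms
      get the common base d and the binomial sum applies.\<close>
    also have "\<dots> \<le> real d ^ sum \<gamma> I * moment I P (\<gamma>(j := Suc (\<gamma> j)))"
    proof (intro mult_right_mono power_mono nonneg)
      show "real (sum \<gamma> I + 1) \<le> real d" using \<gamma>'(3) by (simp only: of_nat_le_iff)
    qed (simp only: of_nat_0_le_iff)
    finally have "\<bar>kappa I P j \<gamma>\<bar> * moment I P (\<lambda>i. \<beta> i - \<gamma> i)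
        \<le> real d ^ sum \<gamma> I * (moment I P (\<gamma>(j := Suc (\<gamma> j))) * moment I P (\<lambda>i. \<beta> i - \<gamma> i))"
      by (simp only: mult.assoc[symmetric]) (rule mult_right_mono[OF _ nonneg])
    also have "\<dots> \<le> real d ^ sum \<gamma> I * m"
    proof (rule mult_left_mono)
      have "moment I P (\<gamma>(j := Suc (\<gamma> j))) * moment I P (\<lambda>i. \<beta> i - \<gamma> i)
          \<le> moment I P (\<lambda>i. (\<gamma>(j := Suc (\<gamma> j))) i + (\<beta> i - \<gamma> i))"
        using P(2) unfolding supermultiplicative_moments_def by blast
      then show "moment I P (\<gamma>(j := Suc (\<gamma> j))) * moment I P (\<lambda>i. \<beta> i - \<gamma> i) \<le> m"
        unfolding eq m_def .
    qed simp
    finally have "multichoose I \<beta> \<gamma> * (\<bar>kappa I P j \<gamma>\<bar> * moment I P (\<lambda>i. \<beta> i - \<gamma> i))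
        \<le> multichoose I \<beta> \<gamma> * (real d ^ sum \<gamma> I * m)"
      by (intro mult_left_mono) (auto intro: prod_nonneg)
    then show ?thesis
      using nonneg[of "\<lambda>i. \<beta> i - \<gamma> i"] by (simp add: abs_mult abs_prod mult.assoc)
  qed
  have "\<bar>kappa I P j \<beta>\<bar> \<le> m + (\<Sum>\<gamma>\<in>S. multichoose I \<beta> \<gamma> * real d ^ sum \<gamma> I * m)"
  proof -
    have "\<bar>kappa I P j \<beta>\<bar> \<le> \<bar>m\<bar> +
        \<bar>\<Sum>\<gamma>\<in>S. multichoose I \<beta> \<gamma> * kappa I P j \<gamma> * moment I P (\<lambda>i. \<beta> i - \<gamma> i)\<bar>"
      unfolding kappa.simps[of I P j \<beta>] m_def[symmetric] S_def[symmetric] by (rule abs_triangle_ineq4)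
    also have "\<bar>\<Sum>\<gamma>\<in>S. multichoose I \<beta> \<gamma> * kappa I P j \<gamma> * moment I P (\<lambda>i. \<beta> i - \<gamma> i)\<bar> \<le>
        (\<Sum>\<gamma>\<in>S. multichoose I \<beta> \<gamma> * real d ^ sum \<gamma> I * m)"
      by (rule order_trans[OF sum_abs]) (intro sum_mono term_le)
    finally show ?thesis using nonneg by (simp add: m_def)
  qed
  also have "(\<Sum>\<gamma>\<in>S. multichoose I \<beta> \<gamma> * real d ^ sum \<gamma> I * m) = ((real d + 1) ^ d - real d ^ d) * m"
  proof -
    have "(\<Sum>\<gamma>\<in>exponents_below I \<beta>. multichoose I \<beta> \<gamma> * real d ^ sum \<gamma> I) =
       real d ^ d + (\<Sum>\<gamma>\<in>S. multichoose I \<beta> \<gamma> * real d ^ sum \<gamma> I)"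
      unfolding S using sum.remove[OF finite_exponents_below[OF I] \<open>\<beta> \<in> exponents_below I \<beta>\<close>,
        where g = "\<lambda>\<gamma>. multichoose I \<beta> \<gamma> * real d ^ sum \<gamma> I"]
      by (simp add: d_def[symmetric])
    then show ?thesis
      unfolding sum_multichoose_power[OF I] by (simp add: sum_distrib_right[symmetric] d_def)
  qed
  also have "m + ((real d + 1) ^ d - real d ^ d) * m \<le> (real d + 1) ^ d * m"
  proof -
    \<comment> \<open>For \<open>d = 0\<close> this is 0^0 = 1. The subtracted d^d thus pays for the
      leading m.\<close>
    have "1 \<le> real d ^ d" by (cases "d = 0") auto
    then have "1 * m \<le> real d ^ d * m" using nonneg by (intro mult_right_mono) (auto simp: m_def)
    then show ?thesis by (simp add: algebra_simps)
  qed
  finally show ?case by (simp add: d_def m_def add.commute)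
qed

section \<open>Hermite products in the observation and in the noise\<close>

lemma prob_space_gaussian_noise: "prob_space (gaussian_noise I)"
  unfolding gaussian_noise_def by (intro prob_space_PiM prob_space_std_normal)

lemma all_moments_std_normal: "all_moments std_normal_distribution (\<lambda>z. z)"
  unfolding all_moments_def
proof (intro conjI allI)
  fix k :: nat
  show "integrable std_normal_distribution (\<lambda>z. \<bar>z\<bar> ^ k)"
    using integrable_std_normal_moment_abs[of k] by (subst integrable_density) auto
qed simp

lemma all_moments_gaussian_noise: "i \<in> I \<Longrightarrow> all_moments (gaussian_noise I) (\<lambda>z. z i)"
  unfolding gaussian_noise_def
  by (rule all_moments_PiM_component[OF prob_space_std_normal _ all_moments_std_normal])

lemma multihermite_inner:
  assumes "finite I"
  shows "(\<integral>z. multihermite I \<beta> (observation lam x z) * multihermite I \<gamma> z \<partial>gaussian_noise I) =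
    (\<Prod>i\<in>I. fact (\<gamma> i) * real (\<beta> i choose \<gamma> i) * (sqrt lam * x i) ^ (\<beta> i - \<gamma> i))"
proof -
  interpret N: prob_space std_normal_distribution by (rule prob_space_std_normal)
  interpret product_prob_space "\<lambda>_. std_normal_distribution" I ..
  have "integrable std_normal_distribution
      (\<lambda>z. poly (hermite a) (y + z) * poly (hermite b) z)" for a b y
    using integrable_std_normal_poly_mult[of "pcompose (hermite a) [:y, 1:]" "hermite b"]
    by (simp add: poly_pcompose)
  then show ?thesis
    unfolding multihermite_def observation_def gaussian_noise_def prod.distrib[symmetric]
    by (subst product_integral_prod[OF assms]) (auto simp: hermite_shift_inner)
qed

text \<open>Expanding each coordinate power stays below \<alpha> coordinatewise, hence within total
  degree \<open>D\<close>. Matching expectations for all polynomials is thereby reduced to finitely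
  many Hermite products.\<close>

lemma polys_le_multihermite:
  assumes I: "finite I" and f: "f \<in> polys_le I D"
  shows "\<exists>a. \<forall>y. f y = (\<Sum>\<beta>\<in>exponents_le I D. a \<beta> * multihermite I \<beta> y)"
proof -
  from f obtain c where c: "f = (\<lambda>y. \<Sum>\<alpha>\<in>exponents_le I D. c \<alpha> * (\<Prod>i\<in>I. y i ^ \<alpha> i))"
    by (auto simp: polys_le_def)
  obtain e where e: "\<And>a y. y ^ a = (\<Sum>k\<le>a. e a k * poly (hermite k) y)"
    using power_hermite_expansion by metis
  define w where "w \<alpha> \<beta> = (if \<beta> \<in> exponents_below I \<alpha> then \<Prod>i\<in>I. e (\<alpha> i) (\<beta> i) else 0)" for \<alpha> \<beta>
  have mono: "(\<Prod>i\<in>I. y i ^ \<alpha> i) = (\<Sum>\<beta>\<in>exponents_le I D. w \<alpha> \<beta> * multihermite I \<beta> y)"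
    if \<alpha>: "\<alpha> \<in> exponents_le I D" for \<alpha> y
  proof -
    have "(\<Prod>i\<in>I. y i ^ \<alpha> i) = (\<Sum>\<beta>\<in>exponents_below I \<alpha>. \<Prod>i\<in>I. e (\<alpha> i) (\<beta> i) * poly (hermite (\<beta> i)) (y i))"
      by (subst e) (rule prod_sum_exponents_below[OF I])
    also have "\<dots> = (\<Sum>\<beta>\<in>exponents_below I \<alpha>. w \<alpha> \<beta> * multihermite I \<beta> y)"
      by (intro sum.cong) (auto simp: w_def multihermite_def prod.distrib)
    also have "\<dots> = (\<Sum>\<beta>\<in>exponents_le I D. w \<alpha> \<beta> * multihermite I \<beta> y)"
      using exponents_below_subset_exponents_le[of \<alpha> I D] \<alpha> finite_exponents_le[OF I]
      by (intro sum.mono_neutral_left) (auto simp: w_def exponents_le_def)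
    finally show ?thesis .
  qed
  have "f y = (\<Sum>\<beta>\<in>exponents_le I D. (\<Sum>\<alpha>\<in>exponents_le I D. c \<alpha> * w \<alpha> \<beta>) * multihermite I \<beta> y)" for y
  proof -
    have "f y = (\<Sum>\<alpha>\<in>exponents_le I D. \<Sum>\<beta>\<in>exponents_le I D. c \<alpha> * w \<alpha> \<beta> * multihermite I \<beta> y)"
      by (simp add: c mono sum_distrib_left mult.assoc)
    then show ?thesis by (subst (asm) sum.swap) (simp add: sum_distrib_right)
  qed
  then show ?thesis by (intro exI[of _ "\<lambda>\<beta>. \<Sum>\<alpha>\<in>exponents_le I D. c \<alpha> * w \<alpha> \<beta>"]) auto
qed

section \<open>The low-degree lower bound\<close>

locale gaussian_additive = prob_space P for P :: "('i \<Rightarrow> real) measure" +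
  fixes I :: "'i set" and lam :: real
  assumes finite_I: "finite I" and all_moments_coord: "\<And>i. i \<in> I \<Longrightarrow> all_moments P (\<lambda>x. x i)"
    and lam_nonneg: "0 \<le> lam"
begin

abbreviation joint :: "(('i \<Rightarrow> real) \<times> ('i \<Rightarrow> real)) measure" where
  "joint \<equiv> P \<Otimes>\<^sub>M gaussian_noise I"

abbreviation obs :: "('i \<Rightarrow> real) \<times> ('i \<Rightarrow> real) \<Rightarrow> 'i \<Rightarrow> real" where
  "obs w \<equiv> observation lam (fst w) (snd w)"

sublocale noise: prob_space "gaussian_noise I"
  by (rule prob_space_gaussian_noise)

sublocale joint: pair_prob_space P "gaussian_noise I" ..

lemma all_moments_signal: "i \<in> I \<Longrightarrow> all_moments joint (\<lambda>w. fst w i)"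
  using all_moments_fst[OF all_moments_coord noise.prob_space_axioms] .

lemma all_moments_noise: "i \<in> I \<Longrightarrow> all_moments joint (\<lambda>w. snd w i)"
  using all_moments_snd[OF all_moments_gaussian_noise prob_space_axioms noise.prob_space_axioms] .

lemma all_moments_multihermite_noise: "all_moments joint (\<lambda>w. multihermite I \<gamma> (snd w))"
  unfolding multihermite_def
  by (intro joint.all_moments_prod joint.all_moments_poly all_moments_noise)

lemma all_moments_multihermite_obs: "all_moments joint (\<lambda>w. multihermite I \<beta> (obs w))"
  unfolding multihermite_def observation_def
  by (rule joint.all_moments_prod, rule joint.all_moments_poly, rule joint.all_moments_add,
      rule joint.all_moments_mult, rule joint.all_moments_const, erule all_moments_signal,
      erule all_moments_noise)

lemma all_moments_polys_le:
  assumes "f \<in> polys_le I D" shows "all_moments joint (\<lambda>w. f (obs w))"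
proof -
  obtain a where "\<And>y. f y = (\<Sum>\<beta>\<in>exponents_le I D. a \<beta> * multihermite I \<beta> y)"
    using polys_le_multihermite[OF finite_I assms] by auto
  then show ?thesis
    by (simp only:) (rule joint.all_moments_sum,
      rule joint.all_moments_mult[OF joint.all_moments_const all_moments_multihermite_obs])
qed

lemma integral_joint:
  assumes "all_moments joint F"
  shows "(\<integral>w. F w \<partial>joint) = (\<integral>x. (\<integral>z. F (x, z) \<partial>gaussian_noise I) \<partial>P)"
  using joint.integral_fst'[OF all_moments_integrable[OF assms]] by simp

lemma integral_multihermite_obs_noise:
  "(\<integral>w. multihermite I \<beta> (obs w) * multihermite I \<gamma> (snd w) \<partial>joint) =
    multifact I \<gamma> * multichoose I \<beta> \<gamma> * sqrt lam ^ (\<Sum>i\<in>I. \<beta> i - \<gamma> i) * moment I P (\<lambda>i. \<beta> i - \<gamma> i)"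
proof -
  have "(\<integral>w. multihermite I \<beta> (obs w) * multihermite I \<gamma> (snd w) \<partial>joint) =
     (\<integral>x. (\<Prod>i\<in>I. fact (\<gamma> i) * real (\<beta> i choose \<gamma> i) * (sqrt lam * x i) ^ (\<beta> i - \<gamma> i)) \<partial>P)"
    by (subst integral_joint[OF joint.all_moments_mult[OF all_moments_multihermite_obs
       all_moments_multihermite_noise]]) (simp add: multihermite_inner[OF finite_I])
  also have "\<dots> = (\<integral>x. multifact I \<gamma> * multichoose I \<beta> \<gamma> * sqrt lam ^ (\<Sum>i\<in>I. \<beta> i - \<gamma> i) *
      (\<Prod>i\<in>I. x i ^ (\<beta> i - \<gamma> i)) \<partial>P)"
    by (simp add: prod.distrib power_mult_distrib power_sum mult.assoc)
  finally show ?thesis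
    by (simp add: moment_def)
qed

text \<open>The weights are forced: division by \<gamma>! cancels the squared norm of
  \<open>multihermite I \<gamma>\<close>, and the power of \<open>sqrt lam\<close> completes the one
  from the inner product to a factor depending on \<beta> alone. As a function of the noise only, it
  has a norm computable by orthogonality.\<close>

definition dual :: "nat \<Rightarrow> 'i \<Rightarrow> ('i \<Rightarrow> real) \<times> ('i \<Rightarrow> real) \<Rightarrow> real" where
  "dual D j w = (\<Sum>\<gamma>\<in>exponents_le I D.
     sqrt lam ^ sum \<gamma> I * kappa I P j \<gamma> / multifact I \<gamma> * multihermite I \<gamma> (snd w))"

lemma all_moments_dual: "all_moments joint (dual D j)"
  unfolding dual_def
  by (rule joint.all_moments_sum,
      rule joint.all_moments_mult[OF joint.all_moments_const all_moments_multihermite_noise])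

lemma multifact_pos: "0 < multifact I \<gamma>"
  by (intro prod_pos) auto

lemma integral_multihermite_dual:
  assumes \<beta>: "\<beta> \<in> exponents_le I D"
  shows "(\<integral>w. multihermite I \<beta> (obs w) * dual D j w \<partial>joint) =
    sqrt lam ^ sum \<beta> I * moment I P (\<beta>(j := Suc (\<beta> j)))"
proof -
  have "(\<integral>w. multihermite I \<beta> (obs w) * dual D j w \<partial>joint) =
    (\<integral>w. (\<Sum>\<gamma>\<in>exponents_le I D. (sqrt lam ^ sum \<gamma> I * kappa I P j \<gamma> / multifact I \<gamma>) *
       (multihermite I \<beta> (obs w) * multihermite I \<gamma> (snd w))) \<partial>joint)"
    by (simp add: dual_def sum_distrib_left mult_ac)
  also have "\<dots> = (\<Sum>\<gamma>\<in>exponents_le I D. (sqrt lam ^ sum \<gamma> I * kappa I P j \<gamma> / multifact I \<gamma>) *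
      (multifact I \<gamma> * multichoose I \<beta> \<gamma> * sqrt lam ^ (\<Sum>i\<in>I. \<beta> i - \<gamma> i) * moment I P (\<lambda>i. \<beta> i - \<gamma> i)))"
    by (subst Bochner_Integration.integral_sum, rule integrable_mult_right,
        rule all_moments_integrable[OF joint.all_moments_mult[OF all_moments_multihermite_obs all_moments_multihermite_noise]])
      (simp only: integral_mult_right_zero integral_multihermite_obs_noise)
  also have "\<dots> = (\<Sum>\<gamma>\<in>exponents_le I D. sqrt lam ^ (sum \<gamma> I + (\<Sum>i\<in>I. \<beta> i - \<gamma> i)) *
      (multichoose I \<beta> \<gamma> * kappa I P j \<gamma> * moment I P (\<lambda>i. \<beta> i - \<gamma> i)))"
  proof (rule sum.cong[OF refl])
    fix \<gamma>
    have "(a * k / m) * (m * c * b * M) = (a * b) * (c * k * M)" if "0 < m" for a b c k m M :: real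
      using that by (simp add: field_simps)
    from this[OF multifact_pos] show "(sqrt lam ^ sum \<gamma> I * kappa I P j \<gamma> / multifact I \<gamma>) *
        (multifact I \<gamma> * multichoose I \<beta> \<gamma> * sqrt lam ^ (\<Sum>i\<in>I. \<beta> i - \<gamma> i) * moment I P (\<lambda>i. \<beta> i - \<gamma> i)) =
      sqrt lam ^ (sum \<gamma> I + (\<Sum>i\<in>I. \<beta> i - \<gamma> i)) *
        (multichoose I \<beta> \<gamma> * kappa I P j \<gamma> * moment I P (\<lambda>i. \<beta> i - \<gamma> i))"
      unfolding power_add .
  qed
  also have "\<dots> = (\<Sum>\<gamma>\<in>exponents_below I \<beta>. sqrt lam ^ (sum \<gamma> I + (\<Sum>i\<in>I. \<beta> i - \<gamma> i)) *
      (multichoose I \<beta> \<gamma> * kappa I P j \<gamma> * moment I P (\<lambda>i. \<beta> i - \<gamma> i)))"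
  \<comment> \<open>Outside \<open>exponents_below I \<beta>\<close> the truncated differences
    \<beta> i - \<gamma> i are meaningless, but there some binomial coefficient is 0.\<close>
  proof (rule sum.mono_neutral_right)
    show "finite (exponents_le I D)" by (rule finite_exponents_le[OF finite_I])
    show "exponents_below I \<beta> \<subseteq> exponents_le I D"
      using \<beta> by (intro exponents_below_subset_exponents_le) (simp add: exponents_le_def)
    show "\<forall>\<gamma>\<in>exponents_le I D - exponents_below I \<beta>. sqrt lam ^ (sum \<gamma> I + (\<Sum>i\<in>I. \<beta> i - \<gamma> i)) *
      (multichoose I \<beta> \<gamma> * kappa I P j \<gamma> * moment I P (\<lambda>i. \<beta> i - \<gamma> i)) = 0"
    proof
      fix \<gamma> assume "\<gamma> \<in> exponents_le I D - exponents_below I \<beta>"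
      then obtain i where "i \<in> I" "\<beta> i < \<gamma> i"
        by (auto simp: exponents_le_def exponents_below_def not_le)
      then have "multichoose I \<beta> \<gamma> = 0" using finite_I by (auto intro!: bexI[of _ i])
      then show "sqrt lam ^ (sum \<gamma> I + (\<Sum>i\<in>I. \<beta> i - \<gamma> i)) *
        (multichoose I \<beta> \<gamma> * kappa I P j \<gamma> * moment I P (\<lambda>i. \<beta> i - \<gamma> i)) = 0" by simp
    qed
  qed
  also have "\<dots> = (\<Sum>\<gamma>\<in>exponents_below I \<beta>. sqrt lam ^ sum \<beta> I *
      (multichoose I \<beta> \<gamma> * kappa I P j \<gamma> * moment I P (\<lambda>i. \<beta> i - \<gamma> i)))"
  proof (rule sum.cong[OF refl])
    fix \<gamma> assume "\<gamma> \<in> exponents_below I \<beta>"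
    then have "sum \<gamma> I + (\<Sum>i\<in>I. \<beta> i - \<gamma> i) = sum \<beta> I"
      unfolding sum.distrib[symmetric] by (intro sum.cong) (auto simp: exponents_below_def)
    then show "sqrt lam ^ (sum \<gamma> I + (\<Sum>i\<in>I. \<beta> i - \<gamma> i)) *
        (multichoose I \<beta> \<gamma> * kappa I P j \<gamma> * moment I P (\<lambda>i. \<beta> i - \<gamma> i)) =
      sqrt lam ^ sum \<beta> I * (multichoose I \<beta> \<gamma> * kappa I P j \<gamma> * moment I P (\<lambda>i. \<beta> i - \<gamma> i))"
      by (simp only:)
  qed
  also have "\<dots> = sqrt lam ^ sum \<beta> I * moment I P (\<beta>(j := Suc (\<beta> j)))"
    using \<beta> unfolding sum_distrib_left[symmetric]
    by (subst kappa_sum[OF finite_I _ prob_space_axioms]) (auto simp: exponents_le_def)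
  finally show ?thesis .
qed

lemma prod_power_Suc:
  assumes "j \<in> I"
  shows "(\<Prod>i\<in>I. (x i :: real) ^ (\<beta>(j := Suc (\<beta> j))) i) = x j * (\<Prod>i\<in>I. x i ^ \<beta> i)"
proof -
  have "(\<Prod>i\<in>I. x i ^ (\<beta>(j := Suc (\<beta> j))) i) = (\<Prod>i\<in>I. (if i = j then x i else 1) * x i ^ \<beta> i)"
    by (rule prod.cong) auto
  then show ?thesis using assms finite_I by (simp add: prod.distrib)
qed

text \<open>The same value as for \<open>dual\<close>: averaging out the noise is the case \<gamma>
  = 0 of \<open>multihermite_inner\<close>, and the extra factor raises the exponent at j.\<close>

lemma integral_multihermite_signal:
  assumes j: "j \<in> I"
  shows "(\<integral>w. multihermite I \<beta> (obs w) * fst w j \<partial>joint) =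
    sqrt lam ^ sum \<beta> I * moment I P (\<beta>(j := Suc (\<beta> j)))"
proof -
  have "(\<integral>z. multihermite I \<beta> (observation lam x z) \<partial>gaussian_noise I) = (\<Prod>i\<in>I. (sqrt lam * x i) ^ \<beta> i)" for x
    using multihermite_inner[OF finite_I, of \<beta> lam x "\<lambda>_. 0"] by (simp add: multihermite_def[of I "\<lambda>_. 0"])
  then have "(\<integral>w. multihermite I \<beta> (obs w) * fst w j \<partial>joint) = (\<integral>x. (\<Prod>i\<in>I. (sqrt lam * x i) ^ \<beta> i) * x j \<partial>P)"
    by (subst integral_joint[OF joint.all_moments_mult[OF all_moments_multihermite_obs all_moments_signal[OF j]]])
       simp
  also have "\<dots> = (\<integral>x. sqrt lam ^ sum \<beta> I * (\<Prod>i\<in>I. x i ^ (\<beta>(j := Suc (\<beta> j))) i) \<partial>P)"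
    unfolding prod_power_Suc[OF j] by (simp add: power_mult_distrib prod.distrib power_sum mult_ac)
  finally show ?thesis by (simp add: moment_def)
qed

lemma integral_polys_le_dual:
  assumes "f \<in> polys_le I D" and j: "j \<in> I"
  shows "(\<integral>w. f (obs w) * dual D j w \<partial>joint) = (\<integral>w. f (obs w) * fst w j \<partial>joint)"
proof -
  obtain a where a: "\<And>y. f y = (\<Sum>\<beta>\<in>exponents_le I D. a \<beta> * multihermite I \<beta> y)"
    using polys_le_multihermite[OF finite_I assms(1)] by auto
  have "(\<integral>w. f (obs w) * G w \<partial>joint) = (\<Sum>\<beta>\<in>exponents_le I D. a \<beta> * (\<integral>w. multihermite I \<beta> (obs w) * G w \<partial>joint))"
    if G: "all_moments joint G" for G
    unfolding a sum_distrib_right mult.assoc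
    by (subst Bochner_Integration.integral_sum)
      (auto intro!: integrable_mult_right all_moments_integrable
        joint.all_moments_mult all_moments_multihermite_obs G)
  then show ?thesis
    by (simp add: all_moments_dual all_moments_signal j integral_multihermite_dual integral_multihermite_signal)
qed

lemma integral_multihermite_noise:
  assumes "\<beta> \<in> exponents_le I D" "\<gamma> \<in> exponents_le I D"
  shows "(\<integral>w. multihermite I \<beta> (snd w) * multihermite I \<gamma> (snd w) \<partial>joint) = (if \<beta> = \<gamma> then multifact I \<gamma> else 0)"
proof -
  \<comment> \<open>Orthogonality is the shift formula at signal-to-noise ratio 0, where the
    observation is the noise and the signal may be arbitrary.\<close>
  have "(\<integral>z. multihermite I \<beta> z * multihermite I \<gamma> z \<partial>gaussian_noise I) =
      (\<Prod>i\<in>I. fact (\<gamma> i) * real (\<beta> i choose \<gamma> i) * 0 ^ (\<beta> i - \<gamma> i))"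
    using multihermite_inner[OF finite_I, of \<beta> 0 undefined \<gamma>] by (simp add: observation_def)
  also have "\<dots> = (if \<beta> = \<gamma> then multifact I \<gamma> else 0)"
  proof (cases "\<beta> = \<gamma>")
    case False
    then obtain i where i: "\<beta> i \<noteq> \<gamma> i" by auto
    then have "i \<in> I" using assms by (cases "i \<in> I") (auto simp: exponents_le_def)
    moreover have "real (\<beta> i choose \<gamma> i) * 0 ^ (\<beta> i - \<gamma> i) = 0"
      using i by (cases "\<beta> i < \<gamma> i") auto
    ultimately have "(\<Prod>i\<in>I. fact (\<gamma> i) * real (\<beta> i choose \<gamma> i) * 0 ^ (\<beta> i - \<gamma> i)) = (0::real)"
      using finite_I by (auto simp: prod_zero_iff mult.assoc)
    with False show ?thesis by simp
  qed simp
  finally show ?thesis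
    by (subst integral_joint[OF joint.all_moments_mult[OF all_moments_multihermite_noise
       all_moments_multihermite_noise]]) (simp add: prob_space)
qed

lemma integral_dual_square:
  "(\<integral>w. (dual D j w)\<^sup>2 \<partial>joint) = (\<Sum>\<gamma>\<in>exponents_le I D. lam ^ sum \<gamma> I * (kappa I P j \<gamma>)\<^sup>2 / multifact I \<gamma>)"
proof -
  define a where "a \<gamma> = sqrt lam ^ sum \<gamma> I * kappa I P j \<gamma> / multifact I \<gamma>" for \<gamma>
  have int: "integrable joint (\<lambda>w. a \<beta> * (a \<gamma> * (multihermite I \<beta> (snd w) * multihermite I \<gamma> (snd w))))" for \<beta> \<gamma>
    by (intro integrable_mult_right all_moments_integrable joint.all_moments_mult all_moments_multihermite_noise)
  have "(\<integral>w. (dual D j w)\<^sup>2 \<partial>joint) = (\<integral>w. (\<Sum>\<beta>\<in>exponents_le I D. \<Sum>\<gamma>\<in>exponents_le I D.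
      a \<beta> * (a \<gamma> * (multihermite I \<beta> (snd w) * multihermite I \<gamma> (snd w)))) \<partial>joint)"
    unfolding dual_def a_def[symmetric] power2_eq_square sum_product by (simp only: mult_ac)
  also have "\<dots> = (\<Sum>\<beta>\<in>exponents_le I D. \<Sum>\<gamma>\<in>exponents_le I D.
      a \<beta> * (a \<gamma> * (\<integral>w. multihermite I \<beta> (snd w) * multihermite I \<gamma> (snd w) \<partial>joint)))"
    by (subst Bochner_Integration.integral_sum, intro Bochner_Integration.integrable_sum int, rule sum.cong[OF refl],
        subst Bochner_Integration.integral_sum, intro int) simp
  also have "\<dots> = (\<Sum>\<beta>\<in>exponents_le I D. \<Sum>\<gamma>\<in>exponents_le I D. if \<beta> = \<gamma> then a \<beta> * a \<gamma> * multifact I \<gamma> else 0)"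
    by (intro sum.cong refl) (simp add: integral_multihermite_noise)
  also have "\<dots> = (\<Sum>\<gamma>\<in>exponents_le I D. a \<gamma> * a \<gamma> * multifact I \<gamma>)"
    by (simp add: finite_exponents_le[OF finite_I])
  also have "\<dots> = (\<Sum>\<gamma>\<in>exponents_le I D. lam ^ sum \<gamma> I * (kappa I P j \<gamma>)\<^sup>2 / multifact I \<gamma>)"
  proof (rule sum.cong[OF refl])
    fix \<gamma>
    have "(sqrt lam ^ sum \<gamma> I)\<^sup>2 = lam ^ sum \<gamma> I"
      using lam_nonneg by (simp add: power_mult[symmetric] mult.commute[of _ 2]) (simp add: power_mult)
    then show "a \<gamma> * a \<gamma> * multifact I \<gamma> = lam ^ sum \<gamma> I * (kappa I P j \<gamma>)\<^sup>2 / multifact I \<gamma>"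
      using multifact_pos[of \<gamma>] by (simp add: a_def power2_eq_square field_simps less_le)
  qed
  finally show ?thesis .
qed

text \<open>With U = \<open>dual D j\<close> and E f U = E f X_j, the error equals E (f - U)^2 + E
  X_j^2 - E U^2, and the first square is dropped.\<close>

lemma mse_lower_bound:
  assumes f: "f \<in> polys_le I D" and j: "j \<in> I"
  shows "(\<integral>w. (f (obs w) - fst w j)\<^sup>2 \<partial>joint) \<ge> (\<integral>x. (x j)\<^sup>2 \<partial>P) -
    (\<Sum>\<gamma>\<in>exponents_le I D. lam ^ sum \<gamma> I * (kappa I P j \<gamma>)\<^sup>2 / multifact I \<gamma>)"
proof -
  note am = all_moments_polys_le[OF f] all_moments_signal[OF j] all_moments_dual[of D j]
  have int: "integrable joint (\<lambda>w. F w * G w)" if "all_moments joint F" "all_moments joint G" for F G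
    using that by (intro all_moments_integrable joint.all_moments_mult)
  have expand: "(\<integral>w. (F w - G w)\<^sup>2 \<partial>joint) = (\<integral>w. (F w)\<^sup>2 \<partial>joint) - 2 * (\<integral>w. F w * G w \<partial>joint) + (\<integral>w. (G w)\<^sup>2 \<partial>joint)"
    if F: "all_moments joint F" and G: "all_moments joint G" for F G
  proof -
    have "(\<integral>w. (F w - G w)\<^sup>2 \<partial>joint) = (\<integral>w. F w * F w - 2 * (F w * G w) + G w * G w \<partial>joint)"
      by (simp add: power2_eq_square algebra_simps)
    then show ?thesis
      using int[OF F F] int[OF F G] int[OF G G] by (simp add: power2_eq_square)
  qed
  have "(\<integral>w. (fst w j)\<^sup>2 \<partial>joint) = (\<integral>x. (x j)\<^sup>2 \<partial>P)"
    by (subst integral_joint[OF joint.all_moments_power[OF am(2)]]) (simp add: noise.prob_space)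
  moreover have "0 \<le> (\<integral>w. (f (obs w) - dual D j w)\<^sup>2 \<partial>joint)"
    by (rule Bochner_Integration.integral_nonneg) simp
  ultimately show ?thesis
    using expand[OF am(1,2)] expand[OF am(1,3)] integral_polys_le_dual[OF f j] integral_dual_square[of D j]
    by linarith
qed

definition overlap_moment :: "nat \<Rightarrow> real" where
  "overlap_moment k = (\<integral>t. t ^ k \<partial>overlap_law I P)"

text \<open>Of the d + 1 factors <X, X'> one is kept as the sum over j and the other d are expanded
  multinomially; independence of the replicas squares each moment. The right-hand side has the shape
  produced by the cumulant bound.\<close>

lemma overlap_moment_Suc:
  "overlap_moment (Suc d) / fact d =
    (\<Sum>j\<in>I. \<Sum>\<beta>\<in>exponents_eq I d. (moment I P (\<beta>(j := Suc (\<beta> j))))\<^sup>2 / multifact I \<beta>)"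
proof -
  interpret PP: pair_prob_space P P ..
  have am1: "all_moments (P \<Otimes>\<^sub>M P) (\<lambda>w. \<Prod>i\<in>I. fst w i ^ \<beta> i)" for \<beta>
    by (intro PP.all_moments_prod PP.all_moments_power all_moments_fst all_moments_coord prob_space_axioms)
  have am2: "all_moments (P \<Otimes>\<^sub>M P) (\<lambda>w. \<Prod>i\<in>I. snd w i ^ \<beta> i)" for \<beta>
    by (intro PP.all_moments_prod PP.all_moments_power all_moments_snd all_moments_coord prob_space_axioms)
  have am12: "all_moments (P \<Otimes>\<^sub>M P) (\<lambda>w. \<Prod>i\<in>I. (fst w i * snd w i) ^ \<beta> i)" for \<beta>
    using PP.all_moments_mult[OF am1 am2, of \<beta> \<beta>] by (simp add: power_mult_distrib prod.distrib)
  have meas: "(\<lambda>w. \<Sum>i\<in>I. fst w i * snd w i) \<in> borel_measurable (P \<Otimes>\<^sub>M P)"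
    by (intro all_moments_measurable PP.all_moments_sum PP.all_moments_mult all_moments_fst
        all_moments_snd all_moments_coord prob_space_axioms)
  have pp: "(\<integral>w. (\<Prod>i\<in>I. (fst w i * snd w i) ^ \<beta> i) \<partial>(P \<Otimes>\<^sub>M P)) = (moment I P \<beta>)\<^sup>2" for \<beta>
    using PP.integral_fst'[OF all_moments_integrable[OF am12], of \<beta>]
    by (simp add: power_mult_distrib prod.distrib moment_def power2_eq_square)
  have "overlap_moment (Suc d) / fact d = (\<integral>w. (\<Sum>i\<in>I. fst w i * snd w i) ^ Suc d / fact d \<partial>(P \<Otimes>\<^sub>M P))"
    using meas by (simp add: overlap_moment_def overlap_law_def integral_distr split_beta')
  also have "\<dots> = (\<integral>w. (\<Sum>j\<in>I. \<Sum>\<beta>\<in>exponents_eq I d.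
      (\<Prod>i\<in>I. (fst w i * snd w i) ^ (\<beta>(j := Suc (\<beta> j))) i) / multifact I \<beta>) \<partial>(P \<Otimes>\<^sub>M P))"
  proof (rule Bochner_Integration.integral_cong[OF refl])
    fix w :: "('i \<Rightarrow> real) \<times> ('i \<Rightarrow> real)"
    have "(\<Sum>i\<in>I. fst w i * snd w i) ^ Suc d / fact d =
      (\<Sum>j\<in>I. fst w j * snd w j) * ((\<Sum>i\<in>I. fst w i * snd w i) ^ d / fact d)"
      by simp
    also have "\<dots> = (\<Sum>j\<in>I. \<Sum>\<beta>\<in>exponents_eq I d.
        fst w j * snd w j * (\<Prod>i\<in>I. (fst w i * snd w i) ^ \<beta> i / fact (\<beta> i)))"
      unfolding multinomial_theorem[OF finite_I] sum_product ..
    also have "\<dots> = (\<Sum>j\<in>I. \<Sum>\<beta>\<in>exponents_eq I d.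
      (\<Prod>i\<in>I. (fst w i * snd w i) ^ (\<beta>(j := Suc (\<beta> j))) i) / multifact I \<beta>)"
      by (intro sum.cong refl) (subst prod_power_Suc, auto simp: prod_dividef)
    finally show "(\<Sum>i\<in>I. fst w i * snd w i) ^ Suc d / fact d = \<dots>" .
  qed
  also have "\<dots> = (\<Sum>j\<in>I. \<Sum>\<beta>\<in>exponents_eq I d. (moment I P (\<beta>(j := Suc (\<beta> j))))\<^sup>2 / multifact I \<beta>)"
  proof -
    have int: "integrable (P \<Otimes>\<^sub>M P) (\<lambda>w. (\<Prod>i\<in>I. (fst w i * snd w i) ^ \<beta> i) / c)" for \<beta> c
      by (intro integrable_divide_zero impI all_moments_integrable am12)
    show ?thesis
      by (subst Bochner_Integration.integral_sum, intro Bochner_Integration.integrable_sum int, rule sum.cong[OF refl],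
        subst Bochner_Integration.integral_sum, intro int) (simp only: integral_divide_zero pp)
  qed
  finally show ?thesis .
qed

definition low_degree_gain :: "nat \<Rightarrow> real" where
  "low_degree_gain D = (\<Sum>d\<le>D. lam ^ d * real (d + 1) ^ (2 * d) / fact d * overlap_moment (Suc d))"

lemma sum_kappa_le_low_degree_gain:
  assumes "supermultiplicative_moments I P"
  shows "(\<Sum>j\<in>I. \<Sum>\<gamma>\<in>exponents_le I D. lam ^ sum \<gamma> I * (kappa I P j \<gamma>)\<^sup>2 / multifact I \<gamma>) \<le> low_degree_gain D"
proof -
  have "(\<Sum>j\<in>I. \<Sum>\<gamma>\<in>exponents_le I D. lam ^ sum \<gamma> I * (kappa I P j \<gamma>)\<^sup>2 / multifact I \<gamma>) \<le>
    (\<Sum>j\<in>I. \<Sum>d\<le>D. \<Sum>\<beta>\<in>exponents_eq I d. lam ^ d * real (d + 1) ^ (2 * d) *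
      ((moment I P (\<beta>(j := Suc (\<beta> j))))\<^sup>2 / multifact I \<beta>))"
    unfolding sum_exponents_le[OF finite_I]
  proof (intro sum_mono)
    fix j d \<beta> assume j: "j \<in> I" and \<beta>: "\<beta> \<in> exponents_eq I d"
    have d: "sum \<beta> I = d" using \<beta> by (simp add: exponents_eq_def)
    have "\<bar>kappa I P j \<beta>\<bar> \<le> real (d + 1) ^ d * moment I P (\<beta>(j := Suc (\<beta> j)))"
      using abs_kappa_le[OF finite_I prob_space_axioms assms _ j, of \<beta>] \<beta> unfolding d by (simp add: exponents_eq_def)
    then have "(kappa I P j \<beta>)\<^sup>2 \<le> (real (d + 1) ^ d * moment I P (\<beta>(j := Suc (\<beta> j))))\<^sup>2"
      by (metis abs_ge_zero power2_abs power_mono)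
    also have "\<dots> = real (d + 1) ^ (2 * d) * (moment I P (\<beta>(j := Suc (\<beta> j))))\<^sup>2"
      by (simp only: power_mult_distrib power_mult[symmetric] mult.commute[of d])
    finally have "lam ^ d * (kappa I P j \<beta>)\<^sup>2 / multifact I \<beta> \<le>
        lam ^ d * (real (d + 1) ^ (2 * d) * (moment I P (\<beta>(j := Suc (\<beta> j))))\<^sup>2) / multifact I \<beta>"
      using lam_nonneg multifact_pos[of \<beta>] by (intro divide_right_mono mult_left_mono) auto
    then show "lam ^ sum \<beta> I * (kappa I P j \<beta>)\<^sup>2 / multifact I \<beta> \<le> lam ^ d * real (d + 1) ^ (2 * d) *
        ((moment I P (\<beta>(j := Suc (\<beta> j))))\<^sup>2 / multifact I \<beta>)"
      unfolding d by (simp only: mult.assoc times_divide_eq_right)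
  qed
  also have "\<dots> = (\<Sum>d\<le>D. lam ^ d * real (d + 1) ^ (2 * d) * (\<Sum>j\<in>I. \<Sum>\<beta>\<in>exponents_eq I d.
      (moment I P (\<beta>(j := Suc (\<beta> j))))\<^sup>2 / multifact I \<beta>))"
    by (subst sum.swap) (simp only: sum_distrib_left)
  also have "\<dots> = low_degree_gain D"
    unfolding overlap_moment_Suc[symmetric] low_degree_gain_def by simp
  finally show ?thesis .
qed

lemma mmse_le_bounds:
  assumes "supermultiplicative_moments I P"
  shows "(\<Sum>j\<in>I. \<integral>x. (x j)\<^sup>2 \<partial>P) - low_degree_gain D \<le> mmse_le I P D lam"
    and "mmse_le I P D lam \<le> (\<Sum>j\<in>I. \<integral>x. (x j)\<^sup>2 \<partial>P)"
proof -
  define V where "V = (\<Sum>j\<in>I. \<integral>x. (x j)\<^sup>2 \<partial>P)"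
  define risk where "risk f = (\<integral>(x, z). (\<Sum>j\<in>I. (f j (observation lam x z) - x j)\<^sup>2) \<partial>joint)"
    for f :: "'i \<Rightarrow> ('i \<Rightarrow> real) \<Rightarrow> real"
  have lower: "V - low_degree_gain D \<le> risk f" if f: "\<forall>j\<in>I. f j \<in> polys_le I D" for f
  proof -
    have int: "integrable joint (\<lambda>w. (f j (obs w) - fst w j)\<^sup>2)" if "j \<in> I" for j
      using f that by (intro all_moments_integrable joint.all_moments_power joint.all_moments_diff
          all_moments_signal all_moments_polys_le[of _ D]) auto
    have "risk f = (\<Sum>j\<in>I. \<integral>w. (f j (obs w) - fst w j)\<^sup>2 \<partial>joint)"
      unfolding risk_def split_beta' using int by (rule Bochner_Integration.integral_sum)
    also have "\<dots> \<ge> (\<Sum>j\<in>I. (\<integral>x. (x j)\<^sup>2 \<partial>P) -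
      (\<Sum>\<gamma>\<in>exponents_le I D. lam ^ sum \<gamma> I * (kappa I P j \<gamma>)\<^sup>2 / multifact I \<gamma>))"
      using f by (intro sum_mono mse_lower_bound) auto
    finally show ?thesis
      using sum_kappa_le_low_degree_gain[OF assms, of D] by (simp add: sum_subtractf V_def)
  qed
  have zero: "(\<lambda>_. 0) \<in> polys_le I D"
    unfolding polys_le_def by (auto intro!: exI[of _ "\<lambda>_. 0"])
  have mmse: "mmse_le I P D lam = Inf {risk f | f. \<forall>j\<in>I. f j \<in> polys_le I D}"
    by (simp add: mmse_le_def risk_def)
  show "V - low_degree_gain D \<le> mmse_le I P D lam"
    unfolding mmse using lower zero by (intro cInf_greatest) (auto intro!: exI[of _ "\<lambda>_ _. 0"])
  \<comment> \<open>The zero estimator is a competitor. \<open>Inf\<close> of reals is informative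
    only for sets bounded below, and the lower bound just proved supplies this.\<close>
  have "mmse_le I P D lam \<le> risk (\<lambda>_ _. 0)"
    unfolding mmse
  proof (rule cInf_lower)
    show "risk (\<lambda>_ _. 0) \<in> {risk f | f. \<forall>j\<in>I. f j \<in> polys_le I D}"
      using zero by auto
    show "bdd_below {risk f | f. \<forall>j\<in>I. f j \<in> polys_le I D}"
      using lower by (intro bdd_belowI[of _ "V - low_degree_gain D"]) auto
  qed
  also have "risk (\<lambda>_ _. 0) = V"
  proof -
    have "risk (\<lambda>_ _. 0) = (\<Sum>j\<in>I. \<integral>w. (fst w j)\<^sup>2 \<partial>joint)"
      unfolding risk_def split_beta'
      by (simp, rule Bochner_Integration.integral_sum)
        (intro all_moments_integrable joint.all_moments_power all_moments_signal)
    also have "\<dots> = V"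
      unfolding V_def
      by (intro sum.cong refl, subst integral_joint[OF joint.all_moments_power[OF all_moments_signal]])
        (simp_all add: noise.prob_space)
    finally show ?thesis .
  qed
  finally show "mmse_le I P D lam \<le> V" .
qed

end

section \<open>Moments of the sparse clustering prior\<close>

lemma distr_PiM_component:
  assumes "prob_space N" "i \<in> I"
  shows "distr (PiM I (\<lambda>_. N)) N (\<lambda>x. x i) = N"
proof -
  interpret N: prob_space N by fact
  interpret product_prob_space "\<lambda>_. N" I ..
  show ?thesis using PiM_component[OF assms(2)] by simp
qed

lemma integral_pair_mult:
  fixes F :: "'a \<Rightarrow> real" and G :: "'b \<Rightarrow> real"
  assumes M: "prob_space M" and N: "prob_space N" and F: "all_moments M F" and G: "all_moments N G"
  shows "(\<integral>w. F (fst w) * G (snd w) \<partial>(M \<Otimes>\<^sub>M N)) = (\<integral>x. F x \<partial>M) * (\<integral>y. G y \<partial>N)"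
proof -
  interpret M: prob_space M by fact
  interpret N: prob_space N by fact
  interpret MN: pair_prob_space M N ..
  have "all_moments (M \<Otimes>\<^sub>M N) (\<lambda>w. F (fst w) * G (snd w))"
    by (intro MN.all_moments_mult all_moments_fst[OF F N] all_moments_snd[OF G M N])
  from MN.integral_fst'[OF all_moments_integrable[OF this]] show ?thesis by simp
qed

definition normal_moment :: "nat \<Rightarrow> real" where
  "normal_moment k = (\<integral>z. z ^ k \<partial>std_normal_distribution)"

lemma normal_moment_simps: "normal_moment 0 = 1" "normal_moment (Suc 0) = 0"
  "normal_moment (Suc (Suc k)) = real (Suc k) * normal_moment k"
proof -
  interpret prob_space std_normal_distribution by (rule prob_space_std_normal)
  show "normal_moment 0 = 1" using prob_space by (simp add: normal_moment_def)
  show "normal_moment (Suc 0) = 0"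
    using std_normal_moment_Suc[of 0] by (simp add: normal_moment_def)
  show "normal_moment (Suc (Suc k)) = real (Suc k) * normal_moment k"
    using std_normal_moment_Suc[of "Suc k"] by (simp only: normal_moment_def diff_Suc_1)
qed

lemma normal_moment_nonneg: "0 \<le> normal_moment k"
  by (induction k rule: nat_less_induct) (metis normal_moment_simps mult_nonneg_nonneg not0_implies_Suc
      of_nat_0_le_iff order_refl zero_le_one lessI less_Suc_eq)

text \<open>Induction in steps of two: raising the exponent by two contributes the factor c + 1 on
  the left and the larger a + c + 1 on the right.\<close>

lemma normal_moment_supermultiplicative: "normal_moment a * normal_moment b \<le> normal_moment (a + b)"
proof (induction b rule: nat_less_induct)
  case (1 b)
  consider "b = 0" | "b = Suc 0" | c where "b = Suc (Suc c)"
    by (metis not0_implies_Suc)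
  then show ?case
  proof cases
    case 3
    have "normal_moment a * normal_moment b = real (Suc c) * (normal_moment a * normal_moment c)"
      by (simp add: 3 normal_moment_simps)
    also have "\<dots> \<le> real (Suc (a + c)) * normal_moment (a + c)"
      using 1[rule_format, of c] 3 by (intro mult_mono) (auto simp: normal_moment_nonneg)
    also have "\<dots> = normal_moment (a + b)" by (simp add: 3 normal_moment_simps)
    finally show ?thesis .
  qed (auto simp: normal_moment_simps normal_moment_nonneg)
qed

lemma integral_rademacher:
  fixes f :: "real \<Rightarrow> 'a :: {banach, second_countable_topology}"
  shows "(\<integral>x. f x \<partial>measure_pmf rademacher) = (1 / 2) *\<^sub>R (f 1 + f (- 1))"
  unfolding rademacher_def
  by (subst integral_measure_pmf[of "{- 1, 1}"]) (auto simp: scaleR_add_right add.commute)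

lemma rademacher_power: "(\<integral>x. x ^ k \<partial>measure_pmf rademacher) = (if even k then 1 else 0)"
  by (simp add: integral_rademacher)

lemma all_moments_rademacher: "all_moments (measure_pmf rademacher) f"
  unfolding all_moments_def rademacher_def
  by (auto intro!: integrable_measure_pmf_finite)

lemma all_moments_bernoulli: "all_moments (measure_pmf (bernoulli_pmf dens)) f"
  unfolding all_moments_def
  by (auto intro!: integrable_measure_pmf_finite)

locale sparse_clustering =
  fixes n p :: nat and s :: real
  assumes p_pos: "0 < p" and s_pos: "0 < s" and s_le: "s \<le> real p"
begin

abbreviation I :: "(nat \<times> nat) set" where "I \<equiv> {..<n} \<times> {..<p}"

definition dens :: real where "dens = s / real p"

lemma dens_bounds: "0 < dens" "dens \<le> 1"
  using p_pos s_pos s_le by (auto simp: dens_def)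

definition labels :: "(nat \<Rightarrow> real) measure" where
  "labels = PiM {..<n} (\<lambda>_. measure_pmf rademacher)"

definition slab :: "(bool \<times> real) measure" where
  "slab = measure_pmf (bernoulli_pmf dens) \<Otimes>\<^sub>M std_normal_distribution"

definition slabs :: "(nat \<Rightarrow> bool \<times> real) measure" where
  "slabs = PiM {..<p} (\<lambda>_. slab)"

definition base :: "((nat \<Rightarrow> real) \<times> (nat \<Rightarrow> bool \<times> real)) measure" where
  "base = labels \<Otimes>\<^sub>M slabs"

definition entry :: "bool \<times> real \<Rightarrow> real" where
  "entry u = of_bool (fst u) * snd u"

definition signal :: "(nat \<Rightarrow> real) \<times> (nat \<Rightarrow> bool \<times> real) \<Rightarrow> nat \<times> nat \<Rightarrow> real" where
  "signal = (\<lambda>(\<xi>, bg). \<lambda>(i, j)\<in>I. \<xi> i * entry (bg j))"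

definition prior :: "(nat \<times> nat \<Rightarrow> real) measure" where
  "prior = sparse_clustering_prior n p s"

sublocale labels: prob_space labels
  unfolding labels_def by (intro prob_space_PiM prob_space_measure_pmf)

sublocale slab: prob_space slab
  unfolding slab_def by (intro prob_space_pair prob_space_measure_pmf prob_space_std_normal)

sublocale slabs: prob_space slabs
  unfolding slabs_def by (intro prob_space_PiM slab.prob_space_axioms)

sublocale base: pair_prob_space labels slabs ..

lemma prob_space_base: "prob_space base"
  unfolding base_def by (rule base.prob_space_axioms)

lemma entry_measurable [measurable]: "entry \<in> borel_measurable slab"
  unfolding entry_def[abs_def] slab_def by measurable

lemma all_moments_entry: "all_moments slab entry"
proof -
  interpret pair_prob_space "measure_pmf (bernoulli_pmf dens)" std_normal_distribution
    by (intro pair_prob_space.intro pair_sigma_finite.intro prob_space_imp_sigma_finite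
      prob_space_measure_pmf prob_space_std_normal)
  show ?thesis
    unfolding entry_def[abs_def] slab_def
    by (intro all_moments_mult
        all_moments_fst[OF all_moments_bernoulli prob_space_std_normal]
        all_moments_snd[OF all_moments_std_normal prob_space_measure_pmf prob_space_std_normal])
qed

lemma labels_measurable [measurable]: "i < n \<Longrightarrow> (\<lambda>\<xi>. \<xi> i) \<in> borel_measurable labels"
proof -
  assume "i < n"
  then have "(\<lambda>\<xi>. \<xi> i) \<in> labels \<rightarrow>\<^sub>M measure_pmf rademacher"
    unfolding labels_def by (intro measurable_component_singleton) simp
  then have "(\<lambda>\<xi>. id (\<xi> i)) \<in> borel_measurable labels"
    by (rule measurable_compose) simp
  then show ?thesis by simp
qed

lemma slabs_measurable [measurable]: "j < p \<Longrightarrow> (\<lambda>bg. bg j) \<in> slabs \<rightarrow>\<^sub>M slab"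
  unfolding slabs_def by (intro measurable_component_singleton) simp

lemma all_moments_label: "i < n \<Longrightarrow> all_moments labels (\<lambda>\<xi>. \<xi> i)"
  unfolding labels_def
  by (intro all_moments_PiM_component prob_space_measure_pmf all_moments_rademacher) simp

lemma all_moments_entry_comp: "j < p \<Longrightarrow> all_moments slabs (\<lambda>bg. entry (bg j))"
  unfolding slabs_def
  by (intro all_moments_PiM_component slab.prob_space_axioms all_moments_entry) simp

lemma signal_measurable [measurable]: "signal \<in> base \<rightarrow>\<^sub>M PiM I (\<lambda>_. borel)"
  unfolding signal_def split_beta' base_def
proof (rule measurable_restrict)
  fix ij :: "nat \<times> nat" assume "ij \<in> I"
  then have [measurable]: "fst ij < n" "snd ij < p" by auto
  have "(\<lambda>w. fst w (fst ij) * entry (snd w (snd ij))) \<in> borel_measurable (labels \<Otimes>\<^sub>M slabs)"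
    using measurable_compose[OF measurable_fst labels_measurable, of "fst ij"]
      measurable_compose[OF measurable_compose[OF measurable_snd slabs_measurable, of "snd ij"] entry_measurable]
    by (intro borel_measurable_times) auto
  then show "(\<lambda>w. fst w (fst ij) * entry (snd w (snd ij))) \<in> borel_measurable (labels \<Otimes>\<^sub>M slabs)" .
qed

lemma prior_eq: "prior = distr base (PiM I (\<lambda>_. borel)) signal"
  unfolding prior_def sparse_clustering_prior_def base_def labels_def slabs_def slab_def signal_def
    entry_def dens_def ..

sublocale prior: prob_space prior
  unfolding prior_eq by (rule prob_space.prob_space_distr[OF prob_space_base signal_measurable])

lemma signal_apply: "(i, j) \<in> I \<Longrightarrow> signal w (i, j) = fst w i * entry (snd w j)"
  by (simp add: signal_def split_beta')

lemma all_moments_signal_base: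
  assumes "ij \<in> I" shows "all_moments base (\<lambda>w. signal w ij)"
proof -
  obtain i j where ij: "ij = (i, j)" "i < n" "j < p" using assms by auto
  then show ?thesis
    unfolding base_def
    by (simp add: signal_apply) (intro base.all_moments_mult all_moments_fst all_moments_snd all_moments_label
      all_moments_entry_comp labels.prob_space_axioms slabs.prob_space_axioms)
qed

lemma all_moments_prior: "ij \<in> I \<Longrightarrow> all_moments prior (\<lambda>x. x ij)"
  unfolding prior_eq using all_moments_signal_base[of ij]
  by (subst all_moments_distr[OF signal_measurable]) auto

definition entry_moment :: "nat \<Rightarrow> real" where
  "entry_moment k = (\<integral>u. entry u ^ k \<partial>slab)"

lemma entry_moment_eq: "entry_moment k = (if k = 0 then 1 else dens * normal_moment k)"
proof (cases "k = 0")
  case True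
  then show ?thesis using slab.prob_space by (simp add: entry_moment_def)
next
  case False
  interpret N: prob_space std_normal_distribution by (rule prob_space_std_normal)
  have "entry_moment k = (\<integral>w. of_bool (fst w) * snd w ^ k \<partial>(measure_pmf (bernoulli_pmf dens) \<Otimes>\<^sub>M std_normal_distribution))"
    using False unfolding entry_moment_def slab_def entry_def
    by (intro Bochner_Integration.integral_cong) (auto simp: power_mult_distrib power_0_left)
  also have "\<dots> = (\<integral>b. of_bool b \<partial>measure_pmf (bernoulli_pmf dens)) * normal_moment k"
    unfolding normal_moment_def
    by (intro integral_pair_mult prob_space_measure_pmf prob_space_std_normal all_moments_bernoulli
      N.all_moments_power all_moments_std_normal)
  also have "(\<integral>b. of_bool b \<partial>measure_pmf (bernoulli_pmf dens)) = dens"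
    using dens_bounds by (subst integral_bernoulli_pmf) auto
  finally show ?thesis using False by simp
qed

lemma entry_moment_nonneg: "0 \<le> entry_moment k"
  using dens_bounds by (simp add: entry_moment_eq normal_moment_nonneg)

text \<open>Two nonzero exponents rest on dens^2 \<le> dens. Exponent 0 is a separate case because
  that moment is 1 and carries no factor \<open>dens\<close>.\<close>

lemma entry_moment_supermultiplicative: "entry_moment a * entry_moment b \<le> entry_moment (a + b)"
proof (cases "a = 0 \<or> b = 0")
  case False
  have "entry_moment a * entry_moment b = (dens * dens) * (normal_moment a * normal_moment b)"
    using False by (simp add: entry_moment_eq)
  also have "\<dots> \<le> dens * normal_moment (a + b)"
    using dens_bounds by (intro mult_mono normal_moment_supermultiplicative)
      (auto simp: normal_moment_nonneg mult_le_cancel_left1)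
  finally show ?thesis using False by (simp add: entry_moment_eq)
qed (auto simp: entry_moment_eq)

abbreviation rad :: "nat \<Rightarrow> real" where "rad k \<equiv> (if even k then 1 else 0)"

text \<open>Rank one makes a monomial split into row sums acting on the labels and column sums
  acting on the entries; a row survives exactly when its sum is even.\<close>

lemma moment_prior:
  "moment I prior \<beta> = (\<Prod>i<n. rad (\<Sum>j<p. \<beta> (i, j))) * (\<Prod>j<p. entry_moment (\<Sum>i<n. \<beta> (i, j)))"
proof -
  interpret PL: product_prob_space "\<lambda>_. measure_pmf rademacher" "{..<n}" ..
  interpret PS: product_prob_space "\<lambda>_. slab" "{..<p}" ..
  have "moment I prior \<beta> = (\<integral>w. (\<Prod>ij\<in>I. signal w ij ^ \<beta> ij) \<partial>base)"
    unfolding moment_def prior_eq by (subst integral_distr[OF signal_measurable]) auto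
  also have "\<dots> = (\<integral>w. (\<Prod>i<n. fst w i ^ (\<Sum>j<p. \<beta> (i, j))) * (\<Prod>j<p. entry (snd w j) ^ (\<Sum>i<n. \<beta> (i, j))) \<partial>base)"
  proof (rule Bochner_Integration.integral_cong[OF refl])
    fix w
    have "(\<Prod>ij\<in>I. signal w ij ^ \<beta> ij) = (\<Prod>(i, j)\<in>I. fst w i ^ \<beta> (i, j) * entry (snd w j) ^ \<beta> (i, j))"
      by (rule prod.cong) (auto simp: signal_apply power_mult_distrib)
    also have "\<dots> = (\<Prod>i<n. \<Prod>j<p. fst w i ^ \<beta> (i, j)) * (\<Prod>i<n. \<Prod>j<p. entry (snd w j) ^ \<beta> (i, j))"
      by (simp add: prod.cartesian_product[symmetric] prod.distrib)
    also have "(\<Prod>i<n. \<Prod>j<p. entry (snd w j) ^ \<beta> (i, j)) = (\<Prod>j<p. \<Prod>i<n. entry (snd w j) ^ \<beta> (i, j))"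
      by (rule prod.swap)
    finally show "(\<Prod>ij\<in>I. signal w ij ^ \<beta> ij) =
        (\<Prod>i<n. fst w i ^ (\<Sum>j<p. \<beta> (i, j))) * (\<Prod>j<p. entry (snd w j) ^ (\<Sum>i<n. \<beta> (i, j)))"
      by (simp add: power_sum)
  qed
  also have "\<dots> = (\<integral>\<xi>. (\<Prod>i<n. \<xi> i ^ (\<Sum>j<p. \<beta> (i, j))) \<partial>labels) * (\<integral>bg. (\<Prod>j<p. entry (bg j) ^ (\<Sum>i<n. \<beta> (i, j))) \<partial>slabs)"
    unfolding base_def
    by (intro integral_pair_mult labels.prob_space_axioms slabs.prob_space_axioms labels.all_moments_prod
      slabs.all_moments_prod labels.all_moments_power slabs.all_moments_power all_moments_label all_moments_entry_comp) auto
  also have "(\<integral>\<xi>. (\<Prod>i<n. \<xi> i ^ (\<Sum>j<p. \<beta> (i, j))) \<partial>labels) = (\<Prod>i<n. rad (\<Sum>j<p. \<beta> (i, j)))"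
    unfolding labels_def
    by (subst PL.product_integral_prod) (auto simp: rademacher_power intro!: all_moments_integrable all_moments_rademacher)
  also have "(\<integral>bg. (\<Prod>j<p. entry (bg j) ^ (\<Sum>i<n. \<beta> (i, j))) \<partial>slabs) = (\<Prod>j<p. entry_moment (\<Sum>i<n. \<beta> (i, j)))"
    unfolding slabs_def entry_moment_def
    by (subst PS.product_integral_prod) (auto intro!: all_moments_integrable slab.all_moments_power all_moments_entry)
  finally show ?thesis .
qed

text \<open>Inherited factor by factor: two even row sums have an even sum, and columns use
  \<open>entry_moment_supermultiplicative\<close>.\<close>

lemma supermultiplicative_prior: "supermultiplicative_moments I prior"
  unfolding supermultiplicative_moments_def
proof (intro conjI allI)
  show "0 \<le> moment I prior \<beta>" for \<beta>
    unfolding moment_prior by (intro mult_nonneg_nonneg prod_nonneg) (auto simp: entry_moment_nonneg)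
  fix \<beta> \<gamma> :: "nat \<times> nat \<Rightarrow> nat"
  have "moment I prior \<beta> * moment I prior \<gamma> =
    (\<Prod>i<n. rad (\<Sum>j<p. \<beta> (i, j)) * rad (\<Sum>j<p. \<gamma> (i, j))) *
    (\<Prod>j<p. entry_moment (\<Sum>i<n. \<beta> (i, j)) * entry_moment (\<Sum>i<n. \<gamma> (i, j)))"
    unfolding moment_prior prod.distrib by (simp only: mult_ac)
  also have "\<dots> \<le> (\<Prod>i<n. rad (\<Sum>j<p. \<beta> (i, j) + \<gamma> (i, j))) * (\<Prod>j<p. entry_moment (\<Sum>i<n. \<beta> (i, j) + \<gamma> (i, j)))"
    unfolding sum.distrib
    by (intro mult_mono prod_mono conjI entry_moment_supermultiplicative mult_nonneg_nonneg prod_nonneg ballI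
        entry_moment_nonneg) auto
  also have "\<dots> = moment I prior (\<lambda>ij. \<beta> ij + \<gamma> ij)"
    unfolding moment_prior ..
  finally show "moment I prior \<beta> * moment I prior \<gamma> \<le> moment I prior (\<lambda>ij. \<beta> ij + \<gamma> ij)" .
qed

lemma integral_prior_power:
  assumes "ij \<in> I"
  shows "(\<integral>x. x ij ^ k \<partial>prior) = rad k * entry_moment k"
proof -
  obtain i j where ij: "ij = (i, j)" "i < n" "j < p" using assms by auto
  have "(\<integral>x. x ij ^ k \<partial>prior) = (\<integral>w. signal w ij ^ k \<partial>base)"
    unfolding prior_eq using assms by (subst integral_distr[OF signal_measurable]) auto
  also have "\<dots> = (\<integral>w. fst w i ^ k * entry (snd w j) ^ k \<partial>base)"
    using ij by (simp add: signal_apply power_mult_distrib)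
  also have "\<dots> = (\<integral>\<xi>. \<xi> i ^ k \<partial>labels) * (\<integral>bg. entry (bg j) ^ k \<partial>slabs)"
    unfolding base_def using ij
    by (intro integral_pair_mult labels.prob_space_axioms slabs.prob_space_axioms
      labels.all_moments_power slabs.all_moments_power all_moments_label all_moments_entry_comp)
  also have "(\<integral>\<xi>. \<xi> i ^ k \<partial>labels) = (\<integral>x. x ^ k \<partial>distr labels (measure_pmf rademacher) (\<lambda>\<xi>. \<xi> i))"
    using ij unfolding labels_def by (subst integral_distr[OF measurable_component_singleton]) auto
  also have "\<dots> = rad k"
    using ij unfolding labels_def by (subst distr_PiM_component) (auto simp: prob_space_measure_pmf rademacher_power)
  also have "(\<integral>bg. entry (bg j) ^ k \<partial>slabs) = (\<integral>u. entry u ^ k \<partial>distr slabs slab (\<lambda>bg. bg j))"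
    using ij by (subst integral_distr[OF slabs_measurable]) auto
  also have "\<dots> = entry_moment k"
    using ij unfolding slabs_def by (subst distr_PiM_component) (auto simp: slab.prob_space_axioms entry_moment_def)
  finally show ?thesis .
qed

lemma second_moment_prior: "ij \<in> I \<Longrightarrow> (\<integral>x. (x ij)\<^sup>2 \<partial>prior) = dens"
  by (subst integral_prior_power) (auto simp: entry_moment_eq numeral_2_eq_2 normal_moment_simps)

lemma sum_second_moment_prior: "(\<Sum>ij\<in>I. \<integral>x. (x ij)\<^sup>2 \<partial>prior) = real n * s"
  using p_pos by (simp add: second_moment_prior dens_def)

lemma mmse_trivial_prior: "mmse_trivial I prior = real n * s"
proof -
  have "(\<integral>x. x ij \<partial>prior) = 0" if "ij \<in> I" for ij
    using integral_prior_power[OF that, of 1] by simp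
  moreover have "(\<integral>x. (\<Sum>ij\<in>I. (x ij)\<^sup>2) \<partial>prior) = (\<Sum>ij\<in>I. \<integral>x. (x ij)\<^sup>2 \<partial>prior)"
    by (intro Bochner_Integration.integral_sum all_moments_integrable prior.all_moments_power all_moments_prior)
  ultimately show ?thesis
    unfolding mmse_trivial_def sum_second_moment_prior by simp
qed

lemma gaussian_additive_prior: "0 \<le> lam \<Longrightarrow> gaussian_additive prior I lam"
  by unfold_locales (auto intro: all_moments_prior)

end

section \<open>Exponential moments and elementary inequalities\<close>

text \<open>Termwise comparison of power series through 2^n n! \<le> (2 n)!. The series of cosh is
  first grouped in pairs to get rid of its vanishing odd terms.\<close>

lemma cosh_le_exp_half_square: "cosh (x::real) \<le> exp (x\<^sup>2 / 2)"
proof -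
  let ?f = "\<lambda>n. if even n then x ^ n /\<^sub>R fact n else 0"
  have "(\<lambda>n. sum ?f {n * 2..<n * 2 + 2}) sums cosh x"
    by (rule sums_group[OF cosh_converges]) simp
  moreover have "sum ?f {n * 2..<n * 2 + 2} = x ^ (2 * n) / fact (2 * n)" for n
  proof -
    have "{n * 2..<n * 2 + 2} = {2 * n, Suc (2 * n)}" by auto
    then show ?thesis by (simp add: divide_inverse mult.commute)
  qed
  ultimately have sums1: "(\<lambda>n. x ^ (2 * n) / fact (2 * n)) sums cosh x" by simp
  have sums2: "(\<lambda>n. (x\<^sup>2 / 2) ^ n /\<^sub>R fact n) sums exp (x\<^sup>2 / 2)"
    by (rule exp_converges)
  have le: "x ^ (2 * n) / fact (2 * n) \<le> (x\<^sup>2 / 2) ^ n /\<^sub>R fact n" for n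
  proof -
    have "2 ^ n * fact n \<le> (fact (2 * n) :: real)"
    proof (induction n)
      case (Suc n)
      have "2 ^ Suc n * fact (Suc n) = (2 * real n + 2) * (2 ^ n * fact n)"
        unfolding fact_Suc power_Suc by (simp only: of_nat_mult of_nat_Suc) algebra
      also have "\<dots> \<le> (2 * real n + 2) * ((2 * real n + 1) * fact (2 * n))"
      proof (rule mult_left_mono)
        have "1 * fact (2 * n) \<le> (2 * real n + 1) * fact (2 * n)" by (intro mult_right_mono) auto
        with Suc show "2 ^ n * fact n \<le> (2 * real n + 1) * fact (2 * n)" by linarith
      qed simp
      also have "\<dots> = fact (Suc (Suc (2 * n)))"
        unfolding fact_Suc by (simp only: of_nat_mult of_nat_Suc of_nat_numeral) algebra
      also have "Suc (Suc (2 * n)) = 2 * Suc n" by simp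
      finally show ?case .
    qed simp
    then have "x ^ (2 * n) / fact (2 * n) \<le> x ^ (2 * n) / (2 ^ n * fact n)"
      by (rule divide_left_mono) (auto simp: power_mult)
    moreover have "(x\<^sup>2 / 2) ^ n /\<^sub>R fact n = x ^ (2 * n) / (2 ^ n * fact n)"
      unfolding power_mult power_divide real_scaleR_def by (simp add: field_simps)
    ultimately show ?thesis by (simp only:)
  qed
  show ?thesis by (rule sums_le[OF le sums1 sums2])
qed

lemma power_le_fact_exp:
  assumes "0 \<le> (x::real)" shows "x ^ k \<le> fact k * exp x"
proof -
  have "x ^ k /\<^sub>R fact k \<le> exp x"
    using sum_le_suminf[OF summable_exp_generic, of "{k}" x] assms by (simp add: exp_def)
  then show ?thesis by (simp add: field_simps)
qed

lemma nn_integral_rademacher_exp: "(\<integral>\<^sup>+x. ennreal (exp (a * x)) \<partial>measure_pmf rademacher) = ennreal (cosh a)"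
proof -
  have "(\<integral>\<^sup>+x. ennreal (exp (a * x)) \<partial>measure_pmf rademacher) = ennreal (\<integral>x. exp (a * x) \<partial>measure_pmf rademacher)"
    by (intro nn_integral_eq_integral all_moments_integrable all_moments_rademacher AE_I2) simp
  then show ?thesis by (simp add: integral_rademacher cosh_def)
qed

text \<open>The weight turns the standard normal density into \<open>sqrt 2\<close> times the normal
  density of variance 2.\<close>

lemma nn_integral_std_normal_exp_square:
  "(\<integral>\<^sup>+z. ennreal (exp (z\<^sup>2 / 4)) \<partial>std_normal_distribution) = ennreal (sqrt 2)"
proof -
  have "(\<integral>\<^sup>+z. ennreal (exp (z\<^sup>2 / 4)) \<partial>std_normal_distribution) =
      (\<integral>\<^sup>+z. ennreal (std_normal_density z * exp (z\<^sup>2 / 4)) \<partial>lborel)"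
    by (subst nn_integral_density) (auto simp: ennreal_mult)
  also have "\<dots> = (\<integral>\<^sup>+z. ennreal (sqrt 2 * normal_density 0 (sqrt 2) z) \<partial>lborel)"
  proof (rule nn_integral_cong)
    fix z :: real
    have "std_normal_density z * exp (z\<^sup>2 / 4) = 1 / sqrt (2 * pi) * exp (- z\<^sup>2 / 2 + z\<^sup>2 / 4)"
      unfolding std_normal_density_def exp_add by (simp only: mult.assoc)
    also have "- z\<^sup>2 / 2 + z\<^sup>2 / 4 = - z\<^sup>2 / 4" by simp
    also have "1 / sqrt (2 * pi) * exp (- z\<^sup>2 / 4) = sqrt 2 * normal_density 0 (sqrt 2) z"
      by (simp add: normal_density_def real_sqrt_mult field_simps)
    finally show "ennreal (std_normal_density z * exp (z\<^sup>2 / 4)) = ennreal (sqrt 2 * normal_density 0 (sqrt 2) z)"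
      by simp
  qed
  also have "\<dots> = ennreal (\<integral>z. sqrt 2 * normal_density 0 (sqrt 2) z \<partial>lborel)"
    by (intro nn_integral_eq_integral) auto
  finally show ?thesis by simp
qed

text \<open>The chord of exp between 0 and y / 4. It transfers the exponential moment at 1/4 to all
  smaller parameters with an error linear in \<tau>, which preserves the sparsity factor.\<close>

lemma exp_scaled_convex:
  assumes "0 \<le> \<tau>" "\<tau> \<le> 1 / 4"
  shows "exp (\<tau> * y) \<le> (1 - 4 * \<tau>) + 4 * \<tau> * exp (y / 4 :: real)"
  using convex_onD[OF convex_on_exp[of 1], of "4 * \<tau>" 0 "y / 4"] assms by simp

section \<open>Gaussian scale mixtures\<close>

text \<open>Variance 0 gets the value 0: the event W = 0 produces the atom at 0, which a density off
  0 must ignore. The quotient by v is then 0 there as well.\<close>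

definition gauss_kernel :: "real \<Rightarrow> real \<Rightarrow> real" where
  "gauss_kernel v t = (if 0 < v then exp (- t\<^sup>2 / (2 * v)) / sqrt (2 * pi * v) else 0)"

lemma gauss_kernel_nonneg [simp]: "0 \<le> gauss_kernel v t"
  by (simp add: gauss_kernel_def)

lemma gauss_kernel_measurable_compose [measurable (raw)]:
  assumes "f \<in> borel_measurable M" "g \<in> borel_measurable M"
  shows "(\<lambda>x. gauss_kernel (f x) (g x)) \<in> borel_measurable M"
  using assms unfolding gauss_kernel_def by measurable

text \<open>For fixed t these yield kernel bounds uniform in v, as domination requires. With u = t^2
  / (2 v), the inequality 4 x \<le> (1 + x)^2 is used at x = u / 3, so that cubing exp (u / 3) gives
  exactly exp u.\<close>

lemma exp_scaled_ge:
  assumes v: "0 < v"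
  shows "\<bar>t\<bar> / 2 \<le> sqrt v * exp (t\<^sup>2 / (2 * v))"
    and "(\<bar>t\<bar> / 2) ^ 3 \<le> sqrt v ^ 3 * exp (t\<^sup>2 / (2 * v))"
proof -
  define u where "u = t\<^sup>2 / (2 * v)"
  have u: "0 \<le> u" "v * u = t\<^sup>2 / 2" using v by (auto simp: u_def)
  have "4 * (u / 3) \<le> (1 + u / 3)\<^sup>2"
    using zero_le_power2[of "1 - u / 3"] by (simp add: power2_eq_square algebra_simps)
  then have "v * (4 * (u / 3)) \<le> v * (1 + u / 3)\<^sup>2"
    using v by (intro mult_left_mono) auto
  moreover have "t\<^sup>2 / 4 \<le> v * (4 * (u / 3))"
    using u(2) zero_le_power2[of t] by linarith
  ultimately have "t\<^sup>2 / 4 \<le> v * (1 + u / 3)\<^sup>2" by linarith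
  moreover have "(\<bar>t\<bar> / 2)\<^sup>2 = t\<^sup>2 / 4" "(sqrt v * (1 + u / 3))\<^sup>2 = v * (1 + u / 3)\<^sup>2"
    using v by (simp_all add: power_divide power_mult_distrib)
  ultimately have "(\<bar>t\<bar> / 2)\<^sup>2 \<le> (sqrt v * (1 + u / 3))\<^sup>2"
    by (simp only:)
  moreover have "0 \<le> sqrt v * (1 + u / 3)"
    using u(1) v by simp
  ultimately have base: "\<bar>t\<bar> / 2 \<le> sqrt v * (1 + u / 3)"
    by (rule power2_le_imp_le)
  have e: "1 + u / 3 \<le> exp (u / 3)" by (rule exp_ge_add_one_self)
  have "exp (u / 3) \<le> exp u" using u(1) by simp
  then have "sqrt v * (1 + u / 3) \<le> sqrt v * exp u"
    using order_trans[OF e \<open>exp (u / 3) \<le> exp u\<close>] v by (intro mult_left_mono) auto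
  with base show "\<bar>t\<bar> / 2 \<le> sqrt v * exp (t\<^sup>2 / (2 * v))"
    by (simp add: u_def)
  have "(\<bar>t\<bar> / 2) ^ 3 \<le> (sqrt v * exp (u / 3)) ^ 3"
    using base e v by (intro power_mono order_trans[OF base] mult_left_mono) auto
  also have "\<dots> = sqrt v ^ 3 * exp u"
    by (simp add: power_mult_distrib exp_of_nat_mult[symmetric])
  finally show "(\<bar>t\<bar> / 2) ^ 3 \<le> sqrt v ^ 3 * exp (t\<^sup>2 / (2 * v))"
    by (simp add: u_def)
qed

lemma gauss_kernel_eq:
  assumes "0 < v"
  shows "gauss_kernel v t = 1 / (sqrt (2 * pi) * (sqrt v * exp (t\<^sup>2 / (2 * v))))"
  using assms by (simp add: gauss_kernel_def real_sqrt_mult exp_minus field_simps)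

lemma one_le_sqrt_2pi: "1 \<le> sqrt (2 * pi)"
  using pi_gt3 by (intro real_le_rsqrt) auto

lemma gauss_kernel_le:
  assumes t: "t \<noteq> 0"
  shows "gauss_kernel v t \<le> 2 / \<bar>t\<bar>" and "gauss_kernel v t / v \<le> 8 / \<bar>t\<bar> ^ 3"
proof -
  show "gauss_kernel v t \<le> 2 / \<bar>t\<bar>"
  proof (cases "0 < v")
    case True
    have "\<bar>t\<bar> / 2 \<le> 1 * (sqrt v * exp (t\<^sup>2 / (2 * v)))"
      using exp_scaled_ge(1)[OF True] by simp
    also have "\<dots> \<le> sqrt (2 * pi) * (sqrt v * exp (t\<^sup>2 / (2 * v)))"
      using True one_le_sqrt_2pi by (intro mult_right_mono) auto
    finally have "1 / (sqrt (2 * pi) * (sqrt v * exp (t\<^sup>2 / (2 * v)))) \<le> 1 / (\<bar>t\<bar> / 2)"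
      using t by (intro divide_left_mono) (auto intro!: mult_pos_pos True)
    then show ?thesis using True by (simp add: gauss_kernel_eq)
  qed (use t in \<open>simp add: gauss_kernel_def\<close>)
  show "gauss_kernel v t / v \<le> 8 / \<bar>t\<bar> ^ 3"
  proof (cases "0 < v")
    case True
    have "(\<bar>t\<bar> / 2) ^ 3 \<le> 1 * (sqrt v ^ 3 * exp (t\<^sup>2 / (2 * v)))"
      using exp_scaled_ge(2)[OF True] by simp
    also have "\<dots> \<le> sqrt (2 * pi) * (sqrt v ^ 3 * exp (t\<^sup>2 / (2 * v)))"
      using True one_le_sqrt_2pi by (intro mult_right_mono) auto
    also have "\<dots> = sqrt (2 * pi) * (sqrt v * exp (t\<^sup>2 / (2 * v))) * v"
      using True by (simp add: power3_eq_cube)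
    finally have "1 / (sqrt (2 * pi) * (sqrt v * exp (t\<^sup>2 / (2 * v))) * v) \<le> 1 / (\<bar>t\<bar> / 2) ^ 3"
      using t by (intro divide_left_mono) (auto intro!: mult_pos_pos True)
    then show ?thesis using True by (simp add: gauss_kernel_eq power_divide)
  qed (use t in \<open>simp add: gauss_kernel_def\<close>)
qed

lemma DERIV_gauss_kernel:
  "(gauss_kernel v has_real_derivative - t * (gauss_kernel v t / v)) (at t)"
proof (cases "0 < v")
  case True
  have "gauss_kernel v = (\<lambda>t. exp (- t\<^sup>2 / (2 * v)) / sqrt (2 * pi * v))"
    using True by (auto simp: gauss_kernel_def fun_eq_iff)
  then show ?thesis
    using True by (auto intro!: derivative_eq_intros simp: gauss_kernel_def field_simps)
next
  case False
  then have "gauss_kernel v = (\<lambda>t. 0)" by (auto simp: gauss_kernel_def fun_eq_iff)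
  then show ?thesis by simp
qed

text \<open>Differentiation under the integral: the mean value inequality bounds all difference
  quotients by C, and dominated convergence applies along sequences. Convexity of \<open>S\<close>
  serves the former; openness turns the limit within \<open>S\<close> into the full one.\<close>

lemma (in prob_space) DERIV_expectation:
  fixes \<phi> \<psi> :: "'a \<Rightarrow> real \<Rightarrow> real"
  assumes S: "open S" "convex S" "t \<in> S"
    and deriv: "\<And>x y. y \<in> S \<Longrightarrow> (\<phi> x has_real_derivative \<psi> x y) (at y)"
    and bound: "\<And>x y. y \<in> S \<Longrightarrow> \<bar>\<psi> x y\<bar> \<le> C"
    and int: "\<And>y. y \<in> S \<Longrightarrow> integrable M (\<lambda>x. \<phi> x y)"
    and meas: "(\<lambda>x. \<psi> x t) \<in> borel_measurable M"
  shows "((\<lambda>y. expectation (\<lambda>x. \<phi> x y)) has_real_derivative expectation (\<lambda>x. \<psi> x t)) (at t)"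
proof -
  have "((\<lambda>y. (expectation (\<lambda>x. \<phi> x y) - expectation (\<lambda>x. \<phi> x t)) / (y - t)) \<longlongrightarrow> expectation (\<lambda>x. \<psi> x t)) (at t within S)"
    unfolding tendsto_at_iff_sequentially
  proof (intro allI impI)
    fix X assume X: "\<forall>i. X i \<in> S - {t}" "X \<longlonglongrightarrow> t"
    have "(\<lambda>i. expectation (\<lambda>x. (\<phi> x (X i) - \<phi> x t) / (X i - t))) \<longlonglongrightarrow> expectation (\<lambda>x. \<psi> x t)"
    proof (rule integral_dominated_convergence)
      show "integrable M (\<lambda>x. C)" by simp
      show "(\<lambda>x. \<psi> x t) \<in> borel_measurable M" by (rule meas)
      show "(\<lambda>x. (\<phi> x (X i) - \<phi> x t) / (X i - t)) \<in> borel_measurable M" for i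
        using int[of "X i"] int[of t] X(1) S(3) by (auto intro!: borel_measurable_divide borel_measurable_diff)
      show "AE x in M. (\<lambda>i. (\<phi> x (X i) - \<phi> x t) / (X i - t)) \<longlonglongrightarrow> \<psi> x t"
      proof (rule AE_I2)
        fix x
        have "((\<lambda>y. (\<phi> x y - \<phi> x t) / (y - t)) \<longlongrightarrow> \<psi> x t) (at t)"
          using deriv[OF S(3)] by (simp add: has_field_derivative_iff)
        then show "(\<lambda>i. (\<phi> x (X i) - \<phi> x t) / (X i - t)) \<longlonglongrightarrow> \<psi> x t"
          using X unfolding tendsto_at_iff_sequentially comp_def by blast
      qed
      show "AE x in M. norm ((\<phi> x (X i) - \<phi> x t) / (X i - t)) \<le> C" for i
      proof (rule AE_I2)
        fix x
        have "norm (\<phi> x (X i) - \<phi> x t) \<le> C * norm (X i - t)"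
        proof (rule field_differentiable_bound[OF S(2)])
          show "(\<phi> x has_field_derivative \<psi> x y) (at y within S)" if "y \<in> S" for y
            using deriv[OF that] by (rule has_field_derivative_at_within)
          show "norm (\<psi> x y) \<le> C" if "y \<in> S" for y using bound[OF that] by simp
        qed (use X(1) S(3) in auto)
        moreover have "X i \<noteq> t" using X(1) by auto
        ultimately show "norm ((\<phi> x (X i) - \<phi> x t) / (X i - t)) \<le> C"
          by (simp add: norm_divide divide_le_eq)
      qed
    qed
    moreover have "expectation (\<lambda>x. (\<phi> x (X i) - \<phi> x t) / (X i - t)) =
        (expectation (\<lambda>x. \<phi> x (X i)) - expectation (\<lambda>x. \<phi> x t)) / (X i - t)" for i
      using int[of "X i"] int[of t] X(1) S(3) by simp
    ultimately show "((\<lambda>y. (expectation (\<lambda>x. \<phi> x y) - expectation (\<lambda>x. \<phi> x t)) / (y - t)) \<circ> X)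
        \<longlonglongrightarrow> expectation (\<lambda>x. \<psi> x t)"
      by (simp only: comp_def)
  qed
  then show ?thesis
    unfolding has_field_derivative_iff using at_within_open[OF S(3,1)] by simp
qed

text \<open>Two versions agree almost everywhere off 0; by continuity a difference at t would
  persist on an interval of positive length. This gives the choice in \<open>density_off_0\<close>
  definite values.\<close>

lemma is_density_off_0_unique:
  assumes f: "is_density_off_0 L f" and g: "is_density_off_0 L g" and t: "t \<noteq> 0"
  shows "f t = g t"
proof -
  have meas: "(\<lambda>x. ennreal (indicator (- {0}) x * h x)) \<in> borel_measurable lborel"
    if "is_density_off_0 L h" for h
    using borel_measurable_continuous_on_indicator[of "- {0}" h] that by (simp add: is_density_off_0_def)
  have dens: "(\<integral>\<^sup>+x\<in>A. ennreal (indicator (- {0}) x * h x) \<partial>lborel) = emeasure L (A - {0})"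
    if "is_density_off_0 L h" "A \<in> sets lborel" for h A
  proof -
    have "A - {0} \<in> sets borel" using that by auto
    then have "emeasure L (A - {0}) = (\<integral>\<^sup>+x\<in>A - {0}. ennreal (h x) \<partial>lborel)"
      using that unfolding is_density_off_0_def by blast
    also have "\<dots> = (\<integral>\<^sup>+x\<in>A. ennreal (indicator (- {0}) x * h x) \<partial>lborel)"
      by (rule nn_integral_cong) (auto simp: indicator_def)
    finally show ?thesis ..
  qed
  have "AE x in lborel. ennreal (indicator (- {0}) x * f x) = ennreal (indicator (- {0}) x * g x)"
    by (rule sigma_finite_measure.density_unique2[OF sigma_finite_lborel]) (use meas dens f g in auto)
  then have "AE x in lborel. x \<noteq> 0 \<longrightarrow> f x = g x"
    by (rule AE_mp) (use f g in \<open>auto simp: is_density_off_0_def indicator_def intro!: AE_I2\<close>)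
  then have ae: "AE x in lborel. x \<noteq> 0 \<longrightarrow> f x = g x" .
  show "f t = g t"
  proof (rule ccontr)
    assume "f t \<noteq> g t"
    have "isCont h t" if "is_density_off_0 L h" for h
      using that t unfolding is_density_off_0_def
      by (metis Compl_iff continuous_on_interior empty_iff insert_iff interior_open open_Compl closed_singleton)
    from isCont_diff[OF this[OF f] this[OF g]] obtain d where
      d: "0 < d" "\<And>x. dist t x < d \<Longrightarrow> f x - g x \<noteq> 0"
      using continuous_at_avoid[of t "\<lambda>x. f x - g x" 0] \<open>f t \<noteq> g t\<close> by auto
    define e where "e = min d \<bar>t\<bar>"
    have e: "x \<noteq> 0 \<and> f x \<noteq> g x" if "\<bar>x - t\<bar> < e" for x
      using d(2)[of x] that unfolding e_def by (auto simp: dist_real_def abs_minus_commute[of t])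
    have "0 < e" using d(1) t by (simp add: e_def)
    have "AE x in lborel. x \<notin> {t - e<..<t + e}"
      using ae
    proof (rule AE_mp, intro AE_I2 impI notI)
      fix x assume "x \<noteq> 0 \<longrightarrow> f x = g x" "x \<in> {t - e<..<t + e}"
      then show False using e[of x] by (auto simp: abs_less_iff)
    qed
    then have "{t - e<..<t + e} \<in> null_sets lborel"
      by (subst AE_iff_null_sets) auto
    then show False using \<open>0 < e\<close> by (simp add: null_sets_def)
  qed
qed

locale gaussian_scale_mixture = prob_space M for M :: "'a measure" +
  fixes W :: "'a \<Rightarrow> real"
  assumes W_measurable [measurable]: "W \<in> borel_measurable M" and W_nonneg: "\<And>x. 0 \<le> W x"
begin

definition law :: "real measure" where
  "law = distr (M \<Otimes>\<^sub>M std_normal_distribution) borel (\<lambda>(x, z). sqrt (W x) * z)"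

definition mix_density :: "real \<Rightarrow> real" where
  "mix_density t = expectation (\<lambda>x. gauss_kernel (W x) t)"

text \<open>The derivative of \<open>mix_density\<close> divided by -t. Its quotient by
  \<open>mix_density\<close> is the mean of 1 / W under the law tilted by the kernel, which is why
  typical values of W decide the size of the derivative of the potential.\<close>

definition mix_slope :: "real \<Rightarrow> real" where
  "mix_slope t = expectation (\<lambda>x. gauss_kernel (W x) t / W x)"

lemma integrable_gauss_kernel: "t \<noteq> 0 \<Longrightarrow> integrable M (\<lambda>x. gauss_kernel (W x) t)"
  by (rule integrable_const_bound[where B = "2 / \<bar>t\<bar>"]) (auto simp: gauss_kernel_le)

lemma integrable_gauss_kernel_divide: "t \<noteq> 0 \<Longrightarrow> integrable M (\<lambda>x. gauss_kernel (W x) t / W x)"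
  by (rule integrable_const_bound[where B = "8 / \<bar>t\<bar> ^ 3"])
    (use W_nonneg gauss_kernel_le(2) in \<open>auto simp: abs_of_nonneg\<close>)

lemma DERIV_mix_density:
  assumes t: "t \<noteq> 0"
  shows "(mix_density has_real_derivative - t * mix_slope t) (at t)"
proof -
  \<comment> \<open>This radius keeps the neighbourhood away from 0, where the kernel bounds blow
    up.\<close>
  define S where "S = ball t (\<bar>t\<bar> / 2)"
  have S: "\<bar>t\<bar> / 2 \<le> \<bar>y\<bar>" "\<bar>y\<bar> \<le> 2 * \<bar>t\<bar>" if "y \<in> S" for y
    using that unfolding S_def mem_ball dist_real_def by linarith+
  then have nz: "y \<noteq> 0" if "y \<in> S" for y using that t by fastforce
  have "(mix_density has_real_derivative expectation (\<lambda>x. - t * (gauss_kernel (W x) t / W x))) (at t)"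
    unfolding mix_density_def[abs_def]
  proof (rule DERIV_expectation[of S])
    fix x y assume y: "y \<in> S"
    show "(gauss_kernel (W x) has_real_derivative - y * (gauss_kernel (W x) y / W x)) (at y)"
      by (rule DERIV_gauss_kernel)
    have "\<bar>- y * (gauss_kernel (W x) y / W x)\<bar> = \<bar>y\<bar> * (gauss_kernel (W x) y / W x)"
      using W_nonneg[of x] by (simp add: abs_mult)
    also have "\<dots> \<le> (2 * \<bar>t\<bar>) * (8 / (\<bar>t\<bar> / 2) ^ 3)"
    proof (rule mult_mono)
      have "gauss_kernel (W x) y / W x \<le> 8 / \<bar>y\<bar> ^ 3" by (rule gauss_kernel_le(2)[OF nz[OF y]])
      also have "\<dots> \<le> 8 / (\<bar>t\<bar> / 2) ^ 3"
        using S[OF y] t nz[OF y] by (intro divide_left_mono power_mono) auto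
      finally show "gauss_kernel (W x) y / W x \<le> 8 / (\<bar>t\<bar> / 2) ^ 3" .
    qed (use S[OF y] W_nonneg[of x] in auto)
    finally show "\<bar>- y * (gauss_kernel (W x) y / W x)\<bar> \<le> (2 * \<bar>t\<bar>) * (8 / (\<bar>t\<bar> / 2) ^ 3)" .
  qed (use t in \<open>auto simp: S_def intro!: integrable_gauss_kernel nz[unfolded S_def]\<close>)
  then show ?thesis by (simp only: integral_mult_right_zero mix_slope_def)
qed

lemma scaled_std_normal:
  assumes v: "0 < v" and A: "A \<in> sets borel"
  shows "(\<integral>\<^sup>+z. indicator A (sqrt v * z) \<partial>std_normal_distribution) = (\<integral>\<^sup>+t. ennreal (gauss_kernel v t) * indicator A t \<partial>lborel)"
proof -
  have "(\<integral>\<^sup>+t. ennreal (gauss_kernel v t) * indicator A t \<partial>lborel) =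
      ennreal \<bar>sqrt v\<bar> * (\<integral>\<^sup>+z. ennreal (gauss_kernel v (0 + sqrt v * z)) * indicator A (0 + sqrt v * z) \<partial>lborel)"
    using A v by (intro nn_integral_real_affine) auto
  also have "\<dots> = (\<integral>\<^sup>+z. ennreal (sqrt v) * (ennreal (gauss_kernel v (sqrt v * z)) * indicator A (sqrt v * z)) \<partial>lborel)"
    using A v by (subst nn_integral_cmult[symmetric]) auto
  also have "\<dots> = (\<integral>\<^sup>+z. ennreal (std_normal_density z) * indicator A (sqrt v * z) \<partial>lborel)"
  proof (rule nn_integral_cong)
    fix z
    have "sqrt v * gauss_kernel v (sqrt v * z) = std_normal_density z"
      using v by (simp add: gauss_kernel_def std_normal_density_def power_mult_distrib real_sqrt_mult)
    then have "ennreal (sqrt v) * ennreal (gauss_kernel v (sqrt v * z)) = ennreal (std_normal_density z)"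
      using v by (simp add: ennreal_mult[symmetric])
    then show "ennreal (sqrt v) * (ennreal (gauss_kernel v (sqrt v * z)) * indicator A (sqrt v * z)) =
        ennreal (std_normal_density z) * indicator A (sqrt v * z)"
      by (simp add: mult.assoc[symmetric])
  qed
  also have "\<dots> = (\<integral>\<^sup>+z. indicator A (sqrt v * z) \<partial>std_normal_distribution)"
    using A by (subst nn_integral_density) auto
  finally show ?thesis ..
qed

text \<open>Where W vanishes the conditional law sits at 0, outside every admissible
  \<open>A\<close>; elsewhere Fubini's theorem averages the Gaussian densities.\<close>

lemma is_density_off_0_mix_density: "is_density_off_0 law mix_density"
  unfolding is_density_off_0_def
proof (intro conjI allI ballI impI)
  show "0 \<le> mix_density x" for x
    unfolding mix_density_def by (rule Bochner_Integration.integral_nonneg) simp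
  show "continuous_on (- {0}) mix_density"
    by (rule continuous_at_imp_continuous_on) (auto intro: DERIV_isCont DERIV_mix_density)
  fix A :: "real set" assume A [measurable]: "A \<in> sets borel" and "0 \<notin> A"
  interpret N: prob_space std_normal_distribution
    by (rule prob_space_std_normal)
  interpret MN: pair_sigma_finite M lborel ..
  have "emeasure law A = (\<integral>\<^sup>+w. indicator A (sqrt (W (fst w)) * snd w) \<partial>(M \<Otimes>\<^sub>M std_normal_distribution))"
    unfolding law_def
    by (subst nn_integral_indicator[symmetric], simp, subst nn_integral_distr) (auto simp: split_beta')
  also have "\<dots> = (\<integral>\<^sup>+x. \<integral>\<^sup>+z. indicator A (sqrt (W x) * z) \<partial>std_normal_distribution \<partial>M)"
    by (subst N.nn_integral_fst[symmetric]) auto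
  also have "\<dots> = (\<integral>\<^sup>+x. \<integral>\<^sup>+t. ennreal (gauss_kernel (W x) t) * indicator A t \<partial>lborel \<partial>M)"
  proof (rule nn_integral_cong)
    fix x
    show "(\<integral>\<^sup>+z. indicator A (sqrt (W x) * z) \<partial>std_normal_distribution) =
        (\<integral>\<^sup>+t. ennreal (gauss_kernel (W x) t) * indicator A t \<partial>lborel)"
    proof (cases "0 < W x")
      case False
      then have "W x = 0" using W_nonneg[of x] by simp
      then show ?thesis using \<open>0 \<notin> A\<close> by (simp add: gauss_kernel_def)
    qed (simp add: scaled_std_normal)
  qed
  also have "\<dots> = (\<integral>\<^sup>+t. \<integral>\<^sup>+x. ennreal (gauss_kernel (W x) t) * indicator A t \<partial>M \<partial>lborel)"
    by (rule MN.Fubini'[symmetric]) measurable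
  also have "\<dots> = (\<integral>\<^sup>+t\<in>A. ennreal (mix_density t) \<partial>lborel)"
  proof (rule nn_integral_cong)
    fix t
    show "(\<integral>\<^sup>+x. ennreal (gauss_kernel (W x) t) * indicator A t \<partial>M) = ennreal (mix_density t) * indicator A t"
    proof (cases "t \<in> A")
      case True
      then have "t \<noteq> 0" using \<open>0 \<notin> A\<close> by auto
      then show ?thesis
        using True unfolding mix_density_def
        by (simp add: nn_integral_eq_integral[OF integrable_gauss_kernel])
    qed simp
  qed
  finally show "emeasure law A = (\<integral>\<^sup>+t\<in>A. ennreal (mix_density t) \<partial>lborel)" .
qed

lemma density_off_0_law:
  assumes "t \<noteq> 0"
  shows "density_off_0 law t = mix_density t"
proof (rule is_density_off_0_unique[OF _ is_density_off_0_mix_density assms])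
  show "is_density_off_0 law (density_off_0 law)"
    unfolding density_off_0_def by (rule someI[of _ mix_density]) (rule is_density_off_0_mix_density)
qed

lemma DERIV_franz_parisi_ann:
  assumes t: "t \<noteq> 0" and pos: "0 < mix_density t"
  shows "(franz_parisi_ann law lam has_real_derivative t * mix_slope t / mix_density t - lam) (at t)"
proof -
  have "((\<lambda>q. - lam * q - ln (mix_density q)) has_real_derivative t * mix_slope t / mix_density t - lam) (at t)"
    using pos by (auto intro!: derivative_eq_intros DERIV_mix_density t)
  then show ?thesis
  proof (rule has_field_derivative_transform_within_open)
    show "open (- {0::real})" by (intro open_Compl closed_singleton)
  qed (use t in \<open>auto simp: franz_parisi_ann_def density_off_0_law\<close>)
qed

end

section \<open>Quantile and density estimates from moments of the variance\<close>

lemma (in finite_measure) integrable_indicator_event: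
  "A \<in> sets M \<Longrightarrow> integrable M (indicator A :: 'a \<Rightarrow> real)"
  by (rule integrable_const_bound[where B = 1]) (auto simp: indicator_def)

text \<open>Pointwise Z \<le> \<mu> / 2 + Z^2 / (4 K \<mu>) + K \<mu> 1_A, where A is the event; on
  A this is (Z - 2 K \<mu>)^2 \<ge> 0. In expectation the second term is at most \<mu> / 4, which
  leaves \<mu> / 4 for the last.\<close>

lemma (in prob_space) paley_zygmund:
  assumes nonneg: "\<And>x. 0 \<le> Z x" and int: "integrable M Z" "integrable M (\<lambda>x. (Z x)\<^sup>2)"
    and mu: "0 < \<mu>" "\<mu> \<le> expectation Z" and K: "0 < K" "expectation (\<lambda>x. (Z x)\<^sup>2) \<le> K * \<mu>\<^sup>2"
  shows "1 / (4 * K) \<le> prob {x\<in>space M. \<mu> / 2 \<le> Z x}"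
proof -
  define A where "A = {x\<in>space M. \<mu> / 2 \<le> Z x}"
  have [measurable]: "Z \<in> borel_measurable M" using int by auto
  have A [measurable]: "A \<in> events" unfolding A_def by measurable
  have pw: "Z x \<le> \<mu> / 2 + (Z x)\<^sup>2 / (4 * K * \<mu>) + K * \<mu> * indicator A x" if "x \<in> space M" for x
  proof (cases "x \<in> A")
    case True
    have "0 \<le> (Z x - 2 * K * \<mu>)\<^sup>2 / (4 * K * \<mu>)" using K mu by simp
    also have "\<dots> = (Z x)\<^sup>2 / (4 * K * \<mu>) - Z x + K * \<mu>"
      using K mu by (simp add: power2_eq_square field_simps)
    finally show ?thesis using True mu(1) by simp
  next
    case False
    then have "Z x \<le> \<mu> / 2" using that by (auto simp: A_def)
    moreover have "0 \<le> (Z x)\<^sup>2 / (4 * K * \<mu>)" using K mu by simp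
    ultimately show ?thesis using False by simp
  qed
  have "\<mu> \<le> expectation (\<lambda>x. \<mu> / 2 + (Z x)\<^sup>2 / (4 * K * \<mu>) + K * \<mu> * indicator A x)"
    using int integrable_indicator_event[OF A]
    by (intro order_trans[OF mu(2)] integral_mono pw) auto
  also have "\<dots> = \<mu> / 2 + expectation (\<lambda>x. (Z x)\<^sup>2) / (4 * K * \<mu>) + K * \<mu> * prob A"
    using int A integrable_indicator_event[OF A] by (simp add: prob_space)
  also have "expectation (\<lambda>x. (Z x)\<^sup>2) / (4 * K * \<mu>) \<le> K * \<mu>\<^sup>2 / (4 * K * \<mu>)"
    using K mu by (intro divide_right_mono) auto
  also have "K * \<mu>\<^sup>2 / (4 * K * \<mu>) = \<mu> / 4"
    using K mu by (simp add: power2_eq_square)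
  finally have "\<mu> * (1 / 4) \<le> \<mu> * (K * prob A)" by (simp add: algebra_simps)
  then have "1 / 4 \<le> K * prob A" using mu(1) by (simp only: mult_le_cancel_left_pos)
  then show ?thesis using K unfolding A_def by (simp add: field_simps)
qed

text \<open>(2 k)! / k! is a product of k factors, each at most 2 k.\<close>

lemma std_normal_even_moment_le: "fact (2 * k) / (2 ^ k * fact k) \<le> real k ^ k"
proof -
  have "fact (2 * k) div fact (2 * k - k) \<le> (2 * k) ^ k"
    by (rule fact_div_fact_le_pow) simp
  then have "real (fact (2 * k) div fact k) \<le> real ((2 * k) ^ k)"
    by (simp only: of_nat_le_iff) simp
  moreover have "real (fact (2 * k) div fact k) = fact (2 * k) / fact k"
    by (subst real_of_nat_div) (auto intro: fact_dvd)
  ultimately have "fact (2 * k) / fact k \<le> 2 ^ k * real k ^ k"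
    by (simp add: power_mult_distrib)
  then show ?thesis by (simp add: field_simps)
qed

text \<open>\<open>w\<close> bounds the mean from below and \<open>B\<close> measures the growth E
  W^k \<le> (B k w)^k. Only k = 2 is assumed here; in the application this growth is available for a
  limited range of k, so higher orders are hypotheses of the individual lemmas.\<close>

locale gaussian_scale_mixture_moments = gaussian_scale_mixture +
  fixes w B :: real
  assumes all_moments_W: "all_moments M W"
    and w_pos: "0 < w" and B_ge_1: "1 \<le> B"
    and mean_ge: "w \<le> expectation W" and second_moment_le: "expectation (\<lambda>x. (W x)\<^sup>2) \<le> (B * 2 * w)\<^sup>2"
begin

lemma all_moments_sqrt_W: "all_moments M (\<lambda>x. sqrt (W x))"
  unfolding all_moments_def
proof (intro conjI allI)
  fix k :: nat
  show "integrable M (\<lambda>x. \<bar>sqrt (W x)\<bar> ^ k)"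
  proof (rule Bochner_Integration.integrable_bound)
    show "integrable M (\<lambda>x. 1 + \<bar>W x\<bar> ^ k)"
      using all_moments_W by (simp add: all_moments_def)
    show "AE x in M. norm (\<bar>sqrt (W x)\<bar> ^ k) \<le> norm (1 + \<bar>W x\<bar> ^ k)"
    proof (rule AE_I2)
      fix x
      have "sqrt (W x) \<le> max 1 (W x)"
        using W_nonneg[of x] real_le_lsqrt[of "W x" "W x"]
        by (cases "W x \<le> 1") (auto simp: power2_eq_square le_max_iff_disj)
      then have "sqrt (W x) ^ k \<le> max 1 (W x) ^ k"
        using W_nonneg[of x] by (intro power_mono) auto
      also have "\<dots> \<le> 1 + W x ^ k" using W_nonneg[of x] by (auto simp: max_def)
      finally show "norm (\<bar>sqrt (W x)\<bar> ^ k) \<le> norm (1 + \<bar>W x\<bar> ^ k)"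
        using W_nonneg[of x] by simp
    qed
  qed simp
qed simp

sublocale N: prob_space std_normal_distribution
  by (rule prob_space_std_normal)

sublocale MN: pair_prob_space M std_normal_distribution ..

lemma all_moments_product: "all_moments (M \<Otimes>\<^sub>M std_normal_distribution) (\<lambda>w. sqrt (W (fst w)) * snd w)"
  by (intro MN.all_moments_mult all_moments_fst[OF all_moments_sqrt_W] all_moments_snd
      all_moments_std_normal prob_space_std_normal prob_space_axioms)

sublocale law: prob_space law
  unfolding law_def by (rule MN.prob_space_distr) (simp add: split_beta')

lemma space_law [simp]: "space law = UNIV" and sets_law [simp, measurable_cong]: "sets law = sets borel"
  by (simp_all add: law_def)

lemma all_moments_law: "all_moments law (\<lambda>t. t)"
  unfolding law_def by (subst all_moments_distr) (use all_moments_product in \<open>auto simp: split_beta'\<close>)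

lemma integral_law_power:
  "(\<integral>t. t ^ k \<partial>law) = expectation (\<lambda>x. sqrt (W x) ^ k) * (\<integral>z. z ^ k \<partial>std_normal_distribution)"
proof -
  have "(\<integral>t. t ^ k \<partial>law) = (\<integral>w. (sqrt (W (fst w)) * snd w) ^ k \<partial>(M \<Otimes>\<^sub>M std_normal_distribution))"
    unfolding law_def by (subst integral_distr) (auto simp: split_beta')
  also have "\<dots> = (\<integral>x. (\<integral>z. (sqrt (W x) * z) ^ k \<partial>std_normal_distribution) \<partial>M)"
    using MN.integral_fst'[OF all_moments_integrable[OF MN.all_moments_power[OF all_moments_product, of k]]]
    by simp
  finally show ?thesis by (simp add: power_mult_distrib)
qed

lemma integral_law_odd: "odd k \<Longrightarrow> (\<integral>t. t ^ k \<partial>law) = 0"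
  by (simp add: integral_law_power integral_std_normal_distribution_moment_odd)

lemma integral_law_even:
  "(\<integral>t. t ^ (2 * k) \<partial>law) = expectation (\<lambda>x. W x ^ k) * (fact (2 * k) / (2 ^ k * fact k))"
proof -
  have "expectation (\<lambda>x. sqrt (W x) ^ (2 * k)) = expectation (\<lambda>x. W x ^ k)"
    using W_nonneg by (simp add: power_mult)
  then show ?thesis
    unfolding integral_law_power std_normal_distribution_even_moments by simp
qed

lemma expectation_power_nonneg: "0 \<le> expectation (\<lambda>x. W x ^ k)"
  using W_nonneg by (intro Bochner_Integration.integral_nonneg) simp

lemma integral_law_even_le:
  assumes "expectation (\<lambda>x. W x ^ k) \<le> (B * real k * w) ^ k"
  shows "(\<integral>t. t ^ (2 * k) \<partial>law) \<le> (B * (real k)\<^sup>2 * w) ^ k"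
proof -
  have "(\<integral>t. t ^ (2 * k) \<partial>law) \<le> (B * real k * w) ^ k * real k ^ k"
    unfolding integral_law_even using w_pos B_ge_1
    by (intro mult_mono assms std_normal_even_moment_le expectation_power_nonneg) auto
  also have "\<dots> = (B * (real k)\<^sup>2 * w) ^ k"
    by (simp add: power_mult_distrib[symmetric] power2_eq_square mult_ac)
  finally show ?thesis .
qed

lemma integrable_law_power: "integrable law (\<lambda>t. t ^ k)"
  by (intro all_moments_integrable law.all_moments_power all_moments_law)

text \<open>Markov's inequality at order 2 k: the threshold is e times the bound on the L^(2k) norm,
  so the tail is at most exp (- 2 k).\<close>

lemma quantile_set_upper:
  assumes k: "1 \<le> k" "D \<le> 2 * real k" and m: "expectation (\<lambda>x. W x ^ k) \<le> (B * real k * w) ^ k"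
  shows "1 - exp (- D) \<le> measure law {t. \<bar>t\<bar> \<le> exp 1 * sqrt B * real k * sqrt w}"
proof -
  define y where "y = exp 1 * sqrt B * real k * sqrt w"
  have y: "0 < y" using k w_pos B_ge_1 by (simp add: y_def)
  have "y\<^sup>2 = exp 2 * (B * (real k)\<^sup>2 * w)"
    using w_pos B_ge_1 by (simp add: y_def power_mult_distrib exp_of_nat_mult[symmetric])
  then have "y ^ (2 * k) = (exp 2 * (B * (real k)\<^sup>2 * w)) ^ k"
    by (simp only: power_mult)
  then have y2: "y ^ (2 * k) = exp (2 * real k) * (B * (real k)\<^sup>2 * w) ^ k"
    by (simp only: power_mult_distrib[of "exp 2"] exp_of_nat_mult[symmetric] mult.commute[of 2])
  have "measure law {t \<in> space law. y ^ (2 * k) \<le> t ^ (2 * k)} \<le> (\<integral>t. t ^ (2 * k) \<partial>law) / y ^ (2 * k)"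
    using y by (intro integral_Markov_inequality_measure[where A = "{}"] integrable_law_power AE_I2) auto
  also have "\<dots> \<le> (B * (real k)\<^sup>2 * w) ^ k / y ^ (2 * k)"
    using y by (intro divide_right_mono integral_law_even_le m) auto
  also have "\<dots> = exp (- (2 * real k))"
    using k w_pos B_ge_1 unfolding y2 by (simp add: exp_minus field_simps)
  also have "\<dots> \<le> exp (- D)" using k by simp
  finally have "law.prob {t. y ^ (2 * k) \<le> t ^ (2 * k)} \<le> exp (- D)" by simp
  moreover have "law.prob (space law - {t. \<bar>t\<bar> \<le> y}) \<le> law.prob {t. y ^ (2 * k) \<le> t ^ (2 * k)}"
  proof (rule law.finite_measure_mono)
    show "space law - {t. \<bar>t\<bar> \<le> y} \<subseteq> {t. y ^ (2 * k) \<le> t ^ (2 * k)}"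
    proof
      fix t assume "t \<in> space law - {t. \<bar>t\<bar> \<le> y}"
      then have "y ^ (2 * k) \<le> \<bar>t\<bar> ^ (2 * k)" using y by (intro power_mono) auto
      then show "t \<in> {t. y ^ (2 * k) \<le> t ^ (2 * k)}" by (simp add: power_even_abs)
    qed
  qed simp
  moreover have "law.prob (space law - {t. \<bar>t\<bar> \<le> y}) = 1 - law.prob {t. \<bar>t\<bar> \<le> y}"
    by (rule law.prob_compl) simp
  ultimately show ?thesis unfolding y_def by linarith
qed

text \<open>The second moment method for t^2 gives t^2 \<ge> w / 2 a fixed probability, so a shorter
  interval misses more than exp (- D). The 48 is 4 * 12, as E t^4 = 3 E W^2 \<le> 12 B^2
  w^2.\<close>

lemma quantile_set_lower:
  assumes D: "exp (- D) < 1 / (48 * B\<^sup>2)" and y: "1 - exp (- D) \<le> measure law {t. \<bar>t\<bar> \<le> y}"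
  shows "sqrt (w / 2) \<le> y"
proof (rule ccontr)
  assume "\<not> sqrt (w / 2) \<le> y"
  then have y': "y < sqrt (w / 2)" by simp
  have sub: "{t. \<bar>t\<bar> \<le> y} \<subseteq> space law - {t. w / 2 \<le> t\<^sup>2}"
  proof
    fix t assume "t \<in> {t. \<bar>t\<bar> \<le> y}"
    then have "\<bar>t\<bar> < sqrt (w / 2)" using y' by simp
    then have "\<not> sqrt (w / 2) \<le> sqrt (t\<^sup>2)" by simp
    then show "t \<in> space law - {t. w / 2 \<le> t\<^sup>2}"
      using real_sqrt_le_mono[of "w / 2" "t\<^sup>2"] by auto
  qed
  have mom: "(\<integral>t. t\<^sup>2 \<partial>law) = expectation W" "(\<integral>t. (t\<^sup>2)\<^sup>2 \<partial>law) = 3 * expectation (\<lambda>x. (W x)\<^sup>2)"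
    using integral_law_even[of 1] integral_law_even[of 2]
    by (simp_all add: power_mult[symmetric] fact_numeral)
  have "1 / (4 * (12 * B\<^sup>2)) \<le> law.prob {t \<in> space law. w / 2 \<le> t\<^sup>2}"
  proof (rule law.paley_zygmund)
    show "integrable law (\<lambda>t. t\<^sup>2)" "integrable law (\<lambda>t. (t\<^sup>2)\<^sup>2)"
      using integrable_law_power[of 2] integrable_law_power[of 4] by (simp_all add: power_mult[symmetric])
    show "(\<integral>t. (t\<^sup>2)\<^sup>2 \<partial>law) \<le> 12 * B\<^sup>2 * w\<^sup>2"
      unfolding mom using second_moment_le by (simp add: power_mult_distrib)
    show "w \<le> (\<integral>t. t\<^sup>2 \<partial>law)" unfolding mom by (rule mean_ge)
  qed (use w_pos B_ge_1 in auto)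
  moreover have "law.prob {t. \<bar>t\<bar> \<le> y} \<le> law.prob (space law - {t. w / 2 \<le> t\<^sup>2})"
    by (rule law.finite_measure_mono[OF sub]) simp
  moreover have "law.prob (space law - {t. w / 2 \<le> t\<^sup>2}) = 1 - law.prob {t. w / 2 \<le> t\<^sup>2}"
    by (rule law.prob_compl) simp
  ultimately show False using D y by simp
qed

lemma overlap_quantile_law_bounds:
  assumes k: "1 \<le> k" "D \<le> 2 * real k" and m: "expectation (\<lambda>x. W x ^ k) \<le> (B * real k * w) ^ k"
    and D: "exp (- D) < 1 / (48 * B\<^sup>2)"
  shows "sqrt (w / 2) \<le> overlap_quantile law D"
    and "overlap_quantile law D \<le> exp 1 * sqrt B * real k * sqrt w"
proof -
  let ?S = "{y. 1 - exp (- D) \<le> measure law {t. \<bar>t\<bar> \<le> y}}"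
  have mem: "exp 1 * sqrt B * real k * sqrt w \<in> ?S"
    using quantile_set_upper[OF k m] by simp
  show "sqrt (w / 2) \<le> overlap_quantile law D"
    unfolding overlap_quantile_def using mem quantile_set_lower[OF D]
    by (intro cInf_greatest) auto
  show "overlap_quantile law D \<le> exp 1 * sqrt B * real k * sqrt w"
    unfolding overlap_quantile_def using mem quantile_set_lower[OF D]
    by (intro cInf_lower bdd_belowI[of _ "sqrt (w / 2)"]) auto
qed

text \<open>A bound on E W^2 / w^2.\<close>

definition kurt :: real where "kurt = 4 * B\<^sup>2"

lemma kurt_ge: "4 \<le> kurt" using B_ge_1 by (simp add: kurt_def)

lemma integrable_W_power: "integrable M (\<lambda>x. W x ^ k)"
  by (intro all_moments_integrable all_moments_power all_moments_W)

text \<open>The second moment method gives W \<ge> w / 2 probability 1 / (4 kurt); Markov's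
  inequality for W^2 at level 8 kurt w removes only 1 / (64 kurt) of it.\<close>

lemma prob_W_typical: "1 / (8 * kurt) \<le> prob {x\<in>space M. w / 2 \<le> W x \<and> W x < 8 * kurt * w}"
proof -
  have sq: "expectation (\<lambda>x. (W x)\<^sup>2) \<le> kurt * w\<^sup>2"
    using second_moment_le by (simp add: kurt_def power_mult_distrib)
  have "1 / (4 * kurt) \<le> prob {x\<in>space M. w / 2 \<le> W x}"
    using W_nonneg w_pos kurt_ge mean_ge sq integrable_W_power[of 1] integrable_W_power[of 2]
    by (intro paley_zygmund) auto
  also have "\<dots> \<le> prob ({x\<in>space M. w / 2 \<le> W x \<and> W x < 8 * kurt * w} \<union> {x\<in>space M. (8 * kurt * w)\<^sup>2 \<le> (W x)\<^sup>2})"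
    using W_nonneg w_pos kurt_ge by (intro finite_measure_mono) (auto intro: power_mono)
  also have "\<dots> \<le> prob {x\<in>space M. w / 2 \<le> W x \<and> W x < 8 * kurt * w} + prob {x\<in>space M. (8 * kurt * w)\<^sup>2 \<le> (W x)\<^sup>2}"
    by (intro measure_Un_le) measurable
  also have "prob {x\<in>space M. (8 * kurt * w)\<^sup>2 \<le> (W x)\<^sup>2} \<le> expectation (\<lambda>x. (W x)\<^sup>2) / (8 * kurt * w)\<^sup>2"
    using w_pos kurt_ge
    by (intro integral_Markov_inequality_measure[where A = "{}"] integrable_W_power AE_I2) auto
  also have "\<dots> \<le> kurt * w\<^sup>2 / (8 * kurt * w)\<^sup>2"
    using w_pos kurt_ge by (intro divide_right_mono sq) auto
  also have "\<dots> = 1 / (64 * kurt)"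
    using w_pos kurt_ge by (simp add: power2_eq_square)
  finally have "1 / (4 * kurt) - 1 / (64 * kurt) \<le> prob {x\<in>space M. w / 2 \<le> W x \<and> W x < 8 * kurt * w}" by simp
  moreover have "1 / (8 * kurt) \<le> 1 / (4 * kurt) - 1 / (64 * kurt)"
    using kurt_ge by (simp add: field_simps)
  ultimately show ?thesis by linarith
qed

lemma mix_density_ge:
  assumes t: "t \<noteq> 0" and c: "0 \<le> c"
    and typical: "\<And>v. w / 2 \<le> v \<Longrightarrow> v < 8 * kurt * w \<Longrightarrow> c \<le> gauss_kernel v t"
  shows "c / (8 * kurt) \<le> mix_density t"
proof -
  define A where "A = {x\<in>space M. w / 2 \<le> W x \<and> W x < 8 * kurt * w}"
  have A: "A \<in> events" unfolding A_def by measurable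
  have "c / (8 * kurt) \<le> c * prob A"
    using mult_left_mono[OF prob_W_typical c] by (simp add: A_def)
  also have "\<dots> = expectation (\<lambda>x. c * indicator A x)" using A by simp
  also have "\<dots> \<le> mix_density t"
    unfolding mix_density_def
  proof (rule integral_mono)
    show "integrable M (\<lambda>x. c * indicator A x)"
      by (intro integrable_mult_right integrable_indicator_event A)
    show "c * indicator A x \<le> gauss_kernel (W x) t" for x
      by (auto simp: indicator_def A_def intro: typical)
  qed (rule integrable_gauss_kernel[OF t])
  finally show ?thesis .
qed

text \<open>The worst cases over typical variances: w / 2 in the exponent and 8 kurt w in the
  prefactor.\<close>

lemma mix_density_ge_exp:
  assumes t: "t \<noteq> 0"
  shows "exp (- t\<^sup>2 / w) / sqrt (2 * pi * (8 * kurt * w)) / (8 * kurt) \<le> mix_density t"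
proof (rule mix_density_ge[OF t])
  fix v assume v: "w / 2 \<le> v" "v < 8 * kurt * w"
  then have "0 < v" using w_pos by linarith
  moreover have "t\<^sup>2 / (2 * v) \<le> t\<^sup>2 / w"
    using v w_pos by (intro divide_left_mono) auto
  moreover have "sqrt (2 * pi * v) \<le> sqrt (2 * pi * (8 * kurt * w))"
    using v by (intro real_sqrt_le_mono mult_left_mono) auto
  ultimately show "exp (- t\<^sup>2 / w) / sqrt (2 * pi * (8 * kurt * w)) \<le> gauss_kernel v t"
    unfolding gauss_kernel_def by (simp del: real_sqrt_le_iff) (intro frac_le, auto)
qed (use w_pos kurt_ge in simp)

lemma mix_density_pos: "t \<noteq> 0 \<Longrightarrow> 0 < mix_density t"
  using w_pos kurt_ge by (intro less_le_trans[OF _ mix_density_ge_exp]) auto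

text \<open>As a function of v, v^(-3/2) exp (- t^2 / (2 v)) increases as long as 3 v \<le> t^2.
  With r = v / u this comes down to ln r \<le> r - 1.\<close>

lemma gauss_kernel_divide_mono:
  assumes u: "0 < u" "u \<le> v" and t: "3 * v \<le> t\<^sup>2"
  shows "gauss_kernel u t / u \<le> gauss_kernel v t / v"
proof -
  define r where "r = v / u"
  have r: "1 \<le> r" "v = r * u" using u by (auto simp: r_def)
  have v: "0 < v" using u by simp
  have "ln r \<le> r - 1" using r by (intro ln_le_minus_one) simp
  then have "3 / 2 * ln r \<le> 3 / 2 * (r - 1)" by simp
  also have "\<dots> \<le> (t\<^sup>2 / (2 * v)) * (r - 1)"
    using t v r by (intro mult_right_mono) (auto simp: field_simps)
  also have "\<dots> = t\<^sup>2 / (2 * u) - t\<^sup>2 / (2 * v)"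
    using u v r by (simp add: field_simps)
  finally have "exp (3 / 2 * ln r) \<le> exp (t\<^sup>2 / (2 * u) - t\<^sup>2 / (2 * v))" by simp
  moreover have "exp (3 / 2 * ln r) = r * sqrt r"
  proof -
    have "r * sqrt r = r powr 1 * r powr (1 / 2)" using r by (simp add: powr_half_sqrt)
    also have "\<dots> = r powr (3 / 2)" by (simp only: powr_add[symmetric]) simp
    finally show ?thesis using r by (simp add: powr_def)
  qed
  ultimately have "r * sqrt r * exp (t\<^sup>2 / (2 * v)) \<le> exp (t\<^sup>2 / (2 * u))"
    by (simp add: exp_diff pos_le_divide_eq)
  then have "(r * sqrt r * exp (t\<^sup>2 / (2 * v))) * (u * sqrt u) \<le> exp (t\<^sup>2 / (2 * u)) * (u * sqrt u)"
    using u by (intro mult_right_mono) auto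
  then have "v * (sqrt v * exp (t\<^sup>2 / (2 * v))) \<le> u * (sqrt u * exp (t\<^sup>2 / (2 * u)))"
    by (simp add: r real_sqrt_mult mult_ac)
  then have "sqrt (2 * pi) * (v * (sqrt v * exp (t\<^sup>2 / (2 * v)))) \<le> sqrt (2 * pi) * (u * (sqrt u * exp (t\<^sup>2 / (2 * u))))"
    by (intro mult_left_mono) auto
  then have "1 / (sqrt (2 * pi) * (u * (sqrt u * exp (t\<^sup>2 / (2 * u))))) \<le> 1 / (sqrt (2 * pi) * (v * (sqrt v * exp (t\<^sup>2 / (2 * v)))))"
    using u v by (intro divide_left_mono) (auto intro!: mult_pos_pos)
  then show ?thesis using u v by (simp add: gauss_kernel_eq mult_ac)
qed

text \<open>
  The cut at \<open>w / 6\<close> is the largest one allowed by \<open>w / 2 \<le> t\<^sup>2\<close> below which \<open>\<phi>\<^sub>v(t) / v\<close> is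
  increasing in \<open>v\<close>.
\<close>

lemma mix_slope_le:
  assumes t: "w / 2 \<le> t\<^sup>2"
  shows "mix_slope t \<le> 6 / w * (1 + 8 * kurt * sqrt (48 * kurt)) * mix_density t"
proof -
  have t0: "t \<noteq> 0" using t w_pos by auto
  define v where "v = w / 6"
  have v: "0 < v" using w_pos by (simp add: v_def)
  \<comment> \<open>Above the cut, 1 / u \<le> 1 / v. Below it, monotonicity replaces u by v, at the
    price of a deterministic term.\<close>
  have pw: "gauss_kernel u t / u \<le> gauss_kernel u t / v + gauss_kernel v t / v" if "0 \<le> u" for u
  proof (cases "v \<le> u")
    case True
    then have "gauss_kernel u t / u \<le> gauss_kernel u t / v" using v by (intro divide_left_mono) auto
    moreover have "0 \<le> gauss_kernel v t / v" using v by simp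
    ultimately show ?thesis by linarith
  next
    case False
    have "gauss_kernel u t / u \<le> gauss_kernel v t / v"
    proof (cases "u = 0")
      case True
      then show ?thesis using v by simp
    next
      case nz: False
      show ?thesis using t that nz False by (intro gauss_kernel_divide_mono) (auto simp: v_def)
    qed
    moreover have "0 \<le> gauss_kernel u t / v" using v by simp
    ultimately show ?thesis by linarith
  qed
  have "mix_slope t \<le> expectation (\<lambda>x. gauss_kernel (W x) t / v + gauss_kernel v t / v)"
    unfolding mix_slope_def using W_nonneg integrable_gauss_kernel[OF t0]
    by (intro integral_mono integrable_gauss_kernel_divide t0 pw) auto
  also have "\<dots> = mix_density t / v + gauss_kernel v t / v"
    using integrable_gauss_kernel[OF t0] by (simp add: mix_density_def prob_space)
  also have "gauss_kernel v t \<le> 8 * kurt * sqrt (48 * kurt) * mix_density t"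
  proof -
    \<comment> \<open>A typical variance u is below 8 kurt w = 48 kurt v, so the prefactor at u is
      smaller by at most sqrt (48 kurt), while the exponential at u is at least that at v.\<close>
    have "gauss_kernel v t / sqrt (48 * kurt) / (8 * kurt) \<le> mix_density t"
    proof (rule mix_density_ge[OF t0])
      fix u assume u: "w / 2 \<le> u" "u < 8 * kurt * w"
      then have u0: "0 < u" using w_pos by linarith
      have "v \<le> u" using u w_pos by (simp add: v_def)
      then have e: "exp (- t\<^sup>2 / (2 * v)) \<le> exp (- t\<^sup>2 / (2 * u))"
        using v u0 by (simp add: divide_left_mono)
      have "gauss_kernel v t / sqrt (48 * kurt) = exp (- t\<^sup>2 / (2 * v)) / sqrt (2 * pi * (48 * kurt * v))"
        using v by (simp add: gauss_kernel_def real_sqrt_mult[symmetric] mult_ac)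
      also have "\<dots> \<le> exp (- t\<^sup>2 / (2 * u)) / sqrt (2 * pi * u)"
      proof (rule frac_le[OF _ e])
        have "u \<le> 48 * kurt * v" using less_imp_le[OF u(2)] by (simp add: v_def mult_ac)
        then show "sqrt (2 * pi * u) \<le> sqrt (2 * pi * (48 * kurt * v))"
          by (intro real_sqrt_le_mono mult_left_mono) auto
      qed (use u0 in auto)
      also have "\<dots> = gauss_kernel u t" using u0 by (simp add: gauss_kernel_def)
      finally show "gauss_kernel v t / sqrt (48 * kurt) \<le> gauss_kernel u t" .
    qed (use kurt_ge in simp)
    then show ?thesis using kurt_ge by (simp add: field_simps)
  qed
  then have "mix_density t / v + gauss_kernel v t / v \<le> mix_density t / v + 8 * kurt * sqrt (48 * kurt) * mix_density t / v"
    using v by (intro add_left_mono divide_right_mono) auto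
  finally show ?thesis by (simp add: v_def algebra_simps)
qed

text \<open>Where W \<le> w1 the kernel is at most w1 times kernel / W. The complementary event has
  probability at most exp (- m), since w1 is e times the bound on the L^m norm, and
  \<open>small\<close> makes its contribution at most half of the lower bound in
  \<open>mix_density_ge_exp\<close>. That half is absorbed on the left, whence the factor 2.\<close>

lemma mix_density_le_slope:
  assumes t: "t \<noteq> 0" and m: "1 \<le> m" "expectation (\<lambda>x. W x ^ m) \<le> (B * real m * w) ^ m"
    and small: "exp (- real m) * (16 * kurt * sqrt (8 * kurt)) \<le> exp (- t\<^sup>2 / w)"
  shows "mix_density t \<le> 2 * (exp 1 * B * real m * w) * mix_slope t"
proof -
  define w1 where "w1 = exp 1 * B * real m * w"
  have "1 * 1 * 1 * w \<le> w1"
    unfolding w1_def using B_ge_1 m w_pos by (intro mult_mono) auto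
  then have w1: "0 < w1" "w \<le> w1" using w_pos by auto
  define A where "A = {x\<in>space M. w1 ^ m \<le> W x ^ m}"
  have A [measurable]: "A \<in> events" unfolding A_def by measurable
  have "prob A \<le> expectation (\<lambda>x. W x ^ m) / w1 ^ m"
    unfolding A_def using w1 W_nonneg
    by (intro integral_Markov_inequality_measure[where A = "{}"] integrable_W_power AE_I2) auto
  also have "\<dots> \<le> (B * real m * w) ^ m / w1 ^ m"
    using w1 by (intro divide_right_mono m) auto
  also have "\<dots> = exp (- real m)"
    using B_ge_1 m w_pos by (simp add: w1_def power_mult_distrib exp_minus exp_of_nat_mult[symmetric] field_simps)
  finally have PA: "prob A \<le> exp (- real m)" .
  have pw: "gauss_kernel (W x) t \<le> w1 * (gauss_kernel (W x) t / W x) + indicator A x / sqrt (2 * pi * w)"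
    if x: "x \<in> space M" for x
  proof (cases "x \<in> A")
    case True
    then have "w1 \<le> W x" using x W_nonneg[of x] m w1 by (auto simp: A_def intro: power_le_imp_le_base[of _ "m - 1"])
    then have "gauss_kernel (W x) t \<le> 1 / sqrt (2 * pi * w)"
      unfolding gauss_kernel_def using w1 w_pos by (auto intro!: frac_le)
    moreover have "0 \<le> w1 * (gauss_kernel (W x) t / W x)"
      using w1 W_nonneg[of x] by simp
    ultimately show ?thesis using True by simp
  next
    case False
    then have "W x \<le> w1" using x w1 W_nonneg[of x] by (auto simp: A_def not_le intro: power_mono power_less_imp_less_base less_imp_le)
    then have "gauss_kernel (W x) t \<le> w1 * (gauss_kernel (W x) t / W x)"
    proof (cases "W x = 0")
      case nz: False
      then have "gauss_kernel (W x) t * 1 \<le> gauss_kernel (W x) t * (w1 / W x)"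
        using \<open>W x \<le> w1\<close> W_nonneg[of x] by (intro mult_left_mono) (auto simp: field_simps)
      then show ?thesis by (simp add: mult_ac)
    qed (simp add: gauss_kernel_def)
    then show ?thesis using False by simp
  qed
  have "mix_density t \<le> expectation (\<lambda>x. w1 * (gauss_kernel (W x) t / W x) + indicator A x / sqrt (2 * pi * w))"
    unfolding mix_density_def using integrable_gauss_kernel_divide[OF t]
    by (intro integral_mono integrable_gauss_kernel t pw Bochner_Integration.integrable_add integrable_mult_right)
      (auto intro!: integrable_divide_zero integrable_indicator_event A)
  also have "\<dots> = w1 * mix_slope t + prob A / sqrt (2 * pi * w)"
  proof (subst Bochner_Integration.integral_add)
    show "integrable M (\<lambda>x. w1 * (gauss_kernel (W x) t / W x))"
      by (intro integrable_mult_right integrable_gauss_kernel_divide t)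
    show "integrable M (\<lambda>x. indicator A x / sqrt (2 * pi * w))"
      by (intro integrable_divide_zero integrable_indicator_event A)
  qed (simp only: integral_mult_right_zero mix_slope_def, simp)
  also have "prob A / sqrt (2 * pi * w) \<le> mix_density t / 2"
  proof -
    have k: "0 < kurt" using kurt_ge by simp
    have "prob A / sqrt (2 * pi * w) \<le> exp (- real m) / sqrt (2 * pi * w)"
      using PA w_pos by (intro divide_right_mono) auto
    also have "\<dots> = exp (- real m) * (16 * kurt * sqrt (8 * kurt)) / (16 * kurt * sqrt (8 * kurt) * sqrt (2 * pi * w))"
      using k by simp
    also have "\<dots> \<le> exp (- t\<^sup>2 / w) / (16 * kurt * sqrt (8 * kurt) * sqrt (2 * pi * w))"
      using small k w_pos by (intro divide_right_mono) auto
    also have "\<dots> = exp (- t\<^sup>2 / w) / sqrt (2 * pi * (8 * kurt * w)) / (8 * kurt) / 2"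
    proof -
      have "sqrt (2 * pi * (8 * kurt * w)) = sqrt (8 * kurt) * sqrt (2 * pi * w)"
        by (simp only: real_sqrt_mult[symmetric] mult_ac)
      then show ?thesis using k w_pos by simp
    qed
    also have "\<dots> \<le> mix_density t / 2"
      by (intro divide_right_mono mix_density_ge_exp t) simp
    finally show ?thesis .
  qed
  finally show ?thesis by (simp add: w1_def)
qed

end

section \<open>The overlap as a Gaussian scale mixture\<close>

context sparse_clustering
begin

definition base2 :: "(((nat \<Rightarrow> real) \<times> (nat \<Rightarrow> bool \<times> real)) \<times> ((nat \<Rightarrow> real) \<times> (nat \<Rightarrow> bool \<times> real))) measure" where
  "base2 = base \<Otimes>\<^sub>M base"

sublocale base2: pair_prob_space base base
  by (intro pair_prob_space.intro pair_sigma_finite.intro prob_space_imp_sigma_finite prob_space_base)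

lemma prob_space_base2: "prob_space base2"
  unfolding base2_def by (rule base2.prob_space_axioms)

definition label_overlap :: "(nat \<Rightarrow> real) \<Rightarrow> (nat \<Rightarrow> real) \<Rightarrow> real" where
  "label_overlap \<xi> \<xi>' = (\<Sum>i<n. \<xi> i * \<xi>' i)"

text \<open>The asymmetry reflects the conditioning: the Gaussian values of the first replica are
  integrated out, so it enters through its support alone, and the second one through its
  entries.\<close>

definition slab_var :: "(nat \<Rightarrow> bool \<times> real) \<Rightarrow> (nat \<Rightarrow> bool \<times> real) \<Rightarrow> real" where
  "slab_var bg bg' = (\<Sum>j<p. of_bool (fst (bg j)) * (entry (bg' j))\<^sup>2)"

definition W :: "((nat \<Rightarrow> real) \<times> (nat \<Rightarrow> bool \<times> real)) \<times> ((nat \<Rightarrow> real) \<times> (nat \<Rightarrow> bool \<times> real)) \<Rightarrow> real" where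
  "W w = (label_overlap (fst (fst w)) (fst (snd w)))\<^sup>2 * slab_var (snd (fst w)) (snd (snd w))"

lemma slab_var_nonneg: "0 \<le> slab_var bg bg'"
  unfolding slab_var_def by (intro sum_nonneg) auto

lemma W_nonneg: "0 \<le> W w"
  unfolding W_def by (intro mult_nonneg_nonneg slab_var_nonneg) simp

lemma all_moments_active: "all_moments slab (\<lambda>u. of_bool (fst u))"
  unfolding slab_def by (intro all_moments_fst[OF all_moments_bernoulli prob_space_std_normal])

lemma all_moments_active_comp: "j < p \<Longrightarrow> all_moments slabs (\<lambda>bg. of_bool (fst (bg j)))"
  unfolding slabs_def
  by (rule all_moments_PiM_component[OF slab.prob_space_axioms _ all_moments_active]) simp

sublocale labels2: pair_prob_space labels labels ..

sublocale slabs2: pair_prob_space slabs slabs ..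

lemma all_moments_label_overlap: "all_moments (labels \<Otimes>\<^sub>M labels) (\<lambda>w. label_overlap (fst w) (snd w))"
  unfolding label_overlap_def
  by (intro labels2.all_moments_sum labels2.all_moments_mult all_moments_fst all_moments_snd all_moments_label
     labels.prob_space_axioms) auto

lemma all_moments_slab_var: "all_moments (slabs \<Otimes>\<^sub>M slabs) (\<lambda>w. slab_var (fst w) (snd w))"
  unfolding slab_var_def
  by (intro slabs2.all_moments_sum slabs2.all_moments_mult slabs2.all_moments_power all_moments_fst
     all_moments_snd[OF all_moments_entry_comp]
     all_moments_active_comp slabs.prob_space_axioms) auto

lemma all_moments_base_label: "i < n \<Longrightarrow> all_moments base (\<lambda>w. fst w i)"
  unfolding base_def by (intro all_moments_fst[OF all_moments_label] slabs.prob_space_axioms)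

lemma all_moments_base_entry: "j < p \<Longrightarrow> all_moments base (\<lambda>w. entry (snd w j))"
  unfolding base_def
  by (intro all_moments_snd[OF all_moments_entry_comp] labels.prob_space_axioms slabs.prob_space_axioms)

lemma all_moments_base_active: "j < p \<Longrightarrow> all_moments base (\<lambda>w. of_bool (fst (snd w j)))"
  unfolding base_def
  by (intro all_moments_snd[OF all_moments_active_comp] labels.prob_space_axioms slabs.prob_space_axioms)

lemma all_moments_W: "all_moments base2 W"
  unfolding W_def[abs_def] label_overlap_def slab_var_def base2_def
  by (intro base2.all_moments_mult base2.all_moments_power base2.all_moments_sum
      all_moments_fst[OF all_moments_base_label] all_moments_snd[OF all_moments_base_label]
      all_moments_fst[OF all_moments_base_active] all_moments_snd[OF all_moments_base_entry]
      prob_space_base) auto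

sublocale mix: gaussian_scale_mixture base2 W
  by (intro gaussian_scale_mixture.intro gaussian_scale_mixture_axioms.intro prob_space_base2
      all_moments_measurable all_moments_W W_nonneg)

definition slab_overlap :: "(nat \<Rightarrow> bool \<times> real) \<Rightarrow> (nat \<Rightarrow> bool \<times> real) \<Rightarrow> real" where
  "slab_overlap bg bg' = (\<Sum>j<p. entry (bg j) * entry (bg' j))"

text \<open>For rank-one matrices the double sum factors, which separates the labels from the
  columns.\<close>

lemma signal_overlap:
  "(\<Sum>ij\<in>I. signal w ij * signal w' ij) = label_overlap (fst w) (fst w') * slab_overlap (snd w) (snd w')"
proof -
  have "(\<Sum>ij\<in>I. signal w ij * signal w' ij) = (\<Sum>(i, j)\<in>I. (fst w i * fst w' i) * (entry (snd w j) * entry (snd w' j)))"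
    by (rule sum.cong) (auto simp: signal_apply)
  then show ?thesis
    by (simp add: sum.cartesian_product[symmetric] label_overlap_def slab_overlap_def sum_product)
qed

lemma overlap_law_prior:
  "overlap_law I prior = distr base2 borel
     (\<lambda>w. label_overlap (fst (fst w)) (fst (snd w)) * slab_overlap (snd (fst w)) (snd (snd w)))"
proof -
  let ?P = "PiM I (\<lambda>_. borel :: real measure)"
  have meas: "(\<lambda>w. \<Sum>ij\<in>I. fst w ij * snd w ij) \<in> borel_measurable (?P \<Otimes>\<^sub>M ?P)"
    by (intro borel_measurable_sum borel_measurable_times
      measurable_compose[OF measurable_fst measurable_component_singleton]
      measurable_compose[OF measurable_snd measurable_component_singleton])
  have "prior \<Otimes>\<^sub>M prior = distr base2 (?P \<Otimes>\<^sub>M ?P) (\<lambda>(w, w'). (signal w, signal w'))"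
    unfolding prior_eq base2_def
    by (rule pair_measure_distr[OF signal_measurable signal_measurable])
      (metis prior_eq prior.sigma_finite_measure_axioms)
  then have "overlap_law I prior = distr (distr base2 (?P \<Otimes>\<^sub>M ?P) (\<lambda>w. (signal (fst w), signal (snd w)))) borel
     (\<lambda>w. \<Sum>ij\<in>I. fst w ij * snd w ij)"
    by (simp add: overlap_law_def split_beta')
  also have "\<dots> = distr base2 borel (\<lambda>w. \<Sum>ij\<in>I. signal (fst w) ij * signal (snd w) ij)"
    unfolding base2_def
    by (subst distr_distr[OF meas measurable_Pair[OF measurable_compose[OF measurable_fst signal_measurable]
      measurable_compose[OF measurable_snd signal_measurable]]]) (simp add: comp_def)
  finally show ?thesis by (simp add: signal_overlap)
qed

lemma integrable_iexp: "prob_space M \<Longrightarrow> f \<in> borel_measurable M \<Longrightarrow> integrable M (\<lambda>x. iexp (f x))"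
  by (rule finite_measure.integrable_const_bound[where B = 1])
    (auto simp: prob_space.finite_measure)

lemma integrable_exp_neg:
  "prob_space M \<Longrightarrow> f \<in> borel_measurable M \<Longrightarrow> (\<And>x. 0 \<le> f x) \<Longrightarrow> integrable M (\<lambda>x. complex_of_real (exp (- f x)))"
  by (rule finite_measure.integrable_const_bound[where B = 1])
    (auto simp: prob_space.finite_measure)

text \<open>Given the support bit b, the entry is normal with variance b, because b^2 = b.\<close>

lemma slab_char:
  "(CLINT u|slab. iexp (a * entry u)) = (CLINT u|slab. complex_of_real (exp (- (a\<^sup>2 * of_bool (fst u) / 2))))"
proof -
  interpret N: prob_space std_normal_distribution by (rule prob_space_std_normal)
  interpret BN: pair_prob_space "measure_pmf (bernoulli_pmf dens)" std_normal_distribution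
    by (intro pair_prob_space.intro pair_sigma_finite.intro prob_space_imp_sigma_finite
      prob_space_measure_pmf prob_space_std_normal)
  have "integrable slab (\<lambda>u. iexp (a * entry u))"
    by (intro integrable_iexp slab.prob_space_axioms borel_measurable_times borel_measurable_const entry_measurable)
  from BN.integral_fst'[OF this[unfolded slab_def]]
  have "(CLINT u|slab. iexp (a * entry u)) =
     (CLINT b|measure_pmf (bernoulli_pmf dens). char std_normal_distribution (a * of_bool b))"
    unfolding slab_def by (simp add: entry_def char_def mult.assoc)
  also have "\<dots> = (CLINT b|measure_pmf (bernoulli_pmf dens). complex_of_real (exp (- (a\<^sup>2 * of_bool b / 2))))"
    unfolding char_std_normal_distribution
    by (intro Bochner_Integration.integral_cong refl) (auto simp: power_mult_distrib)
  also have "\<dots> = (CLINT u|slab. complex_of_real (exp (- (a\<^sup>2 * of_bool (fst u) / 2))))"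
  proof -
    have "integrable slab (\<lambda>u. complex_of_real (exp (- (a\<^sup>2 * of_bool (fst u) / 2))))"
      using all_moments_measurable[OF all_moments_active]
      by (intro integrable_exp_neg slab.prob_space_axioms) auto
    from BN.integral_fst'[OF this[unfolded slab_def]] show ?thesis
      unfolding slab_def using N.prob_space by simp
  qed
  finally show ?thesis .
qed

lemma slabs_char:
  "(CLINT bg|slabs. iexp (\<Sum>j<p. a j * entry (bg j))) =
   (CLINT bg|slabs. complex_of_real (exp (- (\<Sum>j<p. (a j)\<^sup>2 * of_bool (fst (bg j)) / 2))))"
proof -
  interpret PS: product_prob_space "\<lambda>_. slab" "{..<p}" ..
  have "(CLINT bg|slabs. iexp (\<Sum>j<p. a j * entry (bg j))) = (CLINT bg|slabs. (\<Prod>j<p. iexp (a j * entry (bg j))))"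
    by (simp add: exp_sum[symmetric] sum_distrib_left)
  also have "\<dots> = (\<Prod>j<p. CLINT u|slab. iexp (a j * entry u))"
    unfolding slabs_def
    by (rule PS.product_integral_prod, simp)
      (intro integrable_iexp slab.prob_space_axioms borel_measurable_times borel_measurable_const entry_measurable)
  also have "\<dots> = (\<Prod>j<p. CLINT u|slab. complex_of_real (exp (- ((a j)\<^sup>2 * of_bool (fst u) / 2))))"
    by (simp only: slab_char)
  also have "\<dots> = (CLINT bg|slabs. (\<Prod>j<p. complex_of_real (exp (- ((a j)\<^sup>2 * of_bool (fst (bg j)) / 2)))))"
    unfolding slabs_def using all_moments_measurable[OF all_moments_active]
    by (intro PS.product_integral_prod[symmetric] integrable_exp_neg slab.prob_space_axioms) auto
  also have "\<dots> = (CLINT bg|slabs. complex_of_real (exp (- (\<Sum>j<p. (a j)\<^sup>2 * of_bool (fst (bg j)) / 2))))"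
    by (simp only: of_real_prod[symmetric] exp_sum[OF finite_lessThan, symmetric] sum_negf)
  finally show ?thesis .
qed

lemma integral_base2_fubini:
  fixes f :: "_ \<Rightarrow> complex"
  assumes "integrable base2 f"
  shows "(CLINT w|base2. f w) = (CLINT w'|base. CLINT w|base. f (w, w'))"
  using base2.integral_snd[of "\<lambda>x y. f (x, y)"] assms unfolding base2_def by simp

text \<open>
  Integrating out the Gaussian part of the first replica alone turns the characteristic function of
  the overlap at \<open>t\<close> into \<open>E exp (- t\<^sup>2 W / 2)\<close>.
\<close>

lemma overlap_law_eq_mixture: "overlap_law I prior = mix.law"
proof (rule Levy_uniqueness)
  let ?O = "\<lambda>w. label_overlap (fst (fst w)) (fst (snd w)) * slab_overlap (snd (fst w)) (snd (snd w))"
  have am: "all_moments base2 ?O"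
    unfolding label_overlap_def slab_overlap_def base2_def
    by (intro base2.all_moments_mult base2.all_moments_sum
      all_moments_fst[OF all_moments_base_label] all_moments_snd[OF all_moments_base_label]
      all_moments_fst[OF all_moments_base_entry] all_moments_snd[OF all_moments_base_entry]
      prob_space_base) auto
  note [measurable] = all_moments_measurable[OF am]
  interpret N: prob_space std_normal_distribution by (rule prob_space_std_normal)
  interpret MN: pair_prob_space base2 std_normal_distribution ..
  show "real_distribution (overlap_law I prior)"
    unfolding overlap_law_prior by (rule prob_space.real_distribution_distr[OF prob_space_base2]) measurable
  show "real_distribution mix.law"
    unfolding mix.law_def by (rule prob_space.real_distribution_distr[OF MN.prob_space_axioms]) (simp add: split_beta')
  show "char (overlap_law I prior) = char mix.law"
  proof
    fix t :: real
    have int1: "integrable base2 (\<lambda>w. iexp (t * ?O w))"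
      by (intro integrable_iexp prob_space_base2) measurable
    have int2: "integrable base2 (\<lambda>w. complex_of_real (exp (- (t\<^sup>2 * W w / 2))))"
      using W_nonneg by (intro integrable_exp_neg prob_space_base2) auto
    have "char (overlap_law I prior) t = (CLINT w|base2. iexp (t * ?O w))"
      unfolding char_def overlap_law_prior by (subst integral_distr) auto
    also have "\<dots> = (CLINT w'|base. CLINT w|base. iexp (t * ?O (w, w')))"
      by (rule integral_base2_fubini[OF int1])
    also have "\<dots> = (CLINT w'|base. CLINT w|base. complex_of_real (exp (- (t\<^sup>2 * W (w, w') / 2))))"
    proof (rule Bochner_Integration.integral_cong[OF refl])
      fix w'
      have O: "?O (w, w') = (\<Sum>i<n. fst w i * fst w' i) * (\<Sum>j<p. entry (snd w j) * entry (snd w' j))" for w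
        by (simp add: label_overlap_def slab_overlap_def)
      have Wm: "W (w, w') = (\<Sum>i<n. fst w i * fst w' i)\<^sup>2 * (\<Sum>j<p. of_bool (fst (snd w j)) * (entry (snd w' j))\<^sup>2)" for w
        by (simp add: label_overlap_def slab_var_def W_def)
      have mO: "(\<lambda>w. ?O (w, w')) \<in> borel_measurable base"
        unfolding O
        by (intro all_moments_measurable base2.M1.all_moments_mult base2.M1.all_moments_sum base2.M1.all_moments_const
          all_moments_base_label all_moments_base_entry) auto
      have mW: "(\<lambda>w. W (w, w')) \<in> borel_measurable base"
        unfolding Wm
        by (intro all_moments_measurable base2.M1.all_moments_mult base2.M1.all_moments_sum base2.M1.all_moments_const
          base2.M1.all_moments_power all_moments_base_label all_moments_base_active) auto
      have "integrable base (\<lambda>w. iexp (t * ?O (w, w')))"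
        using mO by (intro integrable_iexp prob_space_base) auto
      from base.integral_fst'[OF this[unfolded base_def]]
      have "(CLINT w|base. iexp (t * ?O (w, w'))) = (CLINT \<xi>|labels. CLINT bg|slabs. iexp (t * ?O ((\<xi>, bg), w')))"
        unfolding base_def by simp
      also have "\<dots> = (CLINT \<xi>|labels. CLINT bg|slabs. complex_of_real (exp (- (t\<^sup>2 * W ((\<xi>, bg), w') / 2))))"
      proof (rule Bochner_Integration.integral_cong[OF refl])
        fix \<xi>
        \<comment> \<open>With the labels and the second replica fixed, t times the overlap is a
          linear form in the entries of the first replica with these coefficients.\<close>
        define a where "a j = t * label_overlap \<xi> (fst w') * entry (snd w' j)" for j
        have "t * ?O ((\<xi>, bg), w') = (\<Sum>j<p. a j * entry (bg j))" for bg
          by (simp add: a_def slab_overlap_def sum_distrib_left mult_ac)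
        moreover have "t\<^sup>2 * W ((\<xi>, bg), w') / 2 = (\<Sum>j<p. (a j)\<^sup>2 * of_bool (fst (bg j)) / 2)" for bg
          by (simp add: a_def W_def slab_var_def sum_distrib_left sum_divide_distrib power_mult_distrib mult_ac
              del: sum_of_bool_mult_eq sum_mult_of_bool_eq)
        ultimately show "(CLINT bg|slabs. iexp (t * ?O ((\<xi>, bg), w'))) =
            (CLINT bg|slabs. complex_of_real (exp (- (t\<^sup>2 * W ((\<xi>, bg), w') / 2))))"
          by (simp only: slabs_char)
      qed
      also have "\<dots> = (CLINT w|base. complex_of_real (exp (- (t\<^sup>2 * W (w, w') / 2))))"
      proof -
        have "integrable base (\<lambda>w. complex_of_real (exp (- (t\<^sup>2 * W (w, w') / 2))))"
          using mW W_nonneg by (intro integrable_exp_neg prob_space_base) auto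
        from base.integral_fst'[OF this[unfolded base_def]] show ?thesis
          unfolding base_def by simp
      qed
      finally show "(CLINT w|base. iexp (t * ?O (w, w'))) = (CLINT w|base. complex_of_real (exp (- (t\<^sup>2 * W (w, w') / 2))))" .
    qed
    also have "\<dots> = (CLINT w|base2. complex_of_real (exp (- (t\<^sup>2 * W w / 2))))"
      by (rule integral_base2_fubini[OF int2, symmetric])
    also have "\<dots> = (CLINT w|base2. CLINT z|std_normal_distribution. iexp (t * (sqrt (W w) * z)))"
    proof (rule Bochner_Integration.integral_cong[OF refl])
      fix w
      have "char std_normal_distribution (t * sqrt (W w)) = complex_of_real (exp (- (t\<^sup>2 * W w / 2)))"
        unfolding char_std_normal_distribution using W_nonneg[of w] by (simp add: power_mult_distrib)
      then show "complex_of_real (exp (- (t\<^sup>2 * W w / 2))) = (CLINT z|std_normal_distribution. iexp (t * (sqrt (W w) * z)))"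
        by (simp add: char_def mult.assoc)
    qed
    also have "\<dots> = (CLINT w|base2 \<Otimes>\<^sub>M std_normal_distribution. iexp (t * (sqrt (W (fst w)) * snd w)))"
    proof -
      have "integrable (base2 \<Otimes>\<^sub>M std_normal_distribution) (\<lambda>w. iexp (t * (sqrt (W (fst w)) * snd w)))"
        by (intro integrable_iexp MN.prob_space_axioms) measurable
      from MN.integral_fst'[OF this] show ?thesis by simp
    qed
    also have "\<dots> = char mix.law t"
      unfolding char_def mix.law_def by (subst integral_distr) (auto simp: split_beta')
    finally show "char (overlap_law I prior) t = char mix.law t" .
  qed
qed

section \<open>Moments of the conditional variance\<close>

text \<open>Regrouping four independent components: the pair of label vectors is independent of the
  pair of column families. With nonnegative integrals Tonelli's theorem asks for no
  integrability.\<close>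

lemma nn_integral_base2_mult:
  assumes F: "(\<lambda>w. F (fst w) (snd w)) \<in> borel_measurable (labels \<Otimes>\<^sub>M labels)"
    and G: "(\<lambda>w. G (fst w) (snd w)) \<in> borel_measurable (slabs \<Otimes>\<^sub>M slabs)"
  shows "(\<integral>\<^sup>+w. (F (fst (fst w)) (fst (snd w)) :: ennreal) * G (snd (fst w)) (snd (snd w)) \<partial>base2) =
    (\<integral>\<^sup>+w. F (fst w) (snd w) \<partial>(labels \<Otimes>\<^sub>M labels)) * (\<integral>\<^sup>+w. G (fst w) (snd w) \<partial>(slabs \<Otimes>\<^sub>M slabs))"
proof -
  have mF: "(\<lambda>x. F (f x) (g x)) \<in> borel_measurable M" if "f \<in> M \<rightarrow>\<^sub>M labels" "g \<in> M \<rightarrow>\<^sub>M labels"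
    for f g and M :: "'c measure"
    using measurable_compose[OF measurable_Pair[OF that] F] by simp
  have mG: "(\<lambda>x. G (f x) (g x)) \<in> borel_measurable M" if "f \<in> M \<rightarrow>\<^sub>M slabs" "g \<in> M \<rightarrow>\<^sub>M slabs"
    for f g and M :: "'c measure"
    using measurable_compose[OF measurable_Pair[OF that] G] by simp
  define F1 where "F1 \<xi> = (\<integral>\<^sup>+\<xi>'. F \<xi> \<xi>' \<partial>labels)" for \<xi>
  define G1 where "G1 bg = (\<integral>\<^sup>+bg'. G bg bg' \<partial>slabs)" for bg
  have F1 [measurable]: "F1 \<in> borel_measurable labels"
    unfolding F1_def[abs_def] using F by (intro labels.borel_measurable_nn_integral) (simp add: split_beta')
  have G1 [measurable]: "G1 \<in> borel_measurable slabs"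
    unfolding G1_def[abs_def] using G by (intro slabs.borel_measurable_nn_integral) (simp add: split_beta')
  have "(\<integral>\<^sup>+w. F (fst (fst w)) (fst (snd w)) * G (snd (fst w)) (snd (snd w)) \<partial>base2) =
    (\<integral>\<^sup>+w. \<integral>\<^sup>+w'. F (fst w) (fst w') * G (snd w) (snd w') \<partial>base \<partial>base)"
    unfolding base2_def
    by (subst base2.M1.nn_integral_fst[symmetric])
      (auto intro!: borel_measurable_times_ennreal mF mG simp: base_def)
  also have "\<dots> = (\<integral>\<^sup>+w. F1 (fst w) * G1 (snd w) \<partial>base)"
  proof (rule nn_integral_cong)
    fix w assume "w \<in> space base"
    then have w: "fst w \<in> space labels" "snd w \<in> space slabs" by (auto simp: base_def space_pair_measure)
    have "(\<integral>\<^sup>+w'. F (fst w) (fst w') * G (snd w) (snd w') \<partial>base) =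
      (\<integral>\<^sup>+\<xi>'. \<integral>\<^sup>+bg'. F (fst w) \<xi>' * G (snd w) bg' \<partial>slabs \<partial>labels)"
      unfolding base_def using w
      by (subst slabs.nn_integral_fst[symmetric])
        (auto intro!: borel_measurable_times_ennreal mF mG)
    also have "\<dots> = (\<integral>\<^sup>+\<xi>'. F (fst w) \<xi>' * G1 (snd w) \<partial>labels)"
      unfolding G1_def using w by (intro nn_integral_cong nn_integral_cmult mG) auto
    also have "\<dots> = F1 (fst w) * G1 (snd w)"
      unfolding F1_def using w by (intro nn_integral_multc mF) auto
    finally show "(\<integral>\<^sup>+w'. F (fst w) (fst w') * G (snd w) (snd w') \<partial>base) = F1 (fst w) * G1 (snd w)" .
  qed
  also have "\<dots> = (\<integral>\<^sup>+\<xi>. \<integral>\<^sup>+bg. F1 \<xi> * G1 bg \<partial>slabs \<partial>labels)"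
    unfolding base_def by (subst slabs.nn_integral_fst[symmetric]) (auto intro!: borel_measurable_times_ennreal)
  also have "\<dots> = (\<integral>\<^sup>+\<xi>. F1 \<xi> \<partial>labels) * (\<integral>\<^sup>+bg. G1 bg \<partial>slabs)"
    by (simp add: nn_integral_cmult nn_integral_multc)
  also have "(\<integral>\<^sup>+\<xi>. F1 \<xi> \<partial>labels) = (\<integral>\<^sup>+w. F (fst w) (snd w) \<partial>(labels \<Otimes>\<^sub>M labels))"
    unfolding F1_def using labels.nn_integral_fst[OF F] by simp
  also have "(\<integral>\<^sup>+bg. G1 bg \<partial>slabs) = (\<integral>\<^sup>+w. G (fst w) (snd w) \<partial>(slabs \<Otimes>\<^sub>M slabs))"
    unfolding G1_def using slabs.nn_integral_fst[OF G] by simp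
  finally show ?thesis .
qed

text \<open>Given the first labels, the second ones contribute cosh (a \<xi>_i), whose mean is cosh
  a since cosh is even. So the label overlap is sub-Gaussian with variance proxy n.\<close>

lemma nn_integral_exp_label_overlap:
  "(\<integral>\<^sup>+w. ennreal (exp (a * label_overlap (fst w) (snd w))) \<partial>(labels \<Otimes>\<^sub>M labels)) \<le> ennreal (exp (real n * a\<^sup>2 / 2))"
proof -
  interpret PL: product_prob_space "\<lambda>_. measure_pmf rademacher" "{..<n}" ..
  have "(\<integral>\<^sup>+w. ennreal (exp (a * label_overlap (fst w) (snd w))) \<partial>(labels \<Otimes>\<^sub>M labels)) =
    (\<integral>\<^sup>+\<xi>. \<integral>\<^sup>+\<xi>'. ennreal (exp (a * label_overlap \<xi> \<xi>')) \<partial>labels \<partial>labels)"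
    using all_moments_measurable[OF all_moments_label_overlap]
    by (subst labels.nn_integral_fst[symmetric]) auto
  also have "\<dots> = (\<integral>\<^sup>+\<xi>. \<integral>\<^sup>+\<xi>'. (\<Prod>i<n. ennreal (exp ((a * \<xi> i) * \<xi>' i))) \<partial>labels \<partial>labels)"
    by (simp add: label_overlap_def sum_distrib_left exp_sum prod_ennreal mult.assoc)
  also have "\<dots> = (\<integral>\<^sup>+\<xi>. (\<Prod>i<n. ennreal (cosh (a * \<xi> i))) \<partial>labels)"
    unfolding labels_def by (subst PL.product_nn_integral_prod) (auto simp: nn_integral_rademacher_exp)
  also have "\<dots> = (\<Prod>i<n. \<integral>\<^sup>+x. ennreal (cosh (a * x)) \<partial>measure_pmf rademacher)"
    unfolding labels_def by (subst PL.product_nn_integral_prod) auto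
  also have "(\<integral>\<^sup>+x. ennreal (cosh (a * x)) \<partial>measure_pmf rademacher) = ennreal (cosh a)"
  proof -
    have "(\<integral>\<^sup>+x. ennreal (cosh (a * x)) \<partial>measure_pmf rademacher) = ennreal (\<integral>x. cosh (a * x) \<partial>measure_pmf rademacher)"
      by (intro nn_integral_eq_integral all_moments_integrable all_moments_rademacher AE_I2) simp
    then show ?thesis by (simp add: integral_rademacher)
  qed
  also have "(\<Prod>i<n. ennreal (cosh a)) = ennreal (cosh a ^ n)"
    by (simp add: ennreal_power)
  also have "\<dots> \<le> ennreal (exp (a\<^sup>2 / 2) ^ n)"
    by (intro ennreal_leI power_mono cosh_le_exp_half_square) simp
  also have "exp (a\<^sup>2 / 2) ^ n = exp (real n * a\<^sup>2 / 2)"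
    by (simp add: exp_of_nat_mult[symmetric])
  finally show ?thesis .
qed

lemma nn_integral_label_overlap_power:
  assumes n: "0 < n" and k: "0 < k"
  shows "(\<integral>\<^sup>+w. ennreal (label_overlap (fst w) (snd w) ^ (2 * k)) \<partial>(labels \<Otimes>\<^sub>M labels)) \<le>
    ennreal ((2 * exp 2 * real k * real n) ^ k)"
proof -
  \<comment> \<open>This choice makes the sub-Gaussian exponent n a^2 / 2 equal to k.\<close>
  define a where "a = sqrt (2 * real k / real n)"
  have a: "0 < a" "a\<^sup>2 = 2 * real k / real n" using n k by (auto simp: a_def)
  define c where "c = fact (2 * k) / a ^ (2 * k)"
  have c: "0 \<le> c" using a by (simp add: c_def)
  have pw: "r ^ (2 * k) \<le> c * exp (a * r) + c * exp (- a * r)" for r :: real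
  proof -
    have "(a * \<bar>r\<bar>) ^ (2 * k) \<le> fact (2 * k) * exp (a * \<bar>r\<bar>)"
      using a by (intro power_le_fact_exp) auto
    also have "exp (a * \<bar>r\<bar>) \<le> exp (a * r) + exp (- a * r)"
      by (cases "0 \<le> r") auto
    finally have "a ^ (2 * k) * r ^ (2 * k) \<le> fact (2 * k) * (exp (a * r) + exp (- a * r))"
      by (simp add: power_mult_distrib power_even_abs)
    then show ?thesis using a by (simp add: c_def field_simps)
  qed
  let ?R = "\<lambda>w. label_overlap (fst w) (snd w)"
  note [measurable] = all_moments_measurable[OF all_moments_label_overlap]
  have "(\<integral>\<^sup>+w. ennreal (?R w ^ (2 * k)) \<partial>(labels \<Otimes>\<^sub>M labels)) \<le>
    (\<integral>\<^sup>+w. ennreal c * ennreal (exp (a * ?R w)) + ennreal c * ennreal (exp (- a * ?R w)) \<partial>(labels \<Otimes>\<^sub>M labels))"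
    using pw c by (intro nn_integral_mono) (simp add: ennreal_mult[symmetric] ennreal_plus[symmetric] del: ennreal_plus)
  also have "\<dots> = ennreal c * (\<integral>\<^sup>+w. ennreal (exp (a * ?R w)) \<partial>(labels \<Otimes>\<^sub>M labels)) +
      ennreal c * (\<integral>\<^sup>+w. ennreal (exp (- a * ?R w)) \<partial>(labels \<Otimes>\<^sub>M labels))"
    by (simp add: nn_integral_add nn_integral_cmult)
  also have "\<dots> \<le> ennreal c * ennreal (exp (real n * a\<^sup>2 / 2)) + ennreal c * ennreal (exp (real n * (- a)\<^sup>2 / 2))"
    by (intro add_mono mult_left_mono nn_integral_exp_label_overlap) auto
  also have "\<dots> = ennreal (2 * c * exp (real k))"
    using c n by (simp add: a ennreal_mult[symmetric] ennreal_plus[symmetric] del: ennreal_plus)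
  also have "2 * c * exp (real k) \<le> (2 * exp 2 * real k * real n) ^ k"
  proof -
    have "c = fact (2 * k) * (real n / (2 * real k)) ^ k"
      by (simp add: c_def power_mult a power_divide)
    also have "\<dots> \<le> (2 * real k) ^ (2 * k) * (real n / (2 * real k)) ^ k"
      using fact_le_power[of "2 * k", where 'a = real] by (intro mult_right_mono) auto
    also have "\<dots> = (2 * real k * real n) ^ k"
    proof -
      have "(2 * real k)\<^sup>2 * (real n / (2 * real k)) = 2 * real k * real n"
        using k by (simp add: power2_eq_square)
      then show ?thesis by (simp only: power_mult power_mult_distrib[symmetric])
    qed
    finally have 1: "c \<le> (2 * real k * real n) ^ k" .
    have "2 \<le> exp (1::real)" using exp_ge_add_one_self[of 1] by simp
    also have "\<dots> \<le> exp (real k)" using k by simp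
    finally have "2 * c * exp (real k) \<le> exp (real k) * (2 * real k * real n) ^ k * exp (real k)"
      using 1 c by (intro mult_mono) auto
    also have "\<dots> = (2 * exp 2 * real k * real n) ^ k"
    proof -
      have "exp (real k) * exp (real k) = exp (2::real) ^ k"
        by (simp add: exp_add[symmetric] exp_of_nat_mult[symmetric])
      then show ?thesis by (simp add: power_mult_distrib mult_ac)
    qed
    finally show ?thesis .
  qed
  then have "ennreal (2 * c * exp (real k)) \<le> ennreal ((2 * exp 2 * real k * real n) ^ k)"
    by (rule ennreal_leI)
  finally show ?thesis .
qed

lemma nn_integral_slab_exp:
  "(\<integral>\<^sup>+u. ennreal (exp ((entry u)\<^sup>2 / 4)) \<partial>slab) \<le> ennreal (1 + dens / 2)"
proof -
  interpret N: prob_space std_normal_distribution by (rule prob_space_std_normal)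
  have "(\<lambda>u. ennreal (exp ((entry u)\<^sup>2 / 4))) \<in> borel_measurable slab" by measurable
  from N.nn_integral_fst[OF this[unfolded slab_def]]
  have "(\<integral>\<^sup>+u. ennreal (exp ((entry u)\<^sup>2 / 4)) \<partial>slab) =
    (\<integral>\<^sup>+b. \<integral>\<^sup>+z. ennreal (exp ((of_bool b * z)\<^sup>2 / 4)) \<partial>std_normal_distribution \<partial>measure_pmf (bernoulli_pmf dens))"
    unfolding slab_def by (simp add: entry_def)
  also have "\<dots> = ennreal (sqrt 2) * ennreal dens + ennreal (1 - dens)"
    using dens_bounds N.emeasure_space_1
    by (subst nn_integral_bernoulli_pmf) (auto simp: nn_integral_std_normal_exp_square)
  also have "\<dots> = ennreal (sqrt 2 * dens + (1 - dens))"
    using dens_bounds by (simp add: ennreal_mult[symmetric] ennreal_plus[symmetric] del: ennreal_plus)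
  also have "\<dots> \<le> ennreal (1 + dens / 2)"
  proof (rule ennreal_leI)
    have "sqrt 2 \<le> 3 / 2" by (rule real_le_lsqrt) (auto simp: power2_eq_square)
    then have "sqrt 2 * dens \<le> 3 / 2 * dens" using dens_bounds by (intro mult_right_mono) auto
    then show "sqrt 2 * dens + (1 - dens) \<le> 1 + dens / 2" by simp
  qed
  finally show ?thesis .
qed

text \<open>Integrating the second replica gives 1 for a column inactive in the first and at most 1
  + 2 a dens for an active one; averaging over the first support turns \<open>dens\<close> into its
  square. Hence p dens^2 = s^2 / p in the exponent.\<close>

lemma nn_integral_exp_slab_var:
  assumes a: "0 \<le> a" "a \<le> 1 / 4"
  shows "(\<integral>\<^sup>+w. ennreal (exp (a * slab_var (fst w) (snd w))) \<partial>(slabs \<Otimes>\<^sub>M slabs)) \<le> ennreal (exp (2 * a * (real p * dens\<^sup>2)))"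
proof -
  interpret PS: product_prob_space "\<lambda>_. slab" "{..<p}" ..
  have mact: "(\<lambda>u. f (fst u) :: ennreal) \<in> borel_measurable slab" for f
    unfolding slab_def by measurable
  have one: "(\<integral>\<^sup>+u. ennreal (exp (a * (of_bool b * (entry u)\<^sup>2))) \<partial>slab) \<le> ennreal (1 + 2 * a * dens * of_bool b)" for b
  proof (cases b)
    case True
    have "(\<integral>\<^sup>+u. ennreal (exp (a * (entry u)\<^sup>2)) \<partial>slab) \<le>
      (\<integral>\<^sup>+u. ennreal (1 - 4 * a) + ennreal (4 * a) * ennreal (exp ((entry u)\<^sup>2 / 4)) \<partial>slab)"
      using exp_scaled_convex[OF a] a
      by (intro nn_integral_mono) (simp add: ennreal_mult[symmetric] ennreal_plus[symmetric] del: ennreal_plus)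
    also have "\<dots> = ennreal (1 - 4 * a) + ennreal (4 * a) * (\<integral>\<^sup>+u. ennreal (exp ((entry u)\<^sup>2 / 4)) \<partial>slab)"
      using slab.emeasure_space_1 by (simp add: nn_integral_add nn_integral_cmult)
    also have "\<dots> \<le> ennreal (1 - 4 * a) + ennreal (4 * a) * ennreal (1 + dens / 2)"
      by (intro add_left_mono mult_left_mono nn_integral_slab_exp) simp
    also have "\<dots> = ennreal (1 + 2 * a * dens)"
      using a dens_bounds by (simp add: ennreal_mult[symmetric] ennreal_plus[symmetric] algebra_simps del: ennreal_plus)
    finally show ?thesis using True by simp
  next
    case False
    then show ?thesis using slab.emeasure_space_1 by simp
  qed
  have "(\<integral>\<^sup>+w. ennreal (exp (a * slab_var (fst w) (snd w))) \<partial>(slabs \<Otimes>\<^sub>M slabs)) =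
    (\<integral>\<^sup>+bg. \<integral>\<^sup>+bg'. ennreal (exp (a * slab_var bg bg')) \<partial>slabs \<partial>slabs)"
    using all_moments_measurable[OF all_moments_slab_var]
    by (subst slabs.nn_integral_fst[symmetric]) auto
  also have "\<dots> = (\<integral>\<^sup>+bg. \<integral>\<^sup>+bg'. (\<Prod>j<p. ennreal (exp (a * (of_bool (fst (bg j)) * (entry (bg' j))\<^sup>2)))) \<partial>slabs \<partial>slabs)"
    by (simp only: slab_var_def sum_distrib_left exp_sum[OF finite_lessThan] prod_ennreal exp_ge_zero)
  also have "\<dots> = (\<integral>\<^sup>+bg. (\<Prod>j<p. \<integral>\<^sup>+u. ennreal (exp (a * (of_bool (fst (bg j)) * (entry u)\<^sup>2))) \<partial>slab) \<partial>slabs)"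
    unfolding slabs_def by (subst PS.product_nn_integral_prod) auto
  also have "\<dots> \<le> (\<integral>\<^sup>+bg. (\<Prod>j<p. ennreal (1 + 2 * a * dens * of_bool (fst (bg j)))) \<partial>slabs)"
    by (intro nn_integral_mono prod_mono_ennreal one)
  also have "\<dots> = (\<Prod>j<p. \<integral>\<^sup>+u. ennreal (1 + 2 * a * dens * of_bool (fst u)) \<partial>slab)"
    unfolding slabs_def by (subst PS.product_nn_integral_prod) (auto intro: mact)
  also have "(\<integral>\<^sup>+u. ennreal (1 + 2 * a * dens * of_bool (fst u)) \<partial>slab) = ennreal (1 + 2 * a * dens\<^sup>2)"
  proof -
    have "(\<integral>\<^sup>+u. ennreal (1 + 2 * a * dens * of_bool (fst u)) \<partial>slab) =
        ennreal (\<integral>u. 1 + 2 * a * dens * of_bool (fst u) \<partial>slab)"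
      using a dens_bounds
      by (intro nn_integral_eq_integral all_moments_integrable slab.all_moments_add slab.all_moments_mult
          slab.all_moments_const all_moments_active AE_I2) simp
    also have "(\<integral>u. 1 + 2 * a * dens * of_bool (fst u) \<partial>slab) = 1 + 2 * a * dens * (\<integral>u. of_bool (fst u) \<partial>slab)"
      using all_moments_integrable[OF all_moments_active] slab.prob_space by simp
    also have "(\<integral>u. of_bool (fst u) \<partial>slab) = dens"
    proof -
      have "(\<integral>u. of_bool (fst u) * (1::real) \<partial>slab) = (\<integral>b. of_bool b \<partial>measure_pmf (bernoulli_pmf dens)) * (\<integral>z. 1 \<partial>std_normal_distribution)"
        unfolding slab_def
        by (rule integral_pair_mult[of _ _ "of_bool" "\<lambda>_. 1"])
          (intro prob_space_measure_pmf prob_space_std_normal all_moments_bernoulli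
            finite_measure.all_moments_const prob_space.finite_measure)+
      then show ?thesis
        using dens_bounds prob_space.prob_space[OF prob_space_std_normal] by simp
    qed
    finally show ?thesis by (simp add: power2_eq_square mult.assoc)
  qed
  also have "(\<Prod>j<p. ennreal (1 + 2 * a * dens\<^sup>2)) = ennreal ((1 + 2 * a * dens\<^sup>2) ^ p)"
    unfolding prod_constant card_lessThan using a by (intro ennreal_power) simp
  also have "\<dots> \<le> ennreal (exp (2 * a * dens\<^sup>2) ^ p)"
    using a by (intro ennreal_leI power_mono exp_ge_add_one_self) auto
  also have "exp (2 * a * dens\<^sup>2) ^ p = exp (2 * a * (real p * dens\<^sup>2))"
    by (simp add: exp_of_nat_mult[symmetric] mult_ac)
  finally show ?thesis .
qed

text \<open>The expected number of columns active in both replicas.\<close>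

definition sig2 :: real where "sig2 = s\<^sup>2 / real p"

lemma sig2_pos: "0 < sig2" using s_pos p_pos by (simp add: sig2_def)

lemma sig2_eq: "sig2 = real p * dens\<^sup>2"
proof -
  have "real p * (s / real p)\<^sup>2 = s\<^sup>2 / real p"
    using p_pos unfolding power2_eq_square by simp
  then show ?thesis unfolding sig2_def dens_def by (rule sym)
qed

lemma nn_integral_slab_var_power:
  assumes k: "0 < k" "4 * real k \<le> sig2"
  shows "(\<integral>\<^sup>+w. ennreal (slab_var (fst w) (snd w) ^ k) \<partial>(slabs \<Otimes>\<^sub>M slabs)) \<le> ennreal ((exp 2 * sig2) ^ k)"
proof -
  \<comment> \<open>The hypothesis \<open>4 * real k \<le> sig2\<close> says exactly a \<le> 1/4,
    the range of \<open>nn_integral_exp_slab_var\<close>. The exponent becomes 2 k, and k! / a^k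
    \<le> sig2^k leaves no factor k^k.\<close>
  define a where "a = real k / sig2"
  have a: "0 < a" "a \<le> 1 / 4" "a * sig2 = real k" using k sig2_pos by (auto simp: a_def field_simps)
  define c where "c = fact k / a ^ k"
  have c: "0 \<le> c" using a by (simp add: c_def)
  note [measurable] = all_moments_measurable[OF all_moments_slab_var]
  have pw: "r ^ k \<le> c * exp (a * r)" if "0 \<le> r" for r :: real
    using power_le_fact_exp[of "a * r" k] a that by (simp add: c_def power_mult_distrib field_simps)
  have "(\<integral>\<^sup>+w. ennreal (slab_var (fst w) (snd w) ^ k) \<partial>(slabs \<Otimes>\<^sub>M slabs)) \<le>
    (\<integral>\<^sup>+w. ennreal c * ennreal (exp (a * slab_var (fst w) (snd w))) \<partial>(slabs \<Otimes>\<^sub>M slabs))"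
    using c by (intro nn_integral_mono) (simp add: ennreal_mult[symmetric] pw slab_var_nonneg ennreal_leI)
  also have "\<dots> = ennreal c * (\<integral>\<^sup>+w. ennreal (exp (a * slab_var (fst w) (snd w))) \<partial>(slabs \<Otimes>\<^sub>M slabs))"
    by (rule nn_integral_cmult) measurable
  also have "\<dots> \<le> ennreal c * ennreal (exp (2 * a * (real p * dens\<^sup>2)))"
    using a by (intro mult_left_mono nn_integral_exp_slab_var) auto
  also have "\<dots> = ennreal (c * exp (2 * real k))"
    using c a(3) by (simp add: ennreal_mult[symmetric] sig2_eq[symmetric] mult.assoc)
  also have "c * exp (2 * real k) \<le> (exp 2 * sig2) ^ k"
  proof -
    have "c \<le> real k ^ k / a ^ k"
      unfolding c_def using fact_le_power[of k, where 'a = real] a by (intro divide_right_mono) auto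
    also have "\<dots> = sig2 ^ k"
      using k sig2_pos by (simp add: a_def power_divide)
    finally have "c * exp (2 * real k) \<le> sig2 ^ k * exp (2 * real k)"
      by (intro mult_right_mono) auto
    then show ?thesis by (simp add: power_mult_distrib exp_of_nat_mult[symmetric] mult.commute)
  qed
  then have "ennreal (c * exp (2 * real k)) \<le> ennreal ((exp 2 * sig2) ^ k)" by (rule ennreal_leI)
  finally show ?thesis .
qed

definition scale :: real where "scale = real n * sig2"

text \<open>By independence: the labels supply (C k n)^k and the columns (C sig2)^k, so the factor
  k^k arises only once.\<close>

lemma W_moment_le:
  assumes n: "0 < n" and k: "0 < k" "4 * real k \<le> sig2"
  shows "(\<integral>w. W w ^ k \<partial>base2) \<le> (2 * exp 4 * real k * scale) ^ k"
proof -
  interpret B2: prob_space base2 by (rule prob_space_base2)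
  have int: "integrable base2 (\<lambda>w. W w ^ k)"
    by (intro all_moments_integrable finite_measure.all_moments_power all_moments_W
      prob_space.finite_measure prob_space_base2)
  have "ennreal (\<integral>w. W w ^ k \<partial>base2) = (\<integral>\<^sup>+w. ennreal (W w ^ k) \<partial>base2)"
    using W_nonneg by (intro nn_integral_eq_integral[symmetric] int) auto
  also have "\<dots> = (\<integral>\<^sup>+w. ennreal (label_overlap (fst (fst w)) (fst (snd w)) ^ (2 * k)) *
     ennreal (slab_var (snd (fst w)) (snd (snd w)) ^ k) \<partial>base2)"
    by (simp add: W_def power_mult_distrib power_mult ennreal_mult slab_var_nonneg)
  also have "\<dots> = (\<integral>\<^sup>+w. ennreal (label_overlap (fst w) (snd w) ^ (2 * k)) \<partial>(labels \<Otimes>\<^sub>M labels)) *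
     (\<integral>\<^sup>+w. ennreal (slab_var (fst w) (snd w) ^ k) \<partial>(slabs \<Otimes>\<^sub>M slabs))"
    using all_moments_measurable[OF all_moments_label_overlap] all_moments_measurable[OF all_moments_slab_var]
    by (intro nn_integral_base2_mult) auto
  also have "\<dots> \<le> ennreal ((2 * exp 2 * real k * real n) ^ k) * ennreal ((exp 2 * sig2) ^ k)"
    by (intro mult_mono nn_integral_label_overlap_power nn_integral_slab_var_power n k) auto
  also have "\<dots> = ennreal ((2 * exp 2 * real k * real n) ^ k * (exp 2 * sig2) ^ k)"
    using sig2_pos by (simp add: ennreal_mult)
  also have "(2 * exp 2 * real k * real n) ^ k * (exp 2 * sig2) ^ k = (2 * exp 4 * real k * scale) ^ k"
  proof -
    have "exp 2 * exp 2 = (exp 4 :: real)" by (simp add: exp_add[symmetric])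
    then have "(2 * exp 2 * real k * real n) * (exp 2 * sig2) = 2 * exp 4 * real k * scale"
      by (simp add: scale_def mult_ac)
    then show ?thesis by (simp only: power_mult_distrib[symmetric])
  qed
  finally show ?thesis
    using sig2_pos by (subst (asm) ennreal_le_iff) (auto simp: scale_def)
qed

text \<open>E W is the second moment of the overlap, a sum of nonnegative squared moments, whose
  diagonal terms \<beta> = e_ij alone contribute n p dens^2. Overlap moments do not involve
  \<open>lam\<close>, so the locale is interpreted at 0.\<close>

lemma W_mean_ge: "scale \<le> (\<integral>w. W w \<partial>base2)"
proof -
  interpret ga: gaussian_additive prior I 0 by (rule gaussian_additive_prior) simp
  interpret N: prob_space std_normal_distribution by (rule prob_space_std_normal)
  interpret MN: pair_prob_space base2 std_normal_distribution ..
  have am: "all_moments (base2 \<Otimes>\<^sub>M std_normal_distribution) (\<lambda>w. W (fst w) * (snd w)\<^sup>2)"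
    by (intro MN.all_moments_mult MN.all_moments_power all_moments_fst[OF all_moments_W]
      all_moments_snd[OF all_moments_std_normal] prob_space_base2 prob_space_std_normal)
  have "ga.overlap_moment (Suc 1) = (\<integral>w. (sqrt (W (fst w)) * snd w)\<^sup>2 \<partial>(base2 \<Otimes>\<^sub>M std_normal_distribution))"
    unfolding ga.overlap_moment_def overlap_law_eq_mixture mix.law_def
    by (subst integral_distr) (auto simp: split_beta' numeral_2_eq_2)
  also have "\<dots> = (\<integral>w. W (fst w) * (snd w)\<^sup>2 \<partial>(base2 \<Otimes>\<^sub>M std_normal_distribution))"
    using W_nonneg by (simp add: power_mult_distrib)
  also have "\<dots> = (\<integral>w. W w \<partial>base2) * (\<integral>z. z\<^sup>2 \<partial>std_normal_distribution)"
    by (intro integral_pair_mult prob_space_base2 prob_space_std_normal all_moments_W N.all_moments_power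
      all_moments_std_normal)
  also have "(\<integral>z. z\<^sup>2 \<partial>std_normal_distribution) = 1"
    using normal_moment_simps(3)[of 0] normal_moment_simps(1) by (simp add: normal_moment_def numeral_2_eq_2)
  finally have mean: "ga.overlap_moment (Suc 1) = (\<integral>w. W w \<partial>base2)" by simp
  have "scale = (\<Sum>ij\<in>I. dens\<^sup>2)"
    by (simp add: scale_def sig2_eq)
  also have "\<dots> \<le> (\<Sum>ij\<in>I. \<Sum>\<beta>\<in>exponents_eq I 1. (moment I prior (\<beta>(ij := Suc (\<beta> ij))))\<^sup>2 / multifact I \<beta>)"
  proof (rule sum_mono)
    fix ij assume ij: "ij \<in> I"
    define \<beta> :: "nat \<times> nat \<Rightarrow> nat" where "\<beta> = (\<lambda>_. 0)(ij := 1)"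
    have mem: "\<beta> \<in> exponents_eq I 1"
      using ij by (auto simp: exponents_eq_def \<beta>_def)
    have "(\<Prod>x\<in>I. y x ^ (\<beta>(ij := Suc (\<beta> ij))) x) = (y ij)\<^sup>2" for y :: "nat \<times> nat \<Rightarrow> real"
      using ij by (simp add: ga.prod_power_Suc power2_eq_square \<beta>_def if_distrib[of "\<lambda>k. _ ^ k"] cong: if_cong)
    then have "moment I prior (\<beta>(ij := Suc (\<beta> ij))) = dens"
      unfolding moment_def using second_moment_prior[OF ij] by simp
    moreover have "multifact I \<beta> = 1"
      by (rule prod.neutral) (simp add: \<beta>_def)
    ultimately have "dens\<^sup>2 = (moment I prior (\<beta>(ij := Suc (\<beta> ij))))\<^sup>2 / multifact I \<beta>" by simp
    also have "\<dots> \<le> (\<Sum>\<beta>\<in>exponents_eq I 1. (moment I prior (\<beta>(ij := Suc (\<beta> ij))))\<^sup>2 / multifact I \<beta>)"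
      using mem by (intro member_le_sum divide_nonneg_pos ga.multifact_pos finite_exponents_eq) auto
    finally show "dens\<^sup>2 \<le> \<dots>" .
  qed
  also have "\<dots> = (\<integral>w. W w \<partial>base2)"
    unfolding mean[symmetric] using ga.overlap_moment_Suc[of 1] by (simp only: fact_1 div_by_1)
  finally show ?thesis .
qed

lemma mixture_moments:
  assumes "0 < n" "8 \<le> sig2"
  shows "gaussian_scale_mixture_moments base2 W scale (2 * exp 4)"
proof (intro gaussian_scale_mixture_moments.intro gaussian_scale_mixture_moments_axioms.intro
    mix.gaussian_scale_mixture_axioms all_moments_W W_mean_ge)
  show "0 < scale" using assms by (simp add: scale_def)
  show "1 \<le> 2 * exp (4::real)"
    using exp_ge_add_one_self[of 4] by linarith
  show "(\<integral>w. (W w)\<^sup>2 \<partial>base2) \<le> (2 * exp 4 * 2 * scale)\<^sup>2"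
    using W_moment_le[of 2] assms by simp
qed

end

section \<open>Explicit constants and bounds at fixed n\<close>

definition moment_const :: real where "moment_const = 2 * exp 4"

lemma moment_const_ge_1: "1 \<le> moment_const"
  unfolding moment_const_def using exp_ge_add_one_self[of 4] by linarith

text \<open>Serves twice: in the upper bound on the overlap quantile and as the base constant of the
  low-degree series.\<close>

definition gain_const :: real where "gain_const = exp 1 * sqrt moment_const"

lemma gain_const_ge_1: "1 \<le> gain_const"
proof -
  have "1 * 1 \<le> exp 1 * sqrt moment_const" using moment_const_ge_1 by (intro mult_mono) auto
  then show ?thesis by (simp add: gain_const_def)
qed

definition kurt_const :: real where "kurt_const = 4 * moment_const\<^sup>2"

text \<open>The constant of \<open>mix_slope_le\<close> times that of the quantile bound.\<close>

definition upper_const :: real where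
  "upper_const = 6 * (1 + 8 * kurt_const * sqrt (48 * kurt_const)) * gain_const"

text \<open>The factor 2 e B of \<open>mix_density_le_slope\<close>, doubled because the quantile is
  only bounded below by sqrt w / 2.\<close>

definition lower_const :: real where "lower_const = 4 * (exp 1 * moment_const)"

lemma upper_const_pos: "0 < upper_const"
  unfolding upper_const_def kurt_const_def using gain_const_ge_1 moment_const_ge_1
  by (intro mult_pos_pos add_pos_nonneg) auto

lemma lower_const_pos: "0 < lower_const"
  unfolding lower_const_def using moment_const_ge_1 by simp

context sparse_clustering
begin

lemma scale_pos: "0 < n \<Longrightarrow> 0 < scale"
  using sig2_pos by (simp add: scale_def)

text \<open>The mixture is symmetric, so odd moments vanish. For d + 1 = 2 k the hypothesis
  \<open>2 * real (d + 1) \<le> sig2\<close> is the range 4 k \<le> sig2 of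
  \<open>W_moment_le\<close>.\<close>

lemma overlap_moment_le:
  assumes n: "0 < n" and sig: "8 \<le> sig2" "2 * real (d + 1) \<le> sig2"
  shows "(\<integral>t. t ^ Suc d \<partial>overlap_law I prior) \<le> (if d = 0 then 0 else (sqrt moment_const * real (d + 1) * sqrt scale) ^ (d + 1))"
proof -
  interpret gaussian_scale_mixture_moments base2 W scale moment_const
    unfolding moment_const_def by (rule mixture_moments[OF n sig(1)])
  have nonneg: "0 \<le> sqrt moment_const * real (d + 1) * sqrt scale"
    using moment_const_ge_1 w_pos by simp
  show ?thesis
  proof (cases "even (Suc d)")
    case False
    then show ?thesis
      using nonneg unfolding overlap_law_eq_mixture by (simp add: integral_law_odd del: power_Suc)
  next
    case True
    then obtain k where k: "Suc d = 2 * k" by (elim evenE)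
    then have k0: "0 < k" "d \<noteq> 0" by presburger+
    have "4 * real k \<le> sig2" using sig(2) k by simp
    then have "(\<integral>w. W w ^ k \<partial>base2) \<le> (moment_const * real k * scale) ^ k"
      using W_moment_le[OF n k0(1)] by (simp add: moment_const_def)
    then have "(\<integral>t. t ^ (2 * k) \<partial>mix.law) \<le> (moment_const * (real k)\<^sup>2 * scale) ^ k"
      by (rule integral_law_even_le)
    also have "moment_const * (real k)\<^sup>2 * scale = (sqrt moment_const * real k * sqrt scale)\<^sup>2"
      using moment_const_ge_1 w_pos by (simp add: power_mult_distrib)
    also have "\<dots> ^ k \<le> ((sqrt moment_const * real (d + 1) * sqrt scale)\<^sup>2) ^ k"
      using k moment_const_ge_1 w_pos by (intro power_mono mult_mono) auto
    also have "\<dots> = (sqrt moment_const * real (d + 1) * sqrt scale) ^ (d + 1)"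
      using k by (simp add: power_mult[symmetric])
    finally show ?thesis using k0 k unfolding overlap_law_eq_mixture by simp
  qed
qed

text \<open>By (d + 1)^(d + 1) / d! \<le> (d + 1) e^(d + 1) the term of degree d is at most (d + 1)
  C sqrt w (C (d + 1)^2 lam sqrt w)^d with C = \<open>gain_const\<close>. The hypothesis on
  \<open>lam\<close> makes the last power at most 1, and there are D + 1 terms.\<close>

lemma mmse_prior_bounds:
  assumes n: "0 < n" and sig: "8 \<le> sig2" "2 * real (D + 1) \<le> sig2"
    and lam: "0 \<le> lam" "gain_const * real (D + 1) ^ 2 * (lam * sqrt scale) \<le> 1"
  shows "real n * s - gain_const * real (D + 1) ^ 2 * sqrt scale \<le> mmse_le I prior D lam"
    and "mmse_le I prior D lam \<le> real n * s"
proof -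
  interpret ga: gaussian_additive prior I lam by (rule gaussian_additive_prior[OF lam(1)])
  have w: "0 < scale" by (rule scale_pos[OF n])
  define r where "r = gain_const * real (D + 1) ^ 2 * (lam * sqrt scale)"
  have r: "0 \<le> r" "r \<le> 1" using lam w gain_const_ge_1 by (auto simp: r_def)
  have "ga.low_degree_gain D \<le> (\<Sum>d\<le>D. if d = 0 then 0 else gain_const * real (D + 1) * sqrt scale)"
    unfolding ga.low_degree_gain_def
  proof (rule sum_mono)
    fix d assume "d \<in> {..D}"
    then have d: "d \<le> D" by simp
    have om: "ga.overlap_moment (Suc d) \<le> (if d = 0 then 0 else (sqrt moment_const * real (d + 1) * sqrt scale) ^ (d + 1))"
      unfolding ga.overlap_moment_def using d sig by (intro overlap_moment_le n) auto
    define F where "F = lam ^ d * real (d + 1) ^ (2 * d) / fact d"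
    have F: "0 \<le> F" using lam by (simp add: F_def)
    show "lam ^ d * real (d + 1) ^ (2 * d) / fact d * ga.overlap_moment (Suc d) \<le>
        (if d = 0 then 0 else gain_const * real (D + 1) * sqrt scale)"
    proof (cases "d = 0")
      case True
      then show ?thesis using om mult_left_mono[OF om F] by (simp add: F_def)
    next
      case False
      have "F * ga.overlap_moment (Suc d) \<le> F * (sqrt moment_const * real (d + 1) * sqrt scale) ^ (d + 1)"
        using om False F by (intro mult_left_mono) auto
      also have "\<dots> = lam ^ d * real (d + 1) ^ (2 * d) * (sqrt moment_const * sqrt scale) ^ (d + 1) * (real (d + 1) ^ (d + 1) / fact d)"
        by (simp add: F_def power_mult_distrib)
      also have "\<dots> \<le> lam ^ d * real (d + 1) ^ (2 * d) * (sqrt moment_const * sqrt scale) ^ (d + 1) * (real (d + 1) * exp 1 ^ (d + 1))"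
      proof (rule mult_left_mono)
        have "real (d + 1) ^ (d + 1) \<le> fact (d + 1) * exp (real (d + 1))"
          by (rule power_le_fact_exp) simp
        also have "exp (real (d + 1)) = exp 1 ^ (d + 1)"
          by (simp only: exp_of_nat_mult[symmetric] mult_1_right)
        also have "fact (d + 1) = real (d + 1) * fact d" by simp
        finally have "real (d + 1) ^ (d + 1) \<le> real (d + 1) * exp 1 ^ (d + 1) * fact d" by (simp only: mult_ac)
        then show "real (d + 1) ^ (d + 1) / fact d \<le> real (d + 1) * exp 1 ^ (d + 1)"
          by (simp only: pos_divide_le_eq[OF fact_gt_zero])
      qed (use lam w moment_const_ge_1 in simp)
      also have "\<dots> = real (d + 1) * (gain_const * sqrt scale) * (gain_const * real (d + 1) ^ 2 * (lam * sqrt scale)) ^ d"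
        by (simp only: gain_const_def power_mult_distrib power_add power_one_right power_mult[symmetric] mult_ac)
      also have "\<dots> \<le> real (D + 1) * (gain_const * sqrt scale) * 1"
      proof (intro mult_mono)
        have "gain_const * real (d + 1) ^ 2 * (lam * sqrt scale) \<le> r"
          unfolding r_def using d w lam gain_const_ge_1 by (intro mult_right_mono mult_left_mono power_mono) auto
        then show "(gain_const * real (d + 1) ^ 2 * (lam * sqrt scale)) ^ d \<le> 1"
          using r w lam gain_const_ge_1 by (intro power_le_one) auto
      qed (use d w lam gain_const_ge_1 in auto)
      finally show ?thesis using False by (simp add: F_def mult_ac)
    qed
  qed
  also have "\<dots> \<le> (\<Sum>d\<le>D. gain_const * real (D + 1) * sqrt scale)"
    using w gain_const_ge_1 by (intro sum_mono) auto
  also have "\<dots> = gain_const * real (D + 1) ^ 2 * sqrt scale"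
    by (simp add: power2_eq_square mult_ac)
  finally show "real n * s - gain_const * real (D + 1) ^ 2 * sqrt scale \<le> mmse_le I prior D lam"
    using ga.mmse_le_bounds(1)[OF supermultiplicative_prior, of D] by (simp add: sum_second_moment_prior)
  show "mmse_le I prior D lam \<le> real n * s"
    using ga.mmse_le_bounds(2)[OF supermultiplicative_prior, of D] by (simp add: sum_second_moment_prior)
qed

text \<open>The quantile is estimated with moments of order D, the slope with order D^3: the
  exponent q^2 / w may be as large as (gain_const D)^2, and \<open>D2\<close> says that exp (- D^3)
  still beats it. \<open>D1\<close> feeds the lower quantile bound. As \<open>lam\<close> only
  shifts the derivative, the witness is the derivative at \<open>lam = 0\<close>.\<close>

lemma franz_parisi_prior:
  fixes D :: nat
  assumes n: "0 < n" and D: "1 \<le> D" and sig: "8 \<le> sig2" "4 * real D ^ 3 \<le> sig2"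
    and D1: "exp (- real D) < 1 / (48 * moment_const\<^sup>2)"
    and D2: "exp (- (real D ^ 3)) * (16 * kurt_const * sqrt (8 * kurt_const)) \<le> exp (- ((gain_const * real D)\<^sup>2))"
  defines "q \<equiv> overlap_quantile (overlap_law I prior) (real D)"
  shows "\<exists>a. q \<noteq> 0 \<and> (\<exists>f. is_density_off_0 (overlap_law I prior) f) \<and> 0 < density_off_0 (overlap_law I prior) q \<and>
    (\<forall>lam. (franz_parisi_ann (overlap_law I prior) lam has_real_derivative a - lam) (at q)) \<and>
    1 / (lower_const * real D ^ 3 * sqrt scale) \<le> a \<and> a \<le> upper_const * real D / sqrt scale"
proof -
  interpret gaussian_scale_mixture_moments base2 W scale moment_const
    unfolding moment_const_def by (rule mixture_moments[OF n sig(1)])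
  have kurt: "kurt = kurt_const" by (simp add: kurt_def kurt_const_def)
  have w: "0 < scale" by (rule w_pos)
  have D3: "real D \<le> real D ^ 3" "1 \<le> real D ^ 3"
    using D by (auto intro: self_le_power one_le_power)
  have mom: "(\<integral>x. W x ^ k \<partial>base2) \<le> (moment_const * real k * scale) ^ k" if "0 < k" "4 * real k \<le> sig2" for k
    using W_moment_le[OF n that] by (simp add: moment_const_def)
  have momD: "(\<integral>x. W x ^ D \<partial>base2) \<le> (moment_const * real D * scale) ^ D"
    using D D3(1) sig(2) by (intro mom) linarith+
  have q: "sqrt (scale / 2) \<le> q" "q \<le> gain_const * real D * sqrt scale"
    unfolding q_def overlap_law_eq_mixture gain_const_def
    using overlap_quantile_law_bounds[OF D _ momD D1] by auto
  have q_pos: "0 < q" using q(1) w by (intro less_le_trans[OF _ q(1)]) simp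
  then have q0: "q \<noteq> 0" by simp
  have q_sq: "scale / 2 \<le> q\<^sup>2"
    using power_mono[OF q(1), of 2] w by simp
  define a where "a = q * mix.mix_slope q / mix.mix_density q"
  have dens: "0 < mix.mix_density q" by (rule mix_density_pos[OF q0])
  have "a \<le> q * (6 / scale * (1 + 8 * kurt_const * sqrt (48 * kurt_const)) * mix.mix_density q) / mix.mix_density q"
    unfolding a_def using mix_slope_le[OF q_sq] dens q_pos
    by (intro divide_right_mono mult_left_mono) (auto simp: kurt)
  also have "\<dots> = q * (6 / scale * (1 + 8 * kurt_const * sqrt (48 * kurt_const)))"
    using dens by simp
  also have "\<dots> \<le> (gain_const * real D * sqrt scale) * (6 / scale * (1 + 8 * kurt_const * sqrt (48 * kurt_const)))"
    using q(2) w by (intro mult_right_mono) (auto simp: kurt_const_def)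
  also have "\<dots> = upper_const * real D * (sqrt scale / scale)"
    by (simp add: upper_const_def)
  also have "sqrt scale / scale = 1 / sqrt scale"
    using w by (simp add: field_simps)
  finally have upper: "a \<le> upper_const * real D / sqrt scale" by simp
  have "mix.mix_density q \<le> 2 * (exp 1 * moment_const * real (D ^ 3) * scale) * mix.mix_slope q"
  proof (rule mix_density_le_slope[OF q0])
    show "1 \<le> D ^ 3" using D by simp
    show "(\<integral>x. W x ^ (D ^ 3) \<partial>base2) \<le> (moment_const * real (D ^ 3) * scale) ^ (D ^ 3)"
      using D sig by (intro mom) auto
    have "q\<^sup>2 \<le> (gain_const * real D * sqrt scale)\<^sup>2" using q q_pos by (intro power_mono) auto
    also have "\<dots> = (gain_const * real D)\<^sup>2 * scale" using w by (simp add: power_mult_distrib)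
    finally have "q\<^sup>2 / scale \<le> (gain_const * real D)\<^sup>2"
      using w by (simp add: pos_divide_le_eq)
    then have "exp (- ((gain_const * real D)\<^sup>2)) \<le> exp (- q\<^sup>2 / scale)" by simp
    from order_trans[OF D2 this] show "exp (- real (D ^ 3)) * (16 * kurt * sqrt (8 * kurt)) \<le> exp (- q\<^sup>2 / scale)"
      by (simp only: kurt of_nat_power)
  qed
  moreover have K: "0 < 2 * (exp 1 * moment_const * real D ^ 3 * scale)"
    using w D moment_const_ge_1 by (intro mult_pos_pos zero_less_power) auto
  ultimately have "mix.mix_density q / (2 * (exp 1 * moment_const * real D ^ 3 * scale)) \<le> mix.mix_slope q"
    unfolding pos_divide_le_eq[OF K] by (simp only: of_nat_power mult.commute)
  then have "mix.mix_density q / (2 * (exp 1 * moment_const * real D ^ 3 * scale)) / mix.mix_density q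
      \<le> mix.mix_slope q / mix.mix_density q"
    using dens by (intro divide_right_mono) auto
  then have "1 / (2 * (exp 1 * moment_const * real D ^ 3 * scale)) \<le> mix.mix_slope q / mix.mix_density q"
    using dens by simp
  then have "q * (1 / (2 * (exp 1 * moment_const * real D ^ 3 * scale))) \<le> a"
    unfolding a_def using q_pos mult_left_mono[of _ _ q] by (simp only: times_divide_eq_right[symmetric])
  moreover have "1 / (lower_const * real D ^ 3 * sqrt scale) \<le> q * (1 / (2 * (exp 1 * moment_const * real D ^ 3 * scale)))"
  proof -
    have "sqrt scale / 2 \<le> sqrt (scale / 2)"
      using w by (intro real_le_rsqrt) (simp add: power_divide)
    then have "sqrt scale / 2 \<le> q" using q(1) by linarith
    then have "sqrt scale / 2 * (1 / (2 * (exp 1 * moment_const * real D ^ 3 * scale))) \<le> q * (1 / (2 * (exp 1 * moment_const * real D ^ 3 * scale)))"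
      using w moment_const_ge_1 by (intro mult_right_mono) auto
    also have "sqrt scale / 2 * (1 / (2 * (exp 1 * moment_const * real D ^ 3 * scale))) = 1 / (lower_const * real D ^ 3) * (sqrt scale / scale)"
      by (simp add: lower_const_def)
    also have "sqrt scale / scale = 1 / sqrt scale"
      using w by (simp add: field_simps)
    finally show ?thesis by simp
  qed
  ultimately have lower: "1 / (lower_const * real D ^ 3 * sqrt scale) \<le> a" by linarith
  show ?thesis
    unfolding overlap_law_eq_mixture
  proof (intro exI[of _ a] conjI allI)
    show "\<exists>f. is_density_off_0 mix.law f" using mix.is_density_off_0_mix_density by blast
    show "0 < density_off_0 mix.law q" using dens by (simp add: mix.density_off_0_law[OF q0])
    show "(franz_parisi_ann mix.law lam has_real_derivative a - lam) (at q)" for lam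
      unfolding a_def by (rule mix.DERIV_franz_parisi_ann[OF q0 dens])
  qed (use q0 upper lower in auto)
qed

end

section \<open>Asymptotics\<close>

lemma soft_O_I:
  assumes "\<forall>\<^sub>F n in sequentially. \<bar>f n\<bar> \<le> C * \<bar>g n\<bar> * ln (real n) ^ k"
  shows "f \<in> soft_O g"
proof -
  have "f \<in> O(\<lambda>n. g n * ln (real n) ^ k)"
  proof (rule bigoI[where c = C])
    show "\<forall>\<^sub>F n in sequentially. norm (f n) \<le> C * norm (g n * ln (real n) ^ k)"
      using assms eventually_ge_at_top[of 1]
      by eventually_elim (simp add: abs_mult power_abs[symmetric] mult.assoc)
  qed
  then show ?thesis by (auto simp: soft_O_def)
qed

text \<open>The lower half is phrased as a bound of g by f with the same constant and power of the
  logarithm, so that symmetry of the relation is visible.\<close>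

lemma soft_Theta_I:
  assumes "0 < C" "\<forall>\<^sub>F n in sequentially. \<bar>f n\<bar> \<le> C * \<bar>g n\<bar> * ln (real n) ^ k"
    "\<forall>\<^sub>F n in sequentially. \<bar>g n\<bar> \<le> C * \<bar>f n\<bar> * ln (real n) ^ k"
  shows "f \<in> soft_Theta g"
proof -
  have "f \<in> O(\<lambda>n. g n * ln (real n) ^ k)"
  proof (rule bigoI[where c = C])
    show "\<forall>\<^sub>F n in sequentially. norm (f n) \<le> C * norm (g n * ln (real n) ^ k)"
      using assms(2) eventually_ge_at_top[of 1]
      by eventually_elim (simp add: abs_mult power_abs[symmetric] mult.assoc)
  qed
  moreover have "(\<lambda>n. g n / ln (real n) ^ k) \<in> O(f)"
  proof (rule bigoI[where c = C])
    show "\<forall>\<^sub>F n in sequentially. norm (g n / ln (real n) ^ k) \<le> C * norm (f n)"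
      using assms(3) eventually_ge_at_top[of 2]
    proof eventually_elim
      case (elim n)
      then have "0 < ln (real n)" by simp
      then have "0 < ln (real n) ^ k" by simp
      with elim(1) show ?case by (simp add: pos_divide_le_eq)
    qed
  qed
  ultimately show ?thesis
    unfolding soft_Theta_def bigomega_iff_bigo by blast
qed

lemma soft_Theta_E:
  assumes "f \<in> soft_Theta g"
  obtains C k where "0 < C" "\<forall>\<^sub>F n in sequentially. \<bar>f n\<bar> \<le> C * \<bar>g n\<bar> * ln (real n) ^ k"
    "\<forall>\<^sub>F n in sequentially. \<bar>g n\<bar> \<le> C * \<bar>f n\<bar> * ln (real n) ^ k"
proof -
  from assms obtain k where k: "f \<in> O(\<lambda>n. g n * ln (real n) ^ k)" "(\<lambda>n. g n / ln (real n) ^ k) \<in> O(f)"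
    unfolding soft_Theta_def bigomega_iff_bigo by blast
  obtain c where c: "0 < c" "\<forall>\<^sub>F n in sequentially. norm (f n) \<le> c * norm (g n * ln (real n) ^ k)"
    using landau_o.bigE[OF k(1)] by blast
  obtain d where d: "0 < d" "\<forall>\<^sub>F n in sequentially. norm (g n / ln (real n) ^ k) \<le> d * norm (f n)"
    using landau_o.bigE[OF k(2)] by blast
  show ?thesis
  proof
    show "0 < max c d" using c by simp
    show "\<forall>\<^sub>F n in sequentially. \<bar>f n\<bar> \<le> max c d * \<bar>g n\<bar> * ln (real n) ^ k"
      using c(2) eventually_ge_at_top[of 1]
    proof eventually_elim
      case (elim n)
      then have "\<bar>f n\<bar> \<le> c * (\<bar>g n\<bar> * ln (real n) ^ k)" by (simp add: abs_mult power_abs[symmetric])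
      also have "\<dots> \<le> max c d * (\<bar>g n\<bar> * ln (real n) ^ k)"
        using elim by (intro mult_right_mono) auto
      finally show ?case by (simp only: mult.assoc)
    qed
    show "\<forall>\<^sub>F n in sequentially. \<bar>g n\<bar> \<le> max c d * \<bar>f n\<bar> * ln (real n) ^ k"
      using d(2) eventually_ge_at_top[of 2]
    proof eventually_elim
      case (elim n)
      then have "0 < ln (real n)" by simp
      then have l: "0 < ln (real n) ^ k" by simp
      have "\<bar>g n\<bar> \<le> d * \<bar>f n\<bar> * ln (real n) ^ k"
        using elim(1) l by (simp add: pos_divide_le_eq)
      also have "\<dots> \<le> max c d * \<bar>f n\<bar> * ln (real n) ^ k"
        using l by (intro mult_right_mono) auto
      finally show ?case .
    qed
  qed
qed

lemma soft_Theta_sym: "f \<in> soft_Theta g \<Longrightarrow> g \<in> soft_Theta f"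
  by (erule soft_Theta_E) (rule soft_Theta_I)

lemma soft_Theta_trans:
  assumes "f \<in> soft_Theta g" "g \<in> soft_Theta h"
  shows "f \<in> soft_Theta h"
proof -
  obtain C k where C: "0 < C" "\<forall>\<^sub>F n in sequentially. \<bar>f n\<bar> \<le> C * \<bar>g n\<bar> * ln (real n) ^ k"
    "\<forall>\<^sub>F n in sequentially. \<bar>g n\<bar> \<le> C * \<bar>f n\<bar> * ln (real n) ^ k"
    using assms(1) by (rule soft_Theta_E)
  obtain D l where D: "0 < D" "\<forall>\<^sub>F n in sequentially. \<bar>g n\<bar> \<le> D * \<bar>h n\<bar> * ln (real n) ^ l"
    "\<forall>\<^sub>F n in sequentially. \<bar>h n\<bar> \<le> D * \<bar>g n\<bar> * ln (real n) ^ l"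
    using assms(2) by (rule soft_Theta_E)
  show ?thesis
  proof (rule soft_Theta_I[of "C * D" f h "k + l"])
    show "0 < C * D" using C D by simp
    show "\<forall>\<^sub>F n in sequentially. \<bar>f n\<bar> \<le> C * D * \<bar>h n\<bar> * ln (real n) ^ (k + l)"
      using C(2) D(2) eventually_ge_at_top[of 1]
    proof eventually_elim
      case (elim n)
      have "\<bar>f n\<bar> \<le> C * ln (real n) ^ k * \<bar>g n\<bar>" using elim by (simp add: mult_ac)
      also have "\<dots> \<le> C * ln (real n) ^ k * (D * \<bar>h n\<bar> * ln (real n) ^ l)"
        using elim C by (intro mult_left_mono) auto
      finally show ?case by (simp add: power_add mult_ac)
    qed
    show "\<forall>\<^sub>F n in sequentially. \<bar>h n\<bar> \<le> C * D * \<bar>f n\<bar> * ln (real n) ^ (k + l)"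
      using C(3) D(3) eventually_ge_at_top[of 1]
    proof eventually_elim
      case (elim n)
      have "\<bar>h n\<bar> \<le> D * ln (real n) ^ l * \<bar>g n\<bar>" using elim by (simp add: mult_ac)
      also have "\<dots> \<le> D * ln (real n) ^ l * (C * \<bar>f n\<bar> * ln (real n) ^ k)"
        using elim D by (intro mult_left_mono) auto
      finally show ?case by (simp add: power_add mult_ac)
    qed
  qed
qed

lemma degree_threshold:
  "\<exists>X\<ge>1. \<forall>x\<ge>X. exp (- x) < 1 / (48 * moment_const\<^sup>2) \<and>
     exp (- (x ^ 3)) * (16 * kurt_const * sqrt (8 * kurt_const)) \<le> exp (- ((gain_const * x)\<^sup>2))"
proof -
  define b where "b = 48 * moment_const\<^sup>2"
  define C where "C = 16 * kurt_const * sqrt (8 * kurt_const)"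
  have b: "0 < b" using moment_const_ge_1 by (simp add: b_def)
  have C: "0 < C" using moment_const_ge_1 by (auto simp: C_def kurt_const_def)
  \<comment> \<open>Each summand meets one demand: ln b < x for the first inequality, and ln C \<le>
    x - gain_const^2 for the second, which multiplied by x^2 \<ge> 1 on the right compares cubic
    with quadratic growth.\<close>
  define X where "X = 1 + \<bar>ln b\<bar> + gain_const\<^sup>2 + \<bar>ln C\<bar>"
  have "1 \<le> X" by (simp add: X_def)
  moreover have "exp (- x) < 1 / b \<and> exp (- (x ^ 3)) * C \<le> exp (- ((gain_const * x)\<^sup>2))" if x: "X \<le> x" for x
  proof
    have x1: "1 \<le> x" using x \<open>1 \<le> X\<close> by simp
    have "ln b < x" using x zero_le_power2[of gain_const] unfolding X_def by linarith
    then have "exp (- x) < exp (- ln b)" by simp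
    also have "exp (- ln b) = 1 / b" using b by (simp add: exp_minus divide_inverse)
    finally show "exp (- x) < 1 / b" .
    have "0 \<le> \<bar>ln b\<bar>" "ln C \<le> \<bar>ln C\<bar>" by auto
    with x have "ln C \<le> 1 * (x - gain_const\<^sup>2)" by (simp add: X_def)
    also have "\<dots> \<le> x\<^sup>2 * (x - gain_const\<^sup>2)"
      using x x1 unfolding X_def by (intro mult_right_mono) auto
    finally have "- (x ^ 3) + ln C \<le> - ((gain_const * x)\<^sup>2)"
      by (simp add: power2_eq_square power3_eq_cube algebra_simps)
    then have "exp (- (x ^ 3) + ln C) \<le> exp (- ((gain_const * x)\<^sup>2))" by simp
    then show "exp (- (x ^ 3)) * C \<le> exp (- ((gain_const * x)\<^sup>2))"
      by (simp only: exp_add exp_ln[OF C])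
  qed
  ultimately show ?thesis unfolding b_def C_def by blast
qed

section \<open>The sparse clustering regime as n tends to infinity\<close>

text \<open>s^2 / p is p to the power 2 \<alpha> - 1 + 2 \<delta>. Half of each of the margins c and
  2 \<alpha> - 1 is given up to absorb the vanishing \<epsilon> and \<delta>, which leaves the
  exponent c (2 \<alpha> - 1) / 4.\<close>

lemma sparse_regime:
  fixes p :: "nat \<Rightarrow> nat" and s \<epsilon> \<delta> :: "nat \<Rightarrow> real" and c \<alpha> :: real
  assumes c: "c > 0" and \<alpha>: "1/2 < \<alpha>" "\<alpha> < 1"
    and p_pos: "\<And>n. 0 < p n"
    and p: "\<epsilon> \<longlonglongrightarrow> 0" "\<forall>\<^sub>F n in sequentially. real (p n) = real n powr (c + \<epsilon> n)"
    and s: "\<delta> \<longlonglongrightarrow> 0" "\<forall>\<^sub>F n in sequentially. s n = real (p n) powr (\<alpha> + \<delta> n)"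
  shows "\<forall>\<^sub>F n in sequentially. 0 < s n \<and> s n \<le> real (p n) \<and>
    real n powr (c * (2 * \<alpha> - 1) / 4) \<le> (s n)\<^sup>2 / real (p n)"
proof -
  have "\<forall>\<^sub>F n in sequentially. - (c / 2) < \<epsilon> n"
    using p(1) c by (intro order_tendstoD) auto
  moreover have "\<forall>\<^sub>F n in sequentially. \<delta> n < 1 - \<alpha>"
    using s(1) \<alpha> by (intro order_tendstoD) auto
  moreover have "\<forall>\<^sub>F n in sequentially. - ((2 * \<alpha> - 1) / 4) < \<delta> n"
    using s(1) \<alpha> by (intro order_tendstoD) auto
  ultimately show ?thesis
    using p(2) s(2) eventually_ge_at_top[of 1]
  proof eventually_elim
    case (elim n)
    have p1: "1 \<le> real (p n)" using p_pos[of n] by simp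
    have "real (p n) powr (\<alpha> + \<delta> n) \<le> real (p n) powr 1"
      using elim p1 by (intro powr_mono) auto
    then have "s n \<le> real (p n)" using elim p1 by simp
    moreover have "0 < s n" using elim p1 by simp
    moreover have "real n powr (c * (2 * \<alpha> - 1) / 4) \<le> (s n)\<^sup>2 / real (p n)"
    proof -
      have "c / 2 * ((2 * \<alpha> - 1) / 2) \<le> (c + \<epsilon> n) * ((2 * \<alpha> - 1) / 2)"
        using elim \<alpha> by (intro mult_right_mono) auto
      then have "real n powr (c * (2 * \<alpha> - 1) / 4) \<le> real n powr ((c + \<epsilon> n) * ((2 * \<alpha> - 1) / 2))"
        using elim by (intro powr_mono) auto
      also have "\<dots> = real (p n) powr ((2 * \<alpha> - 1) / 2)"
        using elim by (simp add: powr_powr)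
      also have "\<dots> \<le> real (p n) powr ((\<alpha> + \<delta> n) + (\<alpha> + \<delta> n) - 1)"
      proof (rule powr_mono)
        show "(2 * \<alpha> - 1) / 2 \<le> (\<alpha> + \<delta> n) + (\<alpha> + \<delta> n) - 1" using elim(3) by argo
      qed (rule p1)
      also have "\<dots> = (real (p n) powr (\<alpha> + \<delta> n))\<^sup>2 / real (p n)"
        using p1 by (simp only: powr_diff powr_add power2_eq_square) simp
      also have "\<dots> = (s n)\<^sup>2 / real (p n)"
        using elim(5) by (simp only:)
      finally show ?thesis .
    qed
    ultimately show ?case by blast
  qed
qed

text \<open>Bridge from fixed n to soft asymptotics: D n is replaced by ln n, and D n + 1 by 2 ln n,
  so that the bounds become explicit in ln n and r with absolute constants.\<close>

lemma sparse_clustering_asymptotics: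
  fixes p :: "nat \<Rightarrow> nat" and s \<epsilon> \<delta> :: "nat \<Rightarrow> real" and c \<alpha> :: real
  assumes c: "c > 0" and \<alpha>: "1/2 < \<alpha>" "\<alpha> < 1"
    and p_pos: "\<And>n. 0 < p n"
    and p: "\<epsilon> \<longlonglongrightarrow> 0" "\<forall>\<^sub>F n in sequentially. real (p n) = real n powr (c + \<epsilon> n)"
    and s: "\<delta> \<longlonglongrightarrow> 0" "\<forall>\<^sub>F n in sequentially. s n = real (p n) powr (\<alpha> + \<delta> n)"
  defines "I \<equiv> \<lambda>n. {..<n} \<times> {..<p n}"
    and "X \<equiv> \<lambda>n. sparse_clustering_prior n (p n) (s n)"
    and "D \<equiv> \<lambda>n. nat \<lfloor>(1 - \<alpha>) * ln (real n)\<rfloor>"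
  defines "L \<equiv> \<lambda>n. overlap_law (I n) (X n)"
  defines "q \<equiv> \<lambda>n. overlap_quantile (L n) (real (D n))"
    and "dF \<equiv> \<lambda>n lam. deriv (franz_parisi_ann (L n) lam) (overlap_quantile (L n) (real (D n)))"
    and "r \<equiv> \<lambda>n. sqrt (real n * ((s n)\<^sup>2 / real (p n)))"
  shows "\<forall>\<^sub>F n in sequentially. 0 < s n \<and> 0 < r n \<and> 1 \<le> ln (real n) \<and>
    q n \<noteq> 0 \<and> (\<exists>f. is_density_off_0 (L n) f) \<and> 0 < density_off_0 (L n) (q n) \<and>
    (\<forall>lam. franz_parisi_ann (L n) lam field_differentiable at (q n)) \<and>
    (\<forall>lam. dF n lam = dF n 0 - lam) \<and>
    1 / (lower_const * ln (real n) ^ 3 * r n) \<le> dF n 0 \<and> dF n 0 \<le> upper_const * ln (real n) / r n \<and>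
    mmse_trivial (I n) (X n) = real n * s n \<and>
    (\<forall>lam. 0 \<le> lam \<longrightarrow> gain_const * (2 * ln (real n)) ^ 2 * (lam * r n) \<le> 1 \<longrightarrow>
       real n * s n - gain_const * (2 * ln (real n)) ^ 2 * r n \<le> mmse_le (I n) (X n) (D n) lam \<and>
       mmse_le (I n) (X n) (D n) lam \<le> real n * s n)"
proof -
  obtain X0 where X0: "1 \<le> X0" "\<And>x. X0 \<le> x \<Longrightarrow> exp (- x) < 1 / (48 * moment_const\<^sup>2) \<and>
     exp (- (x ^ 3)) * (16 * kurt_const * sqrt (8 * kurt_const)) \<le> exp (- ((gain_const * x)\<^sup>2))"
    using degree_threshold by blast
  define \<kappa> where "\<kappa> = c * (2 * \<alpha> - 1) / 4"
  have \<kappa>: "0 < \<kappa>" using c \<alpha> by (simp add: \<kappa>_def)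
  \<comment> \<open>The thresholds beyond which the fixed-n lemmas apply. A power of n exceeds the
    cube of the logarithm, as moments of order D^3 demand; the unit added to \<open>X0\<close> pays
    for the floor in D.\<close>
  have "\<forall>\<^sub>F n in sequentially. 8 \<le> real n powr \<kappa>" using \<kappa> by real_asymp
  moreover have "\<forall>\<^sub>F n in sequentially. 4 * (ln (real n) + 1) ^ 3 \<le> real n powr \<kappa>" using \<kappa> by real_asymp
  moreover have "\<forall>\<^sub>F n in sequentially. X0 + 1 \<le> (1 - \<alpha>) * ln (real n)" using \<alpha> by real_asymp
  moreover have "\<forall>\<^sub>F n in sequentially. 1 \<le> ln (real n)" by real_asymp
  ultimately show ?thesis
    using sparse_regime[OF c \<alpha> p_pos p s, folded \<kappa>_def] eventually_ge_at_top[of 1]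
  proof eventually_elim
    case (elim n)
    interpret sparse_clustering n "p n" "s n"
      using elim p_pos[of n] by unfold_locales auto
    have n: "0 < n" using elim by simp
    have X: "X n = prior" by (simp add: X_def prior_def)
    have Ln: "L n = overlap_law ({..<n} \<times> {..<p n}) prior" by (simp add: L_def X I_def)
    have sig2: "real n powr \<kappa> \<le> sig2" using elim by (simp add: sig2_def)
    have r: "r n = sqrt scale" by (simp add: r_def scale_def sig2_def)
    have D_le: "real (D n) \<le> ln (real n)"
    proof -
      have "real (D n) \<le> (1 - \<alpha>) * ln (real n)"
        using elim X0(1) unfolding D_def by (simp add: of_nat_nat)
      also have "\<dots> \<le> 1 * ln (real n)" using elim \<alpha> by (intro mult_right_mono) auto
      finally show ?thesis by simp
    qed
    have D_ge: "X0 \<le> real (D n)"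
      using elim X0(1) unfolding D_def by linarith
    have D1: "1 \<le> D n" using D_ge X0(1) by linarith
    have w: "0 < r n" unfolding r using scale_pos[OF n] by simp
    have cube: "4 * (real (D n) + 1) ^ 3 \<le> sig2"
    proof -
      have "4 * (real (D n) + 1) ^ 3 \<le> 4 * (ln (real n) + 1) ^ 3"
        using D_le by (intro mult_left_mono power_mono) auto
      then show ?thesis using elim sig2 by linarith
    qed
    have sig: "8 \<le> sig2" using elim sig2 by linarith
    have "real (D n) ^ 3 \<le> (real (D n) + 1) ^ 3" by (intro power_mono) auto
    then have sig3: "4 * real (D n) ^ 3 \<le> sig2" using cube by linarith
    have "real (D n) + 1 \<le> (real (D n) + 1) ^ 3" by (intro self_le_power) auto
    then have sig4: "2 * real (D n + 1) \<le> sig2" using cube by simp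
    obtain a where a: "q n \<noteq> 0" "\<exists>f. is_density_off_0 (L n) f" "0 < density_off_0 (L n) (q n)"
      "\<And>lam. (franz_parisi_ann (L n) lam has_real_derivative a - lam) (at (q n))"
      "1 / (lower_const * real (D n) ^ 3 * r n) \<le> a" "a \<le> upper_const * real (D n) / r n"
      using franz_parisi_prior[OF n D1 sig sig3] X0(2)[OF D_ge] unfolding q_def Ln r by blast
    have dF: "dF n lam = a - lam" for lam
      using DERIV_imp_deriv[OF a(4)] by (simp add: dF_def q_def)
    have "1 / (lower_const * ln (real n) ^ 3 * r n) \<le> 1 / (lower_const * real (D n) ^ 3 * r n)"
      using D_le D1 w lower_const_pos
      by (intro divide_left_mono mult_right_mono mult_left_mono power_mono mult_pos_pos) auto
    then have lower: "1 / (lower_const * ln (real n) ^ 3 * r n) \<le> dF n 0"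
      using a(5) by (simp add: dF)
    have "upper_const * real (D n) / r n \<le> upper_const * ln (real n) / r n"
      using D_le w upper_const_pos by (intro divide_right_mono mult_left_mono) auto
    then have upper: "dF n 0 \<le> upper_const * ln (real n) / r n"
      using a(6) by (simp add: dF)
    have sq: "real (D n + 1) ^ 2 \<le> (2 * ln (real n)) ^ 2"
      using D_le elim by (intro power_mono) auto
    have mmse: "real n * s n - gain_const * (2 * ln (real n)) ^ 2 * r n \<le> mmse_le (I n) (X n) (D n) lam"
      "mmse_le (I n) (X n) (D n) lam \<le> real n * s n"
      if lam: "0 \<le> lam" "gain_const * (2 * ln (real n)) ^ 2 * (lam * r n) \<le> 1" for lam
    proof -
      have "gain_const * real (D n + 1) ^ 2 * (lam * r n) \<le> gain_const * (2 * ln (real n)) ^ 2 * (lam * r n)"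
        using sq lam w gain_const_ge_1 by (intro mult_right_mono mult_left_mono) auto
      then have "gain_const * real (D n + 1) ^ 2 * (lam * sqrt scale) \<le> 1"
        using lam by (simp only: r)
      note bounds = mmse_prior_bounds[OF n sig sig4 lam(1) this]
      show "mmse_le (I n) (X n) (D n) lam \<le> real n * s n"
        using bounds(2) by (simp add: X I_def)
      have "gain_const * real (D n + 1) ^ 2 * r n \<le> gain_const * (2 * ln (real n)) ^ 2 * r n"
        using sq w gain_const_ge_1 by (intro mult_right_mono mult_left_mono) auto
      then show "real n * s n - gain_const * (2 * ln (real n)) ^ 2 * r n \<le> mmse_le (I n) (X n) (D n) lam"
        using bounds(1) by (simp add: X I_def r)
    qed
    have triv: "mmse_trivial (I n) (X n) = real n * s n"
      using mmse_trivial_prior by (simp add: X I_def)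
    have diff: "franz_parisi_ann (L n) lam field_differentiable at (q n)" for lam
      using a(4) unfolding field_differentiable_def by blast
    show ?case
      using a(1-3) elim w diff dF lower upper triv mmse by (simp add: dF)
  qed
qed


theorem theorem3p3:
  fixes p :: "nat \<Rightarrow> nat" and s \<Delta> lamALG \<epsilon> \<delta> :: "nat \<Rightarrow> real" and c \<alpha> :: real
  assumes c: "c > 0" and \<alpha>: "1/2 < \<alpha>" "\<alpha> < 1"
    and p_pos: "\<And>n. 0 < p n"
    and p: "\<epsilon> \<longlonglongrightarrow> 0" "\<forall>\<^sub>F n in sequentially. real (p n) = real n powr (c + \<epsilon> n)"
    and s: "\<delta> \<longlonglongrightarrow> 0" "\<forall>\<^sub>F n in sequentially. s n = real (p n) powr (\<alpha> + \<delta> n)"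
    and \<Delta>: "\<And>n. 0 < \<Delta> n"
    and lamALG: "\<forall>\<^sub>F n in sequentially. 0 < lamALG n"
      "lamALG \<in> soft_Theta (\<lambda>n. sqrt (real (p n) / ((s n)\<^sup>2 * real n)))"
  defines "I \<equiv> \<lambda>n. {..<n} \<times> {..<p n}"
    and "X \<equiv> \<lambda>n. sparse_clustering_prior n (p n) (s n)"
    and "D \<equiv> \<lambda>n. nat \<lfloor>(1 - \<alpha>) * ln (real n)\<rfloor>"
  defines "L \<equiv> \<lambda>n. overlap_law (I n) (X n)"
  defines "q \<equiv> \<lambda>n. overlap_quantile (L n) (real (D n))"
    and "dF \<equiv> \<lambda>n lam. deriv (franz_parisi_ann (L n) lam) (overlap_quantile (L n) (real (D n)))"
    and "mmse \<equiv> \<lambda>n lam. mmse_le (I n) (X n) (D n) lam"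
    and "triv \<equiv> \<lambda>n. mmse_trivial (I n) (X n)"
  defines "snr \<equiv> \<lambda>n. 1 / ln (real n) ^ 4 * (\<Delta> n / s n + dF n (\<Delta> n / s n))"
  shows
    \<comment> \<open>all quantities below are well defined\<close>
    "(\<forall>\<^sub>F n in sequentially.
        q n \<noteq> 0 \<and> (\<exists>f. is_density_off_0 (L n) f) \<and> 0 < density_off_0 (L n) (q n) \<and>
        (\<forall>lam. franz_parisi_ann (L n) lam field_differentiable at (q n)) \<and> 0 \<le> snr n) \<and>
     (\<lambda>n. mmse n (snr n) - real n * s n) \<in> soft_O (\<lambda>n. s n * sqrt (real n / real (p n))) \<and>
     (\<lambda>n. mmse n (snr n)) \<sim>[sequentially] triv \<and>
     (\<exists>lam. (\<forall>\<^sub>F n in sequentially. 0 < lam n) \<and>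
        lam \<in> soft_Theta (\<lambda>n. sqrt (real (p n) / ((s n)\<^sup>2 * real n))) \<and>
        lam \<in> soft_Theta lamALG \<and>
        (\<forall>\<^sub>F n in sequentially. 0 \<le> dF n (lam n))) \<and>
     (\<exists>lam \<eta>. (\<forall>\<^sub>F n in sequentially. 0 < lam n) \<and> lam \<in> soft_Theta lamALG \<and> \<eta> \<longlonglongrightarrow> 0 \<and>
        (\<forall>\<^sub>F n in sequentially. mmse n (lam n) \<ge> (1 + \<eta> n) * triv n))"
proof -
  define r where "r n = sqrt (real n * ((s n)\<^sup>2 / real (p n)))" for n
  \<comment> \<open>The derivative is affine in \<open>lam\<close> with slope -1, so its value at 0
    carries all the information.\<close>
  define a where "a n = dF n 0" for n
  have ev: "\<forall>\<^sub>F n in sequentially. 0 < s n \<and> 0 < r n \<and> 1 \<le> ln (real n) \<and>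
    q n \<noteq> 0 \<and> (\<exists>f. is_density_off_0 (L n) f) \<and> 0 < density_off_0 (L n) (q n) \<and>
    (\<forall>lam. franz_parisi_ann (L n) lam field_differentiable at (q n)) \<and>
    (\<forall>lam. dF n lam = a n - lam) \<and>
    1 / (lower_const * ln (real n) ^ 3 * r n) \<le> a n \<and> a n \<le> upper_const * ln (real n) / r n \<and>
    triv n = real n * s n \<and>
    (\<forall>lam. 0 \<le> lam \<longrightarrow> gain_const * (2 * ln (real n)) ^ 2 * (lam * r n) \<le> 1 \<longrightarrow>
       real n * s n - gain_const * (2 * ln (real n)) ^ 2 * r n \<le> mmse n lam \<and>
       mmse n lam \<le> real n * s n)"
    using sparse_clustering_asymptotics[OF c \<alpha> p_pos p s]
    unfolding a_def r_def q_def dF_def mmse_def triv_def L_def I_def X_def D_def .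
  note uc = upper_const_pos
  note lc = lower_const_pos
  note gc = gain_const_ge_1
  \<comment> \<open>The critical signal-to-noise ratio, which is the reciprocal of r.\<close>
  define g where "g n = sqrt (real (p n) / ((s n)\<^sup>2 * real n))" for n
  have g: "\<forall>\<^sub>F n in sequentially. g n = 1 / r n"
  proof (rule always_eventually, rule allI)
    show "g n = 1 / r n" for n
      by (simp add: g_def r_def real_sqrt_divide real_sqrt_mult)
  qed
  have snr: "\<forall>\<^sub>F n in sequentially. snr n = a n / ln (real n) ^ 4"
    using ev
  proof eventually_elim
    case (elim n)
    then have "dF n (\<Delta> n / s n) = a n - \<Delta> n / s n" by blast
    then show ?case unfolding snr_def by simp
  qed
  have a_pos: "\<forall>\<^sub>F n in sequentially. 0 < a n"
    using ev
  proof eventually_elim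
    case (elim n)
    have "0 < 1 / (lower_const * ln (real n) ^ 3 * r n)"
      using elim lc by (intro divide_pos_pos mult_pos_pos zero_less_power) auto
    then show ?case using elim by linarith
  qed
  \<comment> \<open>Counting logarithms: a r contributes one and the low-degree condition two, so
    dividing by the fourth power leaves one to beat the constants.\<close>
  have snr_small: "\<forall>\<^sub>F n in sequentially. gain_const * (2 * ln (real n)) ^ 2 * (snr n * r n) \<le> 1"
  proof -
    have "\<forall>\<^sub>F n in sequentially. 4 * gain_const * upper_const \<le> ln (real n)"
      by real_asymp
    then show ?thesis
      using ev snr
    proof eventually_elim
      case (elim n)
      have l: "1 \<le> ln (real n)" and r: "0 < r n" using elim by auto
      have "a n * r n \<le> upper_const * ln (real n)"
        using elim r by (simp add: pos_le_divide_eq)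
      then have "gain_const * (2 * ln (real n)) ^ 2 * (a n * r n) / ln (real n) ^ 4 \<le>
          gain_const * (2 * ln (real n)) ^ 2 * (upper_const * ln (real n)) / ln (real n) ^ 4"
        using gc l by (intro divide_right_mono mult_left_mono) auto
      also have "\<dots> = 4 * gain_const * upper_const / ln (real n)"
        using l by (simp add: power2_eq_square power4_eq_xxxx)
      also have "\<dots> \<le> 1" using elim l by simp
      finally show ?case using elim by simp
    qed
  qed
  have mmse_snr: "\<forall>\<^sub>F n in sequentially. 0 < snr n \<and> triv n = real n * s n \<and>
      \<bar>mmse n (snr n) - real n * s n\<bar> \<le> 4 * gain_const * ln (real n) ^ 2 * r n"
    using ev snr snr_small a_pos
  proof eventually_elim
    case (elim n)
    then have pos: "0 < snr n" by simp
    have bounds: "real n * s n - gain_const * (2 * ln (real n)) ^ 2 * r n \<le> mmse n (snr n)"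
      "mmse n (snr n) \<le> real n * s n"
      using elim pos by (auto dest: less_imp_le)
    have "gain_const * (2 * ln (real n)) ^ 2 * r n = 4 * gain_const * ln (real n) ^ 2 * r n"
      by (simp add: power_mult_distrib)
    with bounds have "\<bar>mmse n (snr n) - real n * s n\<bar> \<le> 4 * gain_const * ln (real n) ^ 2 * r n"
      by linarith
    with pos elim show ?case by blast
  qed
  have r_eq: "\<forall>\<^sub>F n in sequentially. r n = s n * sqrt (real n / real (p n))"
    using ev
    by eventually_elim (simp add: r_def real_sqrt_mult real_sqrt_divide)
  have claim2: "(\<lambda>n. mmse n (snr n) - real n * s n) \<in> soft_O (\<lambda>n. s n * sqrt (real n / real (p n)))"
  proof (rule soft_O_I)
    show "\<forall>\<^sub>F n in sequentially. \<bar>mmse n (snr n) - real n * s n\<bar> \<le>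
        (4 * gain_const) * \<bar>s n * sqrt (real n / real (p n))\<bar> * ln (real n) ^ 2"
      using mmse_snr r_eq ev
    proof eventually_elim
      case (elim n)
      then have "\<bar>s n * sqrt (real n / real (p n))\<bar> = r n" by simp
      then show ?case using elim by (simp only: mult_ac)
    qed
  qed
  have ratio: "(\<lambda>n. mmse n (snr n) / triv n) \<longlonglongrightarrow> 1"
  proof -
    have "(\<lambda>n. mmse n (snr n) / triv n - 1) \<longlonglongrightarrow> 0"
    proof (rule Lim_null_comparison)
      show "\<forall>\<^sub>F n in sequentially. norm (mmse n (snr n) / triv n - 1) \<le> 4 * gain_const * ln (real n) ^ 2 / sqrt (real n)"
        using mmse_snr ev eventually_ge_at_top[of 1]
      proof eventually_elim
        case (elim n)
        have ns: "0 < real n * s n" using elim by simp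
        have "mmse n (snr n) / triv n - 1 = (mmse n (snr n) - real n * s n) / (real n * s n)"
          using elim ns by (simp add: diff_divide_distrib)
        then have "norm (mmse n (snr n) / triv n - 1) = \<bar>mmse n (snr n) - real n * s n\<bar> / (real n * s n)"
          using ns by (simp add: abs_divide)
        also have "\<dots> \<le> 4 * gain_const * ln (real n) ^ 2 * r n / (real n * s n)"
          using elim ns by (intro divide_right_mono) auto
        also have "\<dots> = 4 * gain_const * ln (real n) ^ 2 * (r n / (real n * s n))" by simp
        \<comment> \<open>The quotient r / (n s) is 1 / sqrt (n p), and p \<ge> 1.\<close>
        also have "\<dots> \<le> 4 * gain_const * ln (real n) ^ 2 * (1 / sqrt (real n))"
        proof (rule mult_left_mono)
          have "(s n)\<^sup>2 / real (p n) \<le> (s n)\<^sup>2 / 1"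
            using p_pos[of n] by (intro divide_left_mono) auto
          then have "r n \<le> sqrt (real n * (s n)\<^sup>2)"
            unfolding r_def by (intro real_sqrt_le_mono mult_left_mono) auto
          also have "\<dots> = sqrt (real n) * s n" using elim by (simp add: real_sqrt_mult)
          finally have "r n / (real n * s n) \<le> sqrt (real n) * s n / (real n * s n)"
            using ns by (intro divide_right_mono) auto
          also have "\<dots> = 1 / sqrt (real n)"
            using elim by (simp add: field_simps)
          finally show "r n / (real n * s n) \<le> 1 / sqrt (real n)" .
        qed (use gc in simp)
        finally show ?case by simp
      qed
      show "(\<lambda>n. 4 * gain_const * ln (real n) ^ 2 / sqrt (real n)) \<longlonglongrightarrow> 0"
        by real_asymp
    qed
    from tendsto_add[OF this tendsto_const[of 1]] show ?thesis by simp
  qed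
  have triv_pos: "\<forall>\<^sub>F n in sequentially. 0 < triv n"
    using mmse_snr ev eventually_ge_at_top[of 1] by eventually_elim simp
  have claim3: "(\<lambda>n. mmse n (snr n)) \<sim>[sequentially] triv"
    using ratio triv_pos by (intro asymp_equivI') (auto elim: eventually_mono)
  \<comment> \<open>The upper bound on a loses one logarithm and the lower bound three, so the power
    3 serves both.\<close>
  have a_Theta: "a \<in> soft_Theta g"
  proof (rule soft_Theta_I[of "max upper_const lower_const" _ _ 3])
    show "0 < max upper_const lower_const" using uc by simp
    show "\<forall>\<^sub>F n in sequentially. \<bar>a n\<bar> \<le> max upper_const lower_const * \<bar>g n\<bar> * ln (real n) ^ 3"
      using ev g a_pos
    proof eventually_elim
      case (elim n)
      have "a n \<le> upper_const * (1 / r n) * ln (real n)" using elim by simp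
      also have "\<dots> \<le> max upper_const lower_const * (1 / r n) * ln (real n) ^ 3"
        using elim uc self_le_power[of "ln (real n)" 3] by (intro mult_mono) auto
      finally show ?case using elim by simp
    qed
    show "\<forall>\<^sub>F n in sequentially. \<bar>g n\<bar> \<le> max upper_const lower_const * \<bar>a n\<bar> * ln (real n) ^ 3"
      using ev g a_pos
    proof eventually_elim
      case (elim n)
      have l: "0 < lower_const * ln (real n) ^ 3" using elim lc by simp
      have "1 / r n / (lower_const * ln (real n) ^ 3) \<le> a n" using elim by (simp add: mult_ac)
      then have "1 / r n \<le> a n * (lower_const * ln (real n) ^ 3)" unfolding pos_divide_le_eq[OF l] .
      also have "\<dots> \<le> a n * (max upper_const lower_const * ln (real n) ^ 3)"
        using elim by (intro mult_left_mono mult_right_mono) auto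
      finally show ?case using elim by (simp add: mult_ac)
    qed
  qed
  have snr_Theta: "snr \<in> soft_Theta a"
  proof (rule soft_Theta_I[of 1 _ _ 4])
    show "\<forall>\<^sub>F n in sequentially. \<bar>snr n\<bar> \<le> 1 * \<bar>a n\<bar> * ln (real n) ^ 4"
      using ev snr a_pos
    proof eventually_elim
      case (elim n)
      have l: "1 \<le> ln (real n) ^ 4" using elim by (intro one_le_power) auto
      have "a n / ln (real n) ^ 4 \<le> a n / 1" using l elim by (intro divide_left_mono) auto
      also have "\<dots> \<le> a n * ln (real n) ^ 4" using l elim by simp
      finally show ?case using elim by simp
    qed
    show "\<forall>\<^sub>F n in sequentially. \<bar>a n\<bar> \<le> 1 * \<bar>snr n\<bar> * ln (real n) ^ 4"
      using ev snr a_pos by eventually_elim simp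
  qed simp
  have lamALG_g: "g \<in> soft_Theta lamALG"
    using lamALG(2) unfolding g_def by (rule soft_Theta_sym)
  \<comment> \<open>The choice \<open>lam = a\<close> is the zero of the derivative, hence the
    witness for the sign claim.\<close>
  have dF_a: "\<forall>\<^sub>F n in sequentially. 0 \<le> dF n (a n)"
    using ev
  proof eventually_elim
    case (elim n)
    then have "dF n (a n) = a n - a n" by blast
    then show ?case by simp
  qed
  show ?thesis
  proof (intro conjI)
    show "\<forall>\<^sub>F n in sequentially.
        q n \<noteq> 0 \<and> (\<exists>f. is_density_off_0 (L n) f) \<and> 0 < density_off_0 (L n) (q n) \<and>
        (\<forall>lam. franz_parisi_ann (L n) lam field_differentiable at (q n)) \<and> 0 \<le> snr n"
      using ev mmse_snr by eventually_elim auto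
    show "\<exists>lam. (\<forall>\<^sub>F n in sequentially. 0 < lam n) \<and>
        lam \<in> soft_Theta (\<lambda>n. sqrt (real (p n) / ((s n)\<^sup>2 * real n))) \<and>
        lam \<in> soft_Theta lamALG \<and>
        (\<forall>\<^sub>F n in sequentially. 0 \<le> dF n (lam n))"
      using a_pos a_Theta soft_Theta_trans[OF a_Theta lamALG_g] dF_a unfolding g_def by blast
    \<comment> \<open>The witness is \<open>snr\<close>, and \<eta> is the relative error itself, so
      the inequality holds with equality.\<close>
    show "\<exists>lam \<eta>. (\<forall>\<^sub>F n in sequentially. 0 < lam n) \<and> lam \<in> soft_Theta lamALG \<and> \<eta> \<longlonglongrightarrow> 0 \<and>
        (\<forall>\<^sub>F n in sequentially. mmse n (lam n) \<ge> (1 + \<eta> n) * triv n)"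
    proof (intro exI conjI)
      show "\<forall>\<^sub>F n in sequentially. 0 < snr n"
        using mmse_snr by eventually_elim simp
      show "snr \<in> soft_Theta lamALG"
        by (rule soft_Theta_trans[OF snr_Theta soft_Theta_trans[OF a_Theta lamALG_g]])
      show "(\<lambda>n. mmse n (snr n) / triv n - 1) \<longlonglongrightarrow> 0"
        using tendsto_diff[OF ratio tendsto_const[of 1]] by simp
      show "\<forall>\<^sub>F n in sequentially. mmse n (snr n) \<ge> (1 + (mmse n (snr n) / triv n - 1)) * triv n"
        using triv_pos by eventually_elim simp
    qed
  qed (rule claim2, rule claim3)
qed

end
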